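(* The operator $\mathcal{R}_\ell^*:V_\ell\to U$ acts on $g\in V_\ell$ as the following two-step operation. (i) Let $\dot w(\gamma,\beta)=\tau(\gamma)\,w(\gamma,\beta)$, with $w=\mathcal{L}g$, be in $V_{\mathsf s}$, where $\tau(\gamma)=D\sec^2\gamma$. (ii) The adjoint operator is obtained as the series $$\widehat{\mathcal{R}_\ell^*g}(\sigma\xi_\theta)=\frac2\sigma\sum_{n=0}^\infty b_n(\theta)J_n(D\sigma),\qquad(\sigma,\theta)\in\mathbb{R}_+\times\mathbb{R}/2\pi\mathbb{Z},$$ where the coefficients $b_n$ are obtained from $\dot z(\gamma,\theta)=\dot w(\gamma,\theta-\gamma)$, treated as a $2\pi$-periodic function of $\gamma$, by $$c_n(\theta)=\frac1{2\pi}\int_0^{2\pi}\dot z(\gamma,\theta)e^{-in\gamma}\,d\gamma,\qquad b_n=2\pi\left[c_n+(-1)^n\overline{c_n}\right]\ (n\ge1),\qquad b_0=2\pi c_0 .$$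
   Context: $D>0$ is the distance from the source to the origin and $\xi_\theta=(\cos\theta,\sin\theta)^T$. $U$ is the space of feature functions on $\mathbb{R}^2$ (the Schwartz space $\mathcal{S}(\mathbb{R}^2)$, extended to an $L^2$ space when adjoints are considered). $V_{\mathsf s}$ is the space of standard fan-beam sinograms $w(\gamma,\beta)$, $(\gamma,\beta)\in\mathbb{R}/\pi\mathbb{Z}\times\mathbb{R}/2\pi\mathbb{Z}$, and $V_\ell$ is the space of linear fan-beam sinograms $g(s,\beta)$, $(s,\beta)\in\mathbb{R}\times\mathbb{R}/2\pi\mathbb{Z}$. The operator $\mathcal{L}:V_\ell\to V_{\mathsf s}$ is $\mathcal{L}g(\gamma,\beta)=g(D\tan\gamma,\beta)$ if $\gamma\neq\pi/2\bmod\pi$, and $0$ otherwise. The Radon transform is $\mathcal{R}f(t,\theta)=\int_{\mathbb{R}^2}f(x)\,\delta(t-x\cdot\xi_\theta)\,dx$, and the linear fan-beam Radon transform $\mathcal{R}_\ell:U\to V_\ell$ is $\mathcal{R}_\ell f(s,\beta)=\mathcal{R}f\big(\frac{sD}{\sqrt{s^2+D^2}},\beta+\arctan\frac sD\big)$. Its adjoint $\mathcal{R}_\ell^*$, i.e. the operator with $\langle\mathcal{R}_\ell f,g\rangle_{V_\ell}=\langle f,\mathcal{R}_\ell^*g\rangle_U$ for the $L^2$ inner products, is $$\mathcal{R}_\ell^*g(x)=\frac1D\int_0^{2\pi}\frac1{U_\beta}\sqrt{s_\beta^2+D^2}\;g(s_\beta,\beta)\,d\beta ,\qquad U_\beta=\frac{D^2-r_\beta\cdot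 x}{D^2},\quad s_\beta=\frac{x\cdot\xi_\beta}{U_\beta},$$ where $r_\beta=D(-\sin\beta,\cos\beta)^T$ is the position of the source. $J_n$ is the Bessel function of the first kind of order $n$, and the bar denotes complex conjugation. The hat on $\mathcal{R}_\ell^*g$ denotes the two-dimensional Fourier transform, evaluated at the frequency $\sigma\xi_\theta$ (polar frequency coordinates). It is normalized so that $\widehat{\mathcal{B}p}(\sigma\xi_\theta)=\hat p(\sigma,\theta)/\sigma$ for $\sigma>0$, where $\mathcal{B}p(x)=\int_0^\pi p(x\cdot\xi_\theta,\theta)\,d\theta$ is the parallel backprojection and $\hat p(\sigma,\theta)=\int_{\mathbb{R}}p(t,\theta)e^{-it\sigma}\,dt$.
   Formalization: Proved for real g integrable in (s,β), with |U_β| for U_β, a distributional transform, and θ where ż is integrable: full-circle c_n require 1/σ, not 2/σ; 2/σ holds if ż is extended by zero from |γ|<π/2 and g depends only on the unoriented line. *)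

theory Defs
  imports "HOL-Analysis.Analysis"
begin

text \<open>
  Points and frequencies of the plane are elements of \<open>real \<times> real\<close>, with its Euclidean inner
  product and norm.  Functions on \<open>\<real>/2\<pi>\<int>\<close> are functions on the reals; periodicity is assumed
  where it is needed.
\<close>

definition xi :: "real \<Rightarrow> real \<times> real" where
  "xi \<theta> = (cos \<theta>, sin \<theta>)"

definition xi_perp :: "real \<Rightarrow> real \<times> real" where
  "xi_perp \<theta> = (- sin \<theta>, cos \<theta>)"

definition source :: "real \<Rightarrow> real \<Rightarrow> real \<times> real" where
  "source D \<beta> = D *\<^sub>R xi_perp \<beta>"


text \<open>
  Schwartz functions: \<open>G i j\<close> is the mixed partial derivative of order \<open>(i, j)\<close>.
\<close>

definition schwartz :: "(real \<times> real \<Rightarrow> complex) \<Rightarrow> bool" where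
  "schwartz f \<longleftrightarrow>
     (\<exists>G :: nat \<Rightarrow> nat \<Rightarrow> real \<times> real \<Rightarrow> complex.
        G 0 0 = f \<and>
        (\<forall>i j x. (G i j has_derivative
                  (\<lambda>h. fst h *\<^sub>R G (Suc i) j x + snd h *\<^sub>R G i (Suc j) x)) (at x)) \<and>
        (\<forall>i j N. \<exists>C. \<forall>x. (1 + norm x) ^ N * norm (G i j x) \<le> C))"

text \<open>
  The factor \<open>1 / (2\<pi>)\<close> is the one for which the transform of the parallel backprojection
  \<open>\<integral>\<^sub>0\<^sup>\<pi> p (x \<bullet> \<xi>\<^sub>\<theta>, \<theta>) d\<theta>\<close> of an even \<open>p\<close> (that is, \<open>p (-t, \<theta> + \<pi>) = p (t, \<theta>)\<close>)
  equals \<open>p^(\<sigma>, \<theta>) / \<sigma>\<close> at \<open>\<sigma> \<xi>\<^sub>\<theta>\<close>: write \<open>p\<close> as the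
  inverse one-dimensional transform of \<open>p^\<close> and pass from polar to Cartesian coordinates.
\<close>

definition fourier :: "(real \<times> real \<Rightarrow> complex) \<Rightarrow> real \<times> real \<Rightarrow> complex" where
  "fourier \<phi> k = complex_of_real (1 / (2 * pi)) * (LINT x|lborel. \<phi> x * cis (- (k \<bullet> x)))"

text \<open>
  A backprojection decays only like \<open>1 / norm x\<close>, so in general it is neither integrable nor square
  integrable over the plane.  Its Fourier transform is therefore the one of tempered distributions,
  and \<open>has_fourier h F\<close> says that this distribution is the function \<open>F\<close>.  (A Gaussian and its
  transform vanish nowhere, so the integrability clauses force \<open>h\<close> and \<open>F\<close> to be measurable and
  locally integrable.)
\<close>

definition has_fourier :: "(real \<times> real \<Rightarrow> complex) \<Rightarrow> (real \<times> real \<Rightarrow> complex) \<Rightarrow> bool" where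
  "has_fourier h F \<longleftrightarrow>
     (\<forall>\<phi>. schwartz \<phi> \<longrightarrow>
        integrable lborel (\<lambda>x. h x * fourier \<phi> x) \<and>
        integrable lborel (\<lambda>k. F k * \<phi> k) \<and>
        (LINT x|lborel. h x * fourier \<phi> x) = (LINT k|lborel. F k * \<phi> k))"


text \<open>
  Integrating against \<open>\<delta> (t - x \<bullet> \<xi>\<^sub>\<theta>)\<close> is integrating over the line \<open>x \<bullet> \<xi>\<^sub>\<theta> = t\<close> with respect
  to arc length, as \<open>\<xi>\<^sub>\<theta>\<close> is a unit vector.
\<close>

definition radon :: "(real \<times> real \<Rightarrow> complex) \<Rightarrow> real \<Rightarrow> real \<Rightarrow> complex" where
  "radon f t \<theta> = (LINT u|lborel. f (t *\<^sub>R xi \<theta> + u *\<^sub>R xi_perp \<theta>))"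

definition fan_radon :: "real \<Rightarrow> (real \<times> real \<Rightarrow> complex) \<Rightarrow> real \<Rightarrow> real \<Rightarrow> complex" where
  "fan_radon D f s \<beta> = radon f (s * D / sqrt (s\<^sup>2 + D\<^sup>2)) (\<beta> + arctan (s / D))"

definition fan_U :: "real \<Rightarrow> real \<Rightarrow> real \<times> real \<Rightarrow> real" where
  "fan_U D \<beta> x = (D\<^sup>2 - source D \<beta> \<bullet> x) / D\<^sup>2"

definition fan_s :: "real \<Rightarrow> real \<Rightarrow> real \<times> real \<Rightarrow> real" where
  "fan_s D \<beta> x = (x \<bullet> xi \<beta>) / fan_U D \<beta> x"

text \<open>
  For \<open>norm x < D\<close> the weight \<open>fan_U D \<beta> x\<close> is positive and the absolute value is redundant.  It matters
  at points \<open>x\<close> behind the source, which lie on the (full) lines integrated over by \<open>fan_radon\<close>: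
  there the change of variables from \<open>x\<close> to \<open>s\<close> has Jacobian \<open>\<bar>fan_U D \<beta> x\<bar>\<close>, and without
  absolute value the operator would not be the adjoint.
\<close>

definition fan_adjoint :: "real \<Rightarrow> (real \<Rightarrow> real \<Rightarrow> real) \<Rightarrow> real \<times> real \<Rightarrow> real" where
  "fan_adjoint D g x =
     1 / D * (LINT \<beta>:{0..2 * pi}|lborel.
        1 / \<bar>fan_U D \<beta> x\<bar> * sqrt ((fan_s D \<beta> x)\<^sup>2 + D\<^sup>2) * g (fan_s D \<beta> x) \<beta>)"

text \<open>
  \<open>h\<close> is the image of \<open>g\<close> under the adjoint of \<open>fan_radon D\<close> for the \<open>L\<^sup>2\<close> inner products.  As \<open>g\<close>
  and \<open>h\<close> are real, no conjugation is needed.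
\<close>

definition is_fan_adjoint_image ::
    "real \<Rightarrow> (real \<Rightarrow> real \<Rightarrow> real) \<Rightarrow> (real \<times> real \<Rightarrow> real) \<Rightarrow> bool" where
  "is_fan_adjoint_image D g h \<longleftrightarrow>
     (\<forall>f. schwartz f \<longrightarrow>
        set_integrable lborel (UNIV \<times> {0..2 * pi})
          (\<lambda>(s, \<beta>). fan_radon D f s \<beta> * complex_of_real (g s \<beta>)) \<and>
        integrable lborel (\<lambda>x. f x * complex_of_real (h x)) \<and>
        (LINT y:UNIV \<times> {0..2 * pi}|lborel.
           (case y of (s, \<beta>) \<Rightarrow> fan_radon D f s \<beta> * complex_of_real (g s \<beta>))) =
        (LINT x|lborel. f x * complex_of_real (h x)))"


text \<open>
  Integrability is what the Fourier integrals in \<open>\<gamma>\<close> require: for fixed \<open>\<theta>\<close>, the substitution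
  \<open>s = D tan \<gamma>\<close> turns \<open>D sec\<^sup>2 \<gamma> d\<gamma>\<close> into \<open>ds\<close>.
\<close>

definition fan_data :: "(real \<Rightarrow> real \<Rightarrow> real) \<Rightarrow> bool" where
  "fan_data g \<longleftrightarrow>
     (\<forall>s \<beta>. g s (\<beta> + 2 * pi) = g s \<beta>) \<and>
     set_integrable lborel (UNIV \<times> {0..2 * pi}) (\<lambda>(s, \<beta>). g s \<beta>)"

text \<open>
  The parameters \<open>(s, \<beta>)\<close> and \<open>(-s, \<beta> + \<pi> + 2 arctan (s / D))\<close> describe the same line; they
  correspond to \<open>(t, \<theta>)\<close> and \<open>(-t, \<theta> + \<pi>)\<close>.  Data that are functions of the unoriented
  line, such as all \<open>fan_radon D f\<close>, agree at both.
\<close>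

definition line_consistent :: "real \<Rightarrow> (real \<Rightarrow> real \<Rightarrow> real) \<Rightarrow> bool" where
  "line_consistent D g \<longleftrightarrow> (\<forall>s \<beta>. g (- s) (\<beta> + pi + 2 * arctan (s / D)) = g s \<beta>)"


definition lin_to_std :: "real \<Rightarrow> (real \<Rightarrow> real \<Rightarrow> real) \<Rightarrow> real \<Rightarrow> real \<Rightarrow> real" where
  "lin_to_std D g \<gamma> \<beta> =
     (if \<exists>k::int. \<gamma> = pi / 2 + of_int k * pi then 0 else g (D * tan \<gamma>) \<beta>)"

definition tau :: "real \<Rightarrow> real \<Rightarrow> real" where
  "tau D \<gamma> = D * (1 / cos \<gamma>)\<^sup>2"

definition wdot :: "real \<Rightarrow> (real \<Rightarrow> real \<Rightarrow> real) \<Rightarrow> real \<Rightarrow> real \<Rightarrow> real" where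
  "wdot D g \<gamma> \<beta> = tau D \<gamma> * lin_to_std D g \<gamma> \<beta>"

definition zdot :: "real \<Rightarrow> (real \<Rightarrow> real \<Rightarrow> real) \<Rightarrow> real \<Rightarrow> real \<Rightarrow> real" where
  "zdot D g \<theta> \<gamma> = wdot D g \<gamma> (\<theta> - \<gamma>)"

text \<open>
  Two \<open>2\<pi>\<close>-periodic functions of \<open>\<gamma>\<close> come from the values of \<open>zdot D g \<theta>\<close> on the fan
  \<open>\<bar>\<gamma>\<bar> < \<pi>/2\<close>: \<open>zdot D g \<theta>\<close> itself, which on \<open>\<pi>/2 < \<gamma> < 3\<pi>/2\<close> traverses the fan once
  more through the \<open>\<pi>\<close>-periodicity of \<open>wdot\<close> in \<open>\<gamma>\<close>, and the \<open>2\<pi>\<close>-periodic extension by zero,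
  below.  For line-consistent data \<open>zdot D g \<theta> (\<pi> - \<gamma>) = zdot D g \<theta> \<gamma>\<close>, so the Bessel series
  of the first is twice that of the second.
\<close>

definition zdot_fan :: "real \<Rightarrow> (real \<Rightarrow> real \<Rightarrow> real) \<Rightarrow> real \<Rightarrow> real \<Rightarrow> real" where
  "zdot_fan D g \<theta> \<gamma> = (if cos \<gamma> > 0 then zdot D g \<theta> \<gamma> else 0)"

definition fourier_coeff :: "(real \<Rightarrow> real) \<Rightarrow> nat \<Rightarrow> complex" where
  "fourier_coeff z n =
     complex_of_real (1 / (2 * pi)) *
       (LINT \<gamma>:{0..2 * pi}|lborel. complex_of_real (z \<gamma>) * cis (- (real n * \<gamma>)))"

definition bessel_coeff :: "(real \<Rightarrow> real) \<Rightarrow> nat \<Rightarrow> complex" where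
  "bessel_coeff z n =
     (if n = 0 then complex_of_real (2 * pi) * fourier_coeff z 0
      else complex_of_real (2 * pi) * (fourier_coeff z n + (- 1) ^ n * cnj (fourier_coeff z n)))"

definition bessel_J :: "nat \<Rightarrow> real \<Rightarrow> real" where
  "bessel_J n x = (\<Sum>k. (- 1) ^ k / (fact k * fact (k + n)) * (x / 2) ^ (2 * k + n))"

end

theory Submission
  imports Defs "HOL-Probability.Probability"
begin

text \<open>
  Write \<open>Z \<theta> \<sigma>\<close> for the integral of \<open>zdot D g \<theta> \<gamma> * cis (- D \<sigma> sin \<gamma>)\<close> over one period of \<open>\<gamma>\<close>
  (\<open>zdot_spectrum\<close>).  The theorem says that the adjoint image has the Fourier transform
  \<open>Z \<theta> \<sigma> / \<sigma>\<close> at \<open>\<sigma> \<xi>\<^sub>\<theta>\<close>, and that \<open>Z \<theta> \<sigma>\<close> is the sum of the Bessel series.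

  The second point is the Jacobi--Anger expansion of \<open>cis (- x sin \<gamma>)\<close> (\<open>jacobi_anger\<close>), integrated
  term by term (\<open>bessel_coeff_series\<close>): for real data the coefficients \<open>c\<^sub>n\<close> and
  \<open>c\<^bsub>-n\<^esub>\<close> are conjugate, and \<open>J\<^bsub>-n\<^esub> = (-1)\<^sup>n J\<^sub>n\<close>, so the terms of indices
  \<open>n\<close> and \<open>- n\<close> combine to the coefficient \<open>b\<^sub>n\<close>.

  For the first point let \<open>\<phi>\<close> be a Schwartz function and \<open>f\<close> its Fourier transform.
  \<^item> For fixed \<open>\<beta>\<close>, the pair formed by \<open>s\<close> and a parameter along the line from the source through
    \<open>s \<xi>\<^sub>\<beta>\<close> is a coordinate system of the plane, in which the area element times the weight of the
    adjoint is \<open>ds\<close> times arc length along the line.  So the pairing of \<open>f\<close> with the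
    adjoint image is the pairing of the fan-beam transform of \<open>f\<close> with \<open>g\<close>
    (\<open>fan_adjoint_pairing\<close>).  This needs no more of \<open>f\<close> than quadratic decay, which makes all line
    integrals of \<open>f\<close> uniformly bounded; the Fourier transform of a Schwartz function decays that
    fast by integration by parts (\<open>fourier_schwartz_decay\<close>).
  \<^item> The substitutions \<open>s = D tan \<gamma>\<close> and \<open>\<theta> = \<beta> + \<gamma>\<close> turn this pairing into the integral of
    \<open>zdot D g \<theta> \<gamma>\<close> times the Radon transform of \<open>f\<close> at \<open>(D sin \<gamma>, \<theta>)\<close>, with \<open>\<gamma>\<close> over the fan
    \<open>\<bar>\<gamma>\<bar> < \<pi>/2\<close> and \<open>\<theta>\<close> over a full period.  The integrand takes equal values at \<open>(\<theta> + \<pi>, \<gamma>)\<close> and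
    \<open>(\<theta>, \<gamma> + \<pi>)\<close>, so \<open>\<theta>\<close> can be restricted to \<open>\<bar>\<theta>\<bar> < \<pi>/2\<close> if \<open>\<gamma>\<close> runs over a full period
    (\<open>fan_pairing_parallel\<close>).
  \<^item> By the Fourier slice theorem the Radon transform of \<open>f\<close> at \<open>(t, \<theta>)\<close> is the integral of
    \<open>\<phi> (\<sigma> \<xi>\<^sub>\<theta>) * cis (- \<sigma> t)\<close> over all real \<open>\<sigma>\<close> (\<open>fourier_slice\<close>).  Inserting this gives
    the integral of \<open>Z \<theta> \<sigma> * \<phi> (\<sigma> \<xi>\<^sub>\<theta>)\<close> over \<open>\<bar>\<theta>\<bar> < \<pi>/2\<close> and real \<open>\<sigma>\<close>, which in polar coordinates,
    where the area element is \<open>\<bar>\<sigma>\<bar> d\<sigma> d\<theta>\<close>, is the pairing of \<open>\<phi>\<close> with \<open>Z \<theta> \<sigma> / \<bar>\<sigma>\<bar>\<close>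
    (\<open>adjoint_spectrum_pairing\<close>).

  For line-consistent data, \<open>zdot\<close> and \<open>sin\<close> are both invariant under \<open>\<gamma> \<mapsto> \<pi> - \<gamma>\<close>, so the two half
  periods \<open>cos \<gamma> > 0\<close> and \<open>cos \<gamma> < 0\<close> contribute equally to \<open>Z\<close>.  This gives the form of the series
  with the factor \<open>2\<close>.
\<close>

section \<open>Bessel series\<close>

lemma bessel_series_bound:
  fixes x :: real
  shows "norm ((- 1) ^ k / (fact k * fact (k + n)) * (x / 2) ^ (2 * k + n))
           \<le> \<bar>x / 2\<bar> ^ n / fact n * (((x / 2)\<^sup>2) ^ k / fact k)"
proof -
  have "(fact n :: real) \<le> fact (k + n)"
    by (simp add: fact_mono)
  then have "1 / (fact k * fact (k + n)) \<le> 1 / (fact k * fact n :: real)"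
    by (intro divide_left_mono mult_left_mono) auto
  then have "1 / (fact k * fact (k + n)) * \<bar>x / 2\<bar> ^ (2 * k + n)
      \<le> 1 / (fact k * fact n) * \<bar>x / 2\<bar> ^ (2 * k + n)"
    by (intro mult_right_mono) auto
  moreover have "(\<bar>x / 2\<bar>\<^sup>2) ^ k = (\<bar>x / 2\<bar> ^ k)\<^sup>2"
    by (simp only: power_mult[symmetric] mult.commute)
  ultimately show ?thesis
    unfolding power2_abs[of "x / 2", symmetric]
    by (simp add: norm_mult abs_mult power_abs power_add power_mult mult_ac del: power2_abs)
qed

lemma exp_sums_real: "(\<lambda>k. x ^ k / fact k) sums exp x" for x :: real
  using exp_converges[of x] by (simp add: field_simps)

lemma exp_bessel_bound_summable:
  fixes x :: real
  shows "summable (\<lambda>k. \<bar>x / 2\<bar> ^ n / fact n * (((x / 2)\<^sup>2) ^ k / fact k))"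
  by (intro summable_mult sums_summable[OF exp_sums_real])

lemma bessel_series_abs_summable:
  fixes x :: real
  shows "summable (\<lambda>k. norm ((- 1) ^ k / (fact k * fact (k + n)) * (x / 2) ^ (2 * k + n)))"
  by (rule summable_comparison_test'[OF exp_bessel_bound_summable[of x n], of 0])
     (use bessel_series_bound[of _ n x] in simp)

lemma abs_bessel_J_le: "\<bar>bessel_J n x\<bar> \<le> \<bar>x / 2\<bar> ^ n / fact n * exp ((x / 2)\<^sup>2)"
proof -
  have "\<bar>bessel_J n x\<bar> \<le> (\<Sum>k. norm ((- 1) ^ k / (fact k * fact (k + n)) * (x / 2) ^ (2 * k + n)))"
    unfolding bessel_J_def real_norm_def[symmetric]
    by (rule summable_norm[OF bessel_series_abs_summable])
  also have "\<dots> \<le> (\<Sum>k. \<bar>x / 2\<bar> ^ n / fact n * (((x / 2)\<^sup>2) ^ k / fact k))"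
    by (intro suminf_le bessel_series_bound bessel_series_abs_summable exp_bessel_bound_summable)
  also have "\<dots> = \<bar>x / 2\<bar> ^ n / fact n * exp ((x / 2)\<^sup>2)"
    by (intro sums_unique[symmetric] sums_mult exp_sums_real)
  finally show ?thesis .
qed

lemma summable_bessel_J: "summable (\<lambda>n. \<bar>bessel_J n x\<bar>)"
proof (rule summable_comparison_test')
  show "summable (\<lambda>n. \<bar>x / 2\<bar> ^ n / fact n * exp ((x / 2)\<^sup>2))"
    by (intro summable_mult2 sums_summable[OF exp_sums_real])
qed (use abs_bessel_J_le in auto)

lemma has_sum_exp:
  fixes u :: complex
  shows "((\<lambda>m. u ^ m / fact m) has_sum exp u) UNIV"
proof (rule norm_summable_imp_has_sum)
  show "summable (\<lambda>m. norm (u ^ m / fact m))"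
    using sums_summable[OF exp_sums_real[of "norm u"]] by (simp add: norm_divide norm_power)
  show "(\<lambda>m. u ^ m / fact m) sums exp u"
    using exp_converges[of u] by (simp add: scaleR_conv_of_real field_simps)
qed

lemma bessel_J_sums:
  fixes x :: real
  shows "((\<lambda>k. complex_of_real ((- 1) ^ k / (fact k * fact (k + n)) * (x / 2) ^ (2 * k + n)))
    has_sum complex_of_real (bessel_J n x)) UNIV"
proof (rule norm_summable_imp_has_sum)
  show "summable (\<lambda>k. norm (complex_of_real ((- 1) ^ k / (fact k * fact (k + n)) * (x / 2) ^ (2 * k + n))))"
    unfolding norm_of_real using bessel_series_abs_summable[of n x] by simp
  show "(\<lambda>k. complex_of_real ((- 1) ^ k / (fact k * fact (k + n)) * (x / 2) ^ (2 * k + n))) sums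
      complex_of_real (bessel_J n x)"
    unfolding bessel_J_def
    by (intro sums_of_real summable_sums summable_norm_cancel[OF bessel_series_abs_summable])
qed

text \<open>
  The factor of \<open>J\<^sub>n\<close> in the Jacobi--Anger expansion once the terms of indices \<open>n\<close> and \<open>- n\<close> are
  combined.  Its integral against real data \<open>z\<close> is the coefficient \<open>bessel_coeff z n\<close>.
\<close>

definition angular_mode :: "nat \<Rightarrow> real \<Rightarrow> complex" where
  "angular_mode n \<gamma> =
     (if n = 0 then 1 else cis (- (real n * \<gamma>)) + (- 1) ^ n * cis (real n * \<gamma>))"

text \<open>
  With \<open>w = cis \<gamma>\<close>, the exponent \<open>- \<i> x sin \<gamma>\<close> is \<open>(x/2) / w - (x/2) w\<close>.  Multiplying the exponential
  series of the two summands and collecting the products of powers whose exponents differ by \<open>n\<close>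
  gives the series of \<open>J\<^sub>n\<close>.
\<close>

lemma jacobi_anger:
  "(\<lambda>n. complex_of_real (bessel_J n x) * angular_mode n \<gamma>) sums cis (- (x * sin \<gamma>))"
proof -
  define u where "u = complex_of_real (x / 2) * cis (- \<gamma>)"
  define v where "v = - complex_of_real (x / 2) * cis \<gamma>"
  define A :: "nat \<times> nat \<Rightarrow> complex" where "A = (\<lambda>(m, k). u ^ m / fact m * (v ^ k / fact k))"
  let ?c = "\<lambda>n k. complex_of_real ((- 1) ^ k / (fact k * fact (k + n)) * (x / 2) ^ (2 * k + n))"
  have cancel: "cis (- \<gamma>) ^ k * cis \<gamma> ^ k = 1" for k
    by (simp add: power_mult_distrib[symmetric] cis_mult)
  have A1: "A (n + k, k) = cis (- (real n * \<gamma>)) * ?c n k" for n k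
  proof -
    have "A (n + k, k) = cis (- \<gamma>) ^ n * (cis (- \<gamma>) ^ k * cis \<gamma> ^ k) * ?c n k"
      unfolding A_def u_def v_def prod.case power_mult_distrib
        power_minus[of "complex_of_real (x / 2)"] power_add mult_2
      by (simp add: add.commute mult_ac power_add)
    then show ?thesis by (simp only: cancel) (simp add: Complex.DeMoivre)
  qed
  have A2: "A (m, n + m) = (- 1) ^ n * cis (real n * \<gamma>) * ?c n m" for n m
  proof -
    have "A (m, n + m) = (- 1) ^ n * cis \<gamma> ^ n * (cis (- \<gamma>) ^ m * cis \<gamma> ^ m) * ?c n m"
      unfolding A_def u_def v_def prod.case power_mult_distrib
        power_minus[of "complex_of_real (x / 2)"] power_add mult_2
      by (simp add: add.commute mult_ac power_add)
    then show ?thesis by (simp only: cancel) (simp add: Complex.DeMoivre)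
  qed
  have nsum: "(\<lambda>m. norm (u ^ m / fact m)) summable_on UNIV" for u :: complex
    using sums_summable[OF exp_sums_real[of "norm u"]]
    by (intro norm_summable_imp_summable_on) (simp add: norm_divide norm_power)
  have "(\<lambda>p. norm (A p)) summable_on (UNIV \<times> UNIV)"
    unfolding Infinite_Sum.abs_summable_on_Sigma_iff A_def prod.case norm_mult
    using nsum[of v] nsum[of u]
    by (auto simp: infsum_cmult_right' abs_mult infsum_nonneg
        intro!: summable_on_cmult_left summable_on_cmult_right)
  then have Asum: "A summable_on (UNIV \<times> UNIV)"
    by (rule Infinite_Sum.abs_summable_summable)
  have "(A has_sum (\<Sum>\<^sub>\<infinity>p. A p)) (UNIV \<times> UNIV)"
    using Asum by simp
  from has_sum_SigmaD[OF this, of "\<lambda>m. u ^ m / fact m * exp v"]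
  have "((\<lambda>m. u ^ m / fact m * exp v) has_sum (\<Sum>\<^sub>\<infinity>p. A p)) UNIV"
    unfolding A_def prod.case using has_sum_cmult_right[OF has_sum_exp[of v]] by blast
  with has_sum_cmult_left[OF has_sum_exp[of u]] have "(\<Sum>\<^sub>\<infinity>p. A p) = exp u * exp v"
    using has_sum_unique by blast
  also have "\<dots> = cis (- (x * sin \<gamma>))"
  proof -
    have "u + v = \<i> * complex_of_real (- (x * sin \<gamma>))"
      by (simp add: u_def v_def complex_eq_iff algebra_simps)
    then show ?thesis by (simp only: exp_add[symmetric] cis_conv_exp)
  qed
  finally have Aval: "(\<Sum>\<^sub>\<infinity>p. A p) = cis (- (x * sin \<gamma>))" .
  \<comment> \<open>the terms with \<open>m - k = n \<ge> 0\<close> give \<open>J\<^sub>n\<close>, those with \<open>k - m = n > 0\<close> give \<open>(-1)\<^sup>n J\<^sub>n\<close>\<close>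
  define S1 where "S1 = {p :: nat \<times> nat. snd p \<le> fst p}"
  define S2 where "S2 = {p :: nat \<times> nat. fst p < snd p}"
  have UN: "S1 \<union> S2 = UNIV \<times> UNIV" "S1 \<inter> S2 = {}"
    by (auto simp: S1_def S2_def)
  have s1: "A summable_on S1" and s2: "A summable_on S2"
    using summable_on_subset_banach[OF Asum] UN by auto
  have "((\<lambda>(n, k). A (n + k, k)) has_sum infsum A S1) (UNIV \<times> UNIV)"
    using has_sum_infsum[OF s1]
    by (subst has_sum_reindex_bij_witness[where i = "\<lambda>(m, k). (m - k, k)" and j = "\<lambda>(n, k). (n + k, k)"
          and T = S1 and h = A and s' = "infsum A S1"]) (auto simp: S1_def)
  from has_sum_SigmaD[OF this, of "\<lambda>n. cis (- (real n * \<gamma>)) * complex_of_real (bessel_J n x)"]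
  have "((\<lambda>n. cis (- (real n * \<gamma>)) * complex_of_real (bessel_J n x)) has_sum infsum A S1) UNIV"
    using has_sum_cmult_right[OF bessel_J_sums] by (simp add: A1)
  from has_sum_imp_sums[OF this]
  have r1: "(\<lambda>n. cis (- (real n * \<gamma>)) * complex_of_real (bessel_J n x)) sums infsum A S1" .
  have "((\<lambda>(n, m). A (m, Suc n + m)) has_sum infsum A S2) (UNIV \<times> UNIV)"
    using has_sum_infsum[OF s2]
    by (subst has_sum_reindex_bij_witness[where i = "\<lambda>(m, k). (k - Suc m, m)" and j = "\<lambda>(n, m). (m, Suc n + m)"
          and T = S2 and h = A and s' = "infsum A S2"]) (auto simp: S2_def)
  from has_sum_SigmaD[OF this, of "\<lambda>n. (- 1) ^ Suc n * cis (real (Suc n) * \<gamma>) * complex_of_real (bessel_J (Suc n) x)"]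
  have "((\<lambda>n. (- 1) ^ Suc n * cis (real (Suc n) * \<gamma>) * complex_of_real (bessel_J (Suc n) x)) has_sum infsum A S2) UNIV"
    unfolding prod.case A2 using has_sum_cmult_right[OF bessel_J_sums] by blast
  from has_sum_imp_sums[OF this]
  have r2: "(\<lambda>n. if n = 0 then 0 else (- 1) ^ n * cis (real n * \<gamma>) * complex_of_real (bessel_J n x)) sums infsum A S2"
    using sums_Suc_iff[of "\<lambda>n. if n = 0 then 0 else (- 1) ^ n * cis (real n * \<gamma>) * complex_of_real (bessel_J n x)"
        "infsum A S2"] by simp
  have "infsum A S1 + infsum A S2 = cis (- (x * sin \<gamma>))"
    using infsum_Un_disjoint[OF s1 s2 UN(2)] UN(1) Aval by simp
  moreover have "cis (- (real n * \<gamma>)) * complex_of_real (bessel_J n x)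
      + (if n = 0 then 0 else (- 1) ^ n * cis (real n * \<gamma>) * complex_of_real (bessel_J n x))
      = complex_of_real (bessel_J n x) * angular_mode n \<gamma>" for n
    by (simp add: angular_mode_def algebra_simps)
  ultimately show ?thesis
    using sums_add[OF r1 r2] by simp
qed

lemma norm_angular_mode_le: "norm (angular_mode n \<gamma>) \<le> 2"
  unfolding angular_mode_def
  by (auto intro!: order_trans[OF norm_triangle_ineq] simp: norm_mult norm_power)

lemma borel_measurable_cis [measurable]: "cis \<in> borel_measurable borel"
  by (intro borel_measurable_continuous_onI continuous_intros)

lemma borel_measurable_angular_mode [measurable]: "angular_mode n \<in> borel_measurable borel"
  unfolding angular_mode_def by measurable

lemma set_integrable_mult_bounded:
  fixes z :: "'a \<Rightarrow> 'b :: {real_normed_algebra, banach, second_countable_topology}"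
  assumes "set_integrable M S z" and [measurable]: "f \<in> borel_measurable M"
    and "\<And>x. norm (f x) \<le> C"
  shows "set_integrable M S (\<lambda>x. z x * f x)"
  unfolding set_integrable_def
proof (rule Bochner_Integration.integrable_bound)
  show "integrable M (\<lambda>x. C * norm (indicator S x *\<^sub>R z x))"
    using assms(1) unfolding set_integrable_def by (intro integrable_mult_right integrable_norm)
  show "(\<lambda>x. indicat_real S x *\<^sub>R (z x * f x)) \<in> borel_measurable M"
    using assms(1)[unfolded set_integrable_def, THEN borel_measurable_integrable]
    unfolding mult_scaleR_left[symmetric] by measurable
  show "AE x in M. norm (indicat_real S x *\<^sub>R (z x * f x)) \<le> norm (C * norm (indicat_real S x *\<^sub>R z x))"
  proof (rule AE_I2)
    fix x
    have "norm (z x * f x) \<le> norm (z x) * C"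
      by (rule order_trans[OF norm_mult_ineq mult_left_mono[OF assms(3)]]) simp
    moreover have "0 \<le> C" using assms(3)[of x] norm_ge_zero[of "f x"] by linarith
    ultimately show "norm (indicat_real S x *\<^sub>R (z x * f x)) \<le> norm (C * norm (indicat_real S x *\<^sub>R z x))"
      by (auto simp: abs_mult mult_ac split: split_indicator)
  qed
qed

lemma bessel_coeff_eq:
  assumes z: "set_integrable lborel {0..2 * pi} z"
  shows "bessel_coeff z n = (LINT \<gamma>:{0..2 * pi}|lborel. complex_of_real (z \<gamma>) * angular_mode n \<gamma>)"
proof -
  have zc: "set_integrable lborel {0..2 * pi} (\<lambda>\<gamma>. complex_of_real (z \<gamma>))"
    using integrable_of_real[OF z[unfolded set_integrable_def], where 'a = complex]
    by (simp add: set_integrable_def scaleR_conv_of_real)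
  have i: "set_integrable lborel {0..2 * pi} (\<lambda>\<gamma>. complex_of_real (z \<gamma>) * cis (c * \<gamma>))" for c
    by (rule set_integrable_mult_bounded[OF zc, of _ 1]) auto
  show ?thesis
  proof (cases "n = 0")
    case True
    then show ?thesis by (simp add: bessel_coeff_def fourier_coeff_def angular_mode_def)
  next
    case False
    have "cnj (LINT \<gamma>:{0..2 * pi}|lborel. complex_of_real (z \<gamma>) * cis (- (real n * \<gamma>)))
        = (LINT \<gamma>:{0..2 * pi}|lborel. complex_of_real (z \<gamma>) * cis (real n * \<gamma>))"
      unfolding set_lebesgue_integral_def
      by (simp add: cis_cnj flip: Bochner_Integration.integral_cnj)
    moreover have "(LINT \<gamma>:{0..2 * pi}|lborel. complex_of_real (z \<gamma>) * angular_mode n \<gamma>)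
      = (LINT \<gamma>:{0..2 * pi}|lborel. complex_of_real (z \<gamma>) * cis (- (real n * \<gamma>)))
        + (- 1) ^ n * (LINT \<gamma>:{0..2 * pi}|lborel. complex_of_real (z \<gamma>) * cis (real n * \<gamma>))"
      using False i[of "- real n"] set_integrable_mult_right[OF i[of "real n"], of "(- 1) ^ n"]
      unfolding set_integral_mult_right[symmetric]
      by (subst set_integral_add(2)[symmetric]) (simp_all add: angular_mode_def algebra_simps)
    ultimately show ?thesis
      using False by (simp add: bessel_coeff_def fourier_coeff_def field_simps)
  qed
qed

lemma bessel_coeff_series:
  assumes z: "set_integrable lborel {0..2 * pi} z"
  shows "(\<lambda>n. bessel_coeff z n * complex_of_real (bessel_J n x)) sums
    (LINT \<gamma>:{0..2 * pi}|lborel. complex_of_real (z \<gamma>) * cis (- (x * sin \<gamma>)))"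
proof -
  let ?f = "\<lambda>n \<gamma>. indicator {0..2 * pi} \<gamma> *\<^sub>R (complex_of_real (z \<gamma>) *
    (complex_of_real (bessel_J n x) * angular_mode n \<gamma>))"
  have zc: "set_integrable lborel {0..2 * pi} (\<lambda>\<gamma>. complex_of_real (z \<gamma>))"
    using integrable_of_real[OF z[unfolded set_integrable_def], where 'a = complex]
    by (simp add: set_integrable_def scaleR_conv_of_real)
  have int: "integrable lborel (?f n)" for n
    unfolding set_integrable_def[symmetric]
    by (rule set_integrable_mult_bounded[OF zc, of _ "\<bar>bessel_J n x\<bar> * 2"])
       (auto simp: norm_mult intro!: mult_left_mono norm_angular_mode_le)
  have bound: "norm (?f n \<gamma>) \<le> 2 * \<bar>bessel_J n x\<bar> * norm (indicator {0..2 * pi} \<gamma> *\<^sub>R z \<gamma>)" for n \<gamma>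
    using mult_left_mono[OF norm_angular_mode_le[of n \<gamma>], of "\<bar>z \<gamma>\<bar> * \<bar>bessel_J n x\<bar>"]
    by (simp add: norm_mult mult_ac split: split_indicator)
  have zn: "integrable lborel (\<lambda>\<gamma>. norm (indicator {0..2 * pi} \<gamma> *\<^sub>R z \<gamma>))"
    using z unfolding set_integrable_def by (rule integrable_norm)
  have "(\<lambda>n. integral\<^sup>L lborel (?f n)) sums (LINT \<gamma>|lborel. (\<Sum>n. ?f n \<gamma>))"
  proof (rule sums_integral[OF int])
    show "AE \<gamma> in lborel. summable (\<lambda>n. norm (?f n \<gamma>))"
      by (intro AE_I2 summable_comparison_test'[of _ 0, OF summable_mult2[OF summable_mult[OF summable_bessel_J]]])
         (use bound in auto)
    show "summable (\<lambda>n. LINT \<gamma>|lborel. norm (?f n \<gamma>))"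
    proof (rule summable_comparison_test'[of _ 0])
      let ?I = "LINT \<gamma>|lborel. norm (indicator {0..2 * pi} \<gamma> *\<^sub>R z \<gamma>)"
      show "summable (\<lambda>n. 2 * \<bar>bessel_J n x\<bar> * ?I)"
        by (intro summable_mult2 summable_mult summable_bessel_J)
      fix n :: nat
      have "(LINT \<gamma>|lborel. norm (?f n \<gamma>)) \<le> (LINT \<gamma>|lborel. 2 * \<bar>bessel_J n x\<bar> * norm (indicator {0..2 * pi} \<gamma> *\<^sub>R z \<gamma>))"
        by (intro integral_mono integrable_norm[OF int] integrable_mult_right zn bound)
      then show "norm (LINT \<gamma>|lborel. norm (?f n \<gamma>)) \<le> 2 * \<bar>bessel_J n x\<bar> * ?I"
        by simp
    qed
  qed
  moreover have "(\<Sum>n. ?f n \<gamma>) = indicator {0..2 * pi} \<gamma> *\<^sub>R (complex_of_real (z \<gamma>) * cis (- (x * sin \<gamma>)))" for \<gamma>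
    by (intro sums_unique[symmetric] sums_scaleR_right sums_mult jacobi_anger)
  moreover have "integral\<^sup>L lborel (?f n) = bessel_coeff z n * complex_of_real (bessel_J n x)" for n
    unfolding bessel_coeff_eq[OF z] set_lebesgue_integral_def[symmetric] set_integral_mult_left[symmetric]
    by (simp add: mult_ac)
  ultimately show ?thesis
    by (simp add: set_lebesgue_integral_def)
qed

section \<open>Changes of variables\<close>

text \<open>
  The image of the measure \<open>w dM\<close> under \<open>T\<close> is \<open>N\<close>.  Every change of variables below is
  first established for nonnegative functions; this lemma carries it over to vector-valued ones.
\<close>

lemma change_of_variables:
  fixes f :: "'b \<Rightarrow> 'c :: {banach, second_countable_topology}" and w :: "'a \<Rightarrow> real"
  assumes T [measurable]: "T \<in> M \<rightarrow>\<^sub>M N" and w [measurable]: "w \<in> borel_measurable M"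
    and nonneg: "\<And>x. 0 \<le> w x"
    and eq: "\<And>A. A \<in> sets N \<Longrightarrow> emeasure N A = (\<integral>\<^sup>+x. ennreal (w x) * indicator A (T x) \<partial>M)"
    and f [measurable]: "f \<in> borel_measurable N"
  shows "integrable N f \<longleftrightarrow> integrable M (\<lambda>x. w x *\<^sub>R f (T x))"
    and "integral\<^sup>L N f = (LINT x|M. w x *\<^sub>R f (T x))"
proof -
  have N: "distr (density M (\<lambda>x. ennreal (w x))) N T = N"
  proof (rule measure_eqI)
    fix A assume "A \<in> sets (distr (density M (\<lambda>x. ennreal (w x))) N T)"
    then have A [measurable]: "A \<in> sets N" by simp
    have "emeasure (distr (density M (\<lambda>x. ennreal (w x))) N T) A
        = (\<integral>\<^sup>+x. ennreal (w x) * indicator (T -` A \<inter> space M) x \<partial>M)"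
      by (subst emeasure_distr) (auto simp: emeasure_density)
    also have "\<dots> = emeasure N A"
      by (subst eq[OF A]) (auto intro!: nn_integral_cong split: split_indicator)
    finally show "emeasure (distr (density M (\<lambda>x. ennreal (w x))) N T) A = emeasure N A" .
  qed simp
  have "integrable (distr (density M (\<lambda>x. ennreal (w x))) N T) f
      \<longleftrightarrow> integrable M (\<lambda>x. w x *\<^sub>R f (T x))"
    using nonneg by (subst integrable_distr_eq) (auto simp: integrable_density)
  then show "integrable N f \<longleftrightarrow> integrable M (\<lambda>x. w x *\<^sub>R f (T x))"
    by (simp add: N)
  have "integral\<^sup>L (distr (density M (\<lambda>x. ennreal (w x))) N T) f = (LINT x|M. w x *\<^sub>R f (T x))"
    using nonneg by (subst integral_distr) (auto simp: integral_density)
  then show "integral\<^sup>L N f = (LINT x|M. w x *\<^sub>R f (T x))"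
    by (simp add: N)
qed

subsection \<open>Periodic functions\<close>

lemma nn_integral_periodic:
  fixes f :: "real \<Rightarrow> ennreal" and p :: real
  assumes [measurable]: "f \<in> borel_measurable borel" and p: "p > 0" and per: "\<And>x. f (x + p) = f x"
  shows "(\<integral>\<^sup>+x. indicator {a..<a + p} x * f x \<partial>lborel) = (\<integral>\<^sup>+x. indicator {0..<p} x * f x \<partial>lborel)"
proof -
  define P where "P a = (\<integral>\<^sup>+x. indicator {a..<a + p} x * f x \<partial>lborel)" for a
  have shift: "(\<integral>\<^sup>+x. indicator {u + p..<v + p} x * f x \<partial>lborel) = (\<integral>\<^sup>+x. indicator {u..<v} x * f x \<partial>lborel)" for u v
    by (subst nn_integral_real_affine[where t = p and c = 1])
       (auto simp: add.commute[of p] per split: split_indicator intro!: nn_integral_cong)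
  have add: "(\<integral>\<^sup>+x. indicator {u..<v} x * f x \<partial>lborel) + (\<integral>\<^sup>+x. indicator {v..<w} x * f x \<partial>lborel)
      = (\<integral>\<^sup>+x. indicator {u..<w} x * f x \<partial>lborel)" if "u \<le> v" "v \<le> w" for u v w
    using that by (subst nn_integral_add[symmetric])
       (auto split: split_indicator intro!: nn_integral_cong)
  have step: "P (a + p) = P a" for a
    using shift[of a "a + p"] by (simp add: P_def)
  have steps: "P (a + real n * p) = P a" for a n
    by (induction n) (use step in \<open>auto simp: algebra_simps\<close>, metis add.assoc add.commute step)
  have base: "P a = P 0" if "0 \<le> a" "a \<le> p" for a
    using shift[of 0 a] add[of 0 a p] add[of a p "a + p"] that
    by (simp add: P_def add.commute)
  define k where "k = \<lfloor>a / p\<rfloor>"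
  have k: "of_int k * p \<le> a" "a \<le> of_int k * p + p"
    using p of_int_floor_le[of "a / p"] real_of_int_floor_add_one_ge[of "a / p"] unfolding k_def
    by (simp_all only: pos_le_divide_eq pos_divide_le_eq ring_distribs mult_1)
  have "P a = P (a - of_int k * p)"
    using steps[of "a - of_int k * p" "nat k"] steps[of a "nat (- k)"] by (cases "0 \<le> k") auto
  also have "\<dots> = P 0"
    using k by (intro base) auto
  finally show ?thesis by (simp add: P_def)
qed

lemma set_integral_periodic:
  fixes f :: "real \<Rightarrow> 'b :: {banach, second_countable_topology}" and p :: real
  assumes [measurable]: "f \<in> borel_measurable borel" and p: "p > 0" and per: "\<And>x. f (x + p) = f x"
  shows "set_integrable lborel {a..<a + p} f \<longleftrightarrow> set_integrable lborel {b..<b + p} f"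
    and "(LINT x:{a..<a + p}|lborel. f x) = (LINT x:{b..<b + p}|lborel. f x)"
proof -
  \<comment> \<open>reduction modulo the period to the interval from \<open>0\<close> to \<open>p\<close>\<close>
  define T where "T x = x - p * of_int \<lfloor>x / p\<rfloor>" for x :: real
  have [measurable]: "T \<in> borel_measurable borel"
    unfolding T_def by measurable
  have Tper: "T (x + p) = T x" for x
    using p by (simp add: T_def add_divide_distrib algebra_simps)
  have T0: "T x = x" if "x \<in> {0..<p}" for x
    using that p by (simp add: T_def floor_eq_iff)
  have pern: "f (x + real n * p) = f x" for x n
    by (induction n) (use per in \<open>auto simp: algebra_simps\<close>, metis add.assoc add.commute per)
  have fT: "f (T x) = f x" for x
    using pern[of "T x" "nat \<lfloor>x / p\<rfloor>"] pern[of x "nat (- \<lfloor>x / p\<rfloor>)"]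
    by (cases "0 \<le> \<lfloor>x / p\<rfloor>") (auto simp: T_def algebra_simps)
  define N where "N = density lborel (indicator {0..<p})"
  have fN: "f \<in> borel_measurable N" by (simp add: N_def)
  have sN [simp]: "sets N = sets borel" "space N = UNIV" by (simp_all add: N_def)
  have eq: "emeasure N A = (\<integral>\<^sup>+x. ennreal (indicator {c..<c + p} x) * indicator A (T x) \<partial>lborel)"
    if "A \<in> sets N" for A c
  proof -
    from that have [measurable]: "A \<in> sets borel" by simp
    have "emeasure N A = (\<integral>\<^sup>+x. indicator {0..<p} x * indicator A (T x) \<partial>lborel)"
      unfolding N_def by (subst emeasure_density) (auto simp: T0 intro!: nn_integral_cong split: split_indicator)
    also have "\<dots> = (\<integral>\<^sup>+x. indicator {c..<c + p} x * indicator A (T x) \<partial>lborel)"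
      by (rule nn_integral_periodic[symmetric]) (use p Tper in auto)
    finally show ?thesis by (simp add: ennreal_indicator)
  qed
  have "T \<in> lborel \<rightarrow>\<^sub>M N"
    by (simp add: N_def cong: measurable_cong_sets)
  have w: "indicat_real {c..<c + p} \<in> borel_measurable lborel" for c
    by measurable
  have i: "set_integrable lborel {c..<c + p} f \<longleftrightarrow> integrable N f"
    and v: "(LINT x:{c..<c + p}|lborel. f x) = integral\<^sup>L N f" for c
    unfolding set_integrable_def set_lebesgue_integral_def
    using change_of_variables[OF \<open>T \<in> lborel \<rightarrow>\<^sub>M N\<close> w _ eq[of _ c] fN]
    by (simp_all only: fT indicator_pos_le)
  show "set_integrable lborel {a..<a + p} f \<longleftrightarrow> set_integrable lborel {b..<b + p} f"
    and "(LINT x:{a..<a + p}|lborel. f x) = (LINT x:{b..<b + p}|lborel. f x)"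
    by (simp_all add: i v)
qed

subsection \<open>The tangent substitution\<close>

text \<open>
  The fan \<open>\<bar>\<gamma>\<bar> < \<pi>/2\<close>.  It also serves as the range of directions \<open>\<theta>\<close> for which the lines
  \<open>\<real> \<xi>\<^sub>\<theta>\<close> cover the plane once, up to a null set.
\<close>

abbreviation half_circle :: "real set" where
  "half_circle \<equiv> {- (pi / 2)<..<pi / 2}"

lemma nn_integral_tan:
  fixes f :: "real \<Rightarrow> ennreal"
  assumes [measurable]: "f \<in> borel_measurable borel"
  shows "(\<integral>\<^sup>+s. f s \<partial>lborel) = (\<integral>\<^sup>+\<gamma>. ennreal (indicator half_circle \<gamma> / (cos \<gamma>)\<^sup>2) * f (tan \<gamma>) \<partial>lborel)"
proof -
  define a where "a n = arctan (real (Suc n))" for n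
  have a: "0 < a n" "a n < pi / 2" "tan (a n) = real (Suc n)" "tan (- a n) = - real (Suc n)" for n
    using arctan_ubound by (auto simp: a_def tan_arctan)
  have mono: "incseq a" by (auto simp: a_def incseq_def intro: arctan_monotone')
  have lim: "a \<longlonglongrightarrow> pi / 2"
    unfolding a_def by (rule filterlim_compose[OF tendsto_arctan_at_top])
      (intro filterlim_compose[OF filterlim_real_sequentially] filterlim_Suc)
  have "(\<integral>\<^sup>+s. f s * indicator {- real (Suc n)..real (Suc n)} s \<partial>lborel)
      = (\<integral>\<^sup>+\<gamma>. f (tan \<gamma>) * ennreal (inverse ((cos \<gamma>)\<^sup>2)) * indicator {- a n..a n} \<gamma> \<partial>lborel)" for n
    unfolding a(3)[symmetric, of n] tan_minus[symmetric]
  proof (rule nn_integral_substitution_aux)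
    have c: "cos x \<noteq> 0" if "x \<in> {- a n..a n}" for x
      using that a(2)[of n] by (intro less_imp_neq[symmetric] cos_gt_zero_pi) auto
    show "(tan has_real_derivative inverse ((cos x)\<^sup>2)) (at x)" if "x \<in> {- a n..a n}" for x
      using c[OF that] by (rule DERIV_tan)
    show "continuous_on {- a n..a n} (\<lambda>x. inverse ((cos x)\<^sup>2))"
      using c by (auto intro!: continuous_intros)
    show "- a n < a n" using a(1)[of n] by simp
  qed auto
  moreover have "(\<lambda>n. \<integral>\<^sup>+s. f s * indicator {- real (Suc n)..real (Suc n)} s \<partial>lborel) \<longlonglongrightarrow> (\<integral>\<^sup>+s. f s \<partial>lborel)"
  proof (rule nn_integral_LIMSEQ)
    show "incseq (\<lambda>n s. f s * indicator {- real (Suc n)..real (Suc n)} s)"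
      by (auto simp: incseq_def le_fun_def split: split_indicator)
    fix s :: real
    have "eventually (\<lambda>n. f s * indicator {- real (Suc n)..real (Suc n)} s = f s) sequentially"
      using eventually_ge_at_top[of "nat \<lceil>\<bar>s\<bar>\<rceil>"]
      by eventually_elim (auto split: split_indicator simp: nat_le_iff ceiling_le_iff abs_le_iff)
    then show "(\<lambda>n. f s * indicator {- real (Suc n)..real (Suc n)} s) \<longlonglongrightarrow> f s"
      by (rule tendsto_eventually)
  qed simp
  moreover have "(\<lambda>n. \<integral>\<^sup>+\<gamma>. f (tan \<gamma>) * ennreal (inverse ((cos \<gamma>)\<^sup>2)) * indicator {- a n..a n} \<gamma> \<partial>lborel)
      \<longlonglongrightarrow> (\<integral>\<^sup>+\<gamma>. ennreal (indicator half_circle \<gamma> / (cos \<gamma>)\<^sup>2) * f (tan \<gamma>) \<partial>lborel)"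
  proof (rule nn_integral_LIMSEQ)
    show "incseq (\<lambda>n \<gamma>. f (tan \<gamma>) * ennreal (inverse ((cos \<gamma>)\<^sup>2)) * indicator {- a n..a n} \<gamma>)"
      using incseqD[OF mono] by (fastforce simp: incseq_def le_fun_def split: split_indicator)
    show "(\<lambda>\<gamma>. f (tan \<gamma>) * ennreal (inverse ((cos \<gamma>)\<^sup>2)) * indicator {- a i..a i} \<gamma>) \<in> borel_measurable lborel" for i
      unfolding tan_def by measurable
    fix \<gamma> :: real
    show "(\<lambda>n. f (tan \<gamma>) * ennreal (inverse ((cos \<gamma>)\<^sup>2)) * indicator {- a n..a n} \<gamma>)
      \<longlonglongrightarrow> ennreal (indicator half_circle \<gamma> / (cos \<gamma>)\<^sup>2) * f (tan \<gamma>)"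
    proof (cases "\<gamma> \<in> half_circle")
      case True
      then have "\<bar>\<gamma>\<bar> < pi / 2" by auto
      from order_tendstoD(1)[OF lim this]
      have "eventually (\<lambda>n. f (tan \<gamma>) * ennreal (inverse ((cos \<gamma>)\<^sup>2)) * indicator {- a n..a n} \<gamma>
        = ennreal (indicator half_circle \<gamma> / (cos \<gamma>)\<^sup>2) * f (tan \<gamma>)) sequentially"
        by eventually_elim (use True in \<open>auto simp: mult.commute field_simps split: split_indicator\<close>)
      then show ?thesis by (rule tendsto_eventually)
    next
      case False
      then have "\<gamma> \<notin> {- a n..a n}" for n
        using a(2)[of n] by auto
      then show ?thesis using False by simp
    qed
  qed
  ultimately show ?thesis
    using LIMSEQ_unique by auto
qed

subsection \<open>Changes of variables in the plane\<close>

lemma nn_integral_lborel_pair: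
  fixes f :: "'a::euclidean_space \<times> 'b::euclidean_space \<Rightarrow> ennreal"
  assumes [measurable]: "f \<in> borel_measurable borel"
  shows "(\<integral>\<^sup>+x. f x \<partial>lborel) = (\<integral>\<^sup>+a. \<integral>\<^sup>+b. f (a, b) \<partial>lborel \<partial>lborel)"
    and "(\<integral>\<^sup>+x. f x \<partial>lborel) = (\<integral>\<^sup>+b. \<integral>\<^sup>+a. f (a, b) \<partial>lborel \<partial>lborel)"
proof -
  have [measurable]: "f \<in> borel_measurable (lborel \<Otimes>\<^sub>M lborel)"
    by (simp add: lborel_prod)
  show "(\<integral>\<^sup>+x. f x \<partial>lborel) = (\<integral>\<^sup>+a. \<integral>\<^sup>+b. f (a, b) \<partial>lborel \<partial>lborel)"
    unfolding lborel_prod[symmetric] by (rule lborel.nn_integral_fst[symmetric]) measurable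
  show "(\<integral>\<^sup>+x. f x \<partial>lborel) = (\<integral>\<^sup>+b. \<integral>\<^sup>+a. f (a, b) \<partial>lborel \<partial>lborel)"
    unfolding lborel_prod[symmetric]
    by (rule lborel_pair.nn_integral_snd[symmetric]) measurable
qed

lemma borel_measurable_xi [measurable]: "xi \<in> borel_measurable borel" "xi_perp \<in> borel_measurable borel"
  unfolding xi_def[abs_def] xi_perp_def[abs_def] borel_prod[symmetric] by measurable

text \<open>
  Invariance under rotations, proved by one-dimensional substitutions: if \<open>cos \<beta> \<noteq> 0\<close>, the new
  abscissa \<open>x\<close> replaces \<open>a\<close> for fixed \<open>b\<close>, and then the new ordinate replaces \<open>b\<close> for fixed \<open>x\<close>.
  Otherwise the rotation exchanges the axes up to signs.
\<close>

lemma nn_integral_rotation: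
  fixes f :: "real \<times> real \<Rightarrow> ennreal"
  assumes f [measurable]: "f \<in> borel_measurable borel"
  shows "(\<integral>\<^sup>+x. f x \<partial>lborel) = (\<integral>\<^sup>+b. \<integral>\<^sup>+a. f (a *\<^sub>R xi \<beta> + b *\<^sub>R xi_perp \<beta>) \<partial>lborel \<partial>lborel)"
proof -
  define c s where "c = cos \<beta>" and "s = sin \<beta>"
  have cs: "c * c + s * s = 1" by (simp add: c_def s_def flip: power2_eq_square)
  have fm [measurable]: "(\<lambda>x. f (u x, v x)) \<in> borel_measurable M"
    if "u \<in> borel_measurable M" "v \<in> borel_measurable M" for u v and M :: "'x measure"
    using that f by (auto intro: measurable_compose[OF _ f] borel_measurable_Pair)
  show ?thesis
  proof (cases "c = 0")
    case False
    have "(\<integral>\<^sup>+b. \<integral>\<^sup>+a. f (c * a - s * b, s * a + c * b) \<partial>lborel \<partial>lborel)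
        = (\<integral>\<^sup>+b. \<integral>\<^sup>+x. ennreal \<bar>1 / c\<bar> * f (x, s / c * x + 1 / c * b) \<partial>lborel \<partial>lborel)"
    proof (rule nn_integral_cong)
      fix b
      have "(\<integral>\<^sup>+a. f (c * a - s * b, s * a + c * b) \<partial>lborel)
        = ennreal \<bar>1 / c\<bar> * (\<integral>\<^sup>+x. f (c * (s * b / c + 1 / c * x) - s * b, s * (s * b / c + 1 / c * x) + c * b) \<partial>lborel)"
        using False by (intro nn_integral_real_affine) auto
      also have "\<dots> = (\<integral>\<^sup>+x. ennreal \<bar>1 / c\<bar> * f (x, s / c * x + 1 / c * b) \<partial>lborel)"
      proof (subst nn_integral_cmult[symmetric])
        have "c * (s * b / c + 1 / c * x) - s * b = x" "s * (s * b / c + 1 / c * x) + c * b = s / c * x + 1 / c * b" for x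
          using False cs by (auto simp: field_simps) (metis cs distrib_left mult.right_neutral)
        then show "(\<integral>\<^sup>+x. ennreal \<bar>1 / c\<bar> * f (c * (s * b / c + 1 / c * x) - s * b, s * (s * b / c + 1 / c * x) + c * b) \<partial>lborel)
          = (\<integral>\<^sup>+x. ennreal \<bar>1 / c\<bar> * f (x, s / c * x + 1 / c * b) \<partial>lborel)" by simp
      qed auto
      finally show "(\<integral>\<^sup>+a. f (c * a - s * b, s * a + c * b) \<partial>lborel)
        = (\<integral>\<^sup>+x. ennreal \<bar>1 / c\<bar> * f (x, s / c * x + 1 / c * b) \<partial>lborel)" .
    qed
    also have "\<dots> = (\<integral>\<^sup>+x. \<integral>\<^sup>+b. ennreal \<bar>1 / c\<bar> * f (x, s / c * x + 1 / c * b) \<partial>lborel \<partial>lborel)"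
      by (rule lborel_pair.Fubini') measurable
    also have "\<dots> = (\<integral>\<^sup>+x. \<integral>\<^sup>+y. f (x, y) \<partial>lborel \<partial>lborel)"
    proof (rule nn_integral_cong)
      fix x
      show "(\<integral>\<^sup>+b. ennreal \<bar>1 / c\<bar> * f (x, s / c * x + 1 / c * b) \<partial>lborel) = (\<integral>\<^sup>+y. f (x, y) \<partial>lborel)"
        using False by (subst nn_integral_real_affine[where t = "s / c * x" and c = "1 / c"]) (auto simp: nn_integral_cmult)
    qed
    finally show ?thesis
      by (simp add: nn_integral_lborel_pair(1)[OF f] xi_def xi_perp_def c_def s_def algebra_simps)
  next
    case True
    then have s: "s = 1 \<or> s = -1" using cs by (auto simp: square_eq_1_iff)
    have "(\<integral>\<^sup>+b. \<integral>\<^sup>+a. f (c * a - s * b, s * a + c * b) \<partial>lborel \<partial>lborel)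
      = (\<integral>\<^sup>+b. \<integral>\<^sup>+a. f (- s * b, s * a) \<partial>lborel \<partial>lborel)"
      using True by simp
    also have "\<dots> = (\<integral>\<^sup>+b. \<integral>\<^sup>+a. f (- s * b, a) \<partial>lborel \<partial>lborel)"
    proof (rule nn_integral_cong)
      fix b show "(\<integral>\<^sup>+a. f (- s * b, s * a) \<partial>lborel) = (\<integral>\<^sup>+a. f (- s * b, a) \<partial>lborel)"
        using s by (subst (2) nn_integral_real_affine[where t = 0 and c = s]) auto
    qed
    also have "\<dots> = (\<integral>\<^sup>+b. \<integral>\<^sup>+a. f (b, a) \<partial>lborel \<partial>lborel)"
      using s by (subst (3) nn_integral_real_affine[where t = 0 and c = "- s"]) auto
    finally show ?thesis
      by (simp add: nn_integral_lborel_pair(1)[OF f] xi_def xi_perp_def c_def s_def algebra_simps)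
  qed
qed

text \<open>
  Polar coordinates with directions in a half circle and a signed radius.  For fixed \<open>x\<close> the
  substitution \<open>y = x tan \<theta>\<close>, and then for fixed \<open>\<theta>\<close> the substitution \<open>x = \<sigma> cos \<theta>\<close>, reduce them to
  the one-dimensional case.
\<close>

lemma nn_integral_polar:
  fixes f :: "real \<times> real \<Rightarrow> ennreal"
  assumes f [measurable]: "f \<in> borel_measurable borel"
  shows "(\<integral>\<^sup>+x. f x \<partial>lborel) = (\<integral>\<^sup>+\<theta>. \<integral>\<^sup>+\<sigma>. ennreal (indicator half_circle \<theta> * \<bar>\<sigma>\<bar>) * f (\<sigma> *\<^sub>R xi \<theta>) \<partial>lborel \<partial>lborel)"
proof -
  have fm [measurable]: "(\<lambda>x. f (u x, v x)) \<in> borel_measurable M"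
    if "u \<in> borel_measurable M" "v \<in> borel_measurable M" for u v and M :: "'x measure"
    using that f by (auto intro: measurable_compose[OF _ f] borel_measurable_Pair)
  have [measurable]: "(tan :: real \<Rightarrow> real) \<in> borel_measurable borel"
    unfolding tan_def by measurable
  let ?w = "\<lambda>\<theta>. indicator half_circle \<theta> / (cos \<theta>)\<^sup>2"
  have "(\<integral>\<^sup>+x. f x \<partial>lborel) = (\<integral>\<^sup>+x. \<integral>\<^sup>+y. f (x, y) \<partial>lborel \<partial>lborel)"
    by (rule nn_integral_lborel_pair(1)[OF f])
  also have "\<dots> = (\<integral>\<^sup>+x. \<integral>\<^sup>+\<theta>. ennreal \<bar>x\<bar> * (ennreal (?w \<theta>) * f (x, x * tan \<theta>)) \<partial>lborel \<partial>lborel)"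
  proof (intro nn_integral_cong_AE)
    have "AE x in lborel. x \<noteq> (0 :: real)" by (rule AE_lborel_singleton)
    then show "AE x in lborel. (\<integral>\<^sup>+y. f (x, y) \<partial>lborel) = (\<integral>\<^sup>+\<theta>. ennreal \<bar>x\<bar> * (ennreal (?w \<theta>) * f (x, x * tan \<theta>)) \<partial>lborel)"
    proof eventually_elim
      fix x :: real assume x: "x \<noteq> 0"
      have "(\<integral>\<^sup>+y. f (x, y) \<partial>lborel) = ennreal \<bar>x\<bar> * (\<integral>\<^sup>+y. f (x, 0 + x * y) \<partial>lborel)"
        using x by (intro nn_integral_real_affine) auto
      also have "\<dots> = ennreal \<bar>x\<bar> * (\<integral>\<^sup>+\<theta>. ennreal (?w \<theta>) * f (x, 0 + x * tan \<theta>) \<partial>lborel)"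
        by (subst nn_integral_tan) auto
      finally show "(\<integral>\<^sup>+y. f (x, y) \<partial>lborel) = (\<integral>\<^sup>+\<theta>. ennreal \<bar>x\<bar> * (ennreal (?w \<theta>) * f (x, x * tan \<theta>)) \<partial>lborel)"
        by (subst nn_integral_cmult) auto
    qed
  qed
  also have "\<dots> = (\<integral>\<^sup>+\<theta>. \<integral>\<^sup>+x. ennreal \<bar>x\<bar> * (ennreal (?w \<theta>) * f (x, x * tan \<theta>)) \<partial>lborel \<partial>lborel)"
    by (rule lborel_pair.Fubini') measurable
  also have "\<dots> = (\<integral>\<^sup>+\<theta>. \<integral>\<^sup>+\<sigma>. ennreal (indicator half_circle \<theta> * \<bar>\<sigma>\<bar>) * f (\<sigma> *\<^sub>R xi \<theta>) \<partial>lborel \<partial>lborel)"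
  proof (rule nn_integral_cong)
    fix \<theta> :: real
    show "(\<integral>\<^sup>+x. ennreal \<bar>x\<bar> * (ennreal (?w \<theta>) * f (x, x * tan \<theta>)) \<partial>lborel)
      = (\<integral>\<^sup>+\<sigma>. ennreal (indicator half_circle \<theta> * \<bar>\<sigma>\<bar>) * f (\<sigma> *\<^sub>R xi \<theta>) \<partial>lborel)"
    proof (cases "\<theta> \<in> half_circle")
      case True
      then have c: "cos \<theta> > 0" by (intro cos_gt_zero_pi) auto
      have "(\<integral>\<^sup>+x. ennreal \<bar>x\<bar> * (ennreal (?w \<theta>) * f (x, x * tan \<theta>)) \<partial>lborel)
        = ennreal \<bar>cos \<theta>\<bar> * (\<integral>\<^sup>+\<sigma>. ennreal \<bar>0 + cos \<theta> * \<sigma>\<bar> * (ennreal (?w \<theta>) * f (0 + cos \<theta> * \<sigma>, (0 + cos \<theta> * \<sigma>) * tan \<theta>)) \<partial>lborel)"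
        using c by (intro nn_integral_real_affine) auto
      also have "\<dots> = (\<integral>\<^sup>+\<sigma>. ennreal \<bar>cos \<theta>\<bar> * (ennreal \<bar>0 + cos \<theta> * \<sigma>\<bar> * (ennreal (?w \<theta>) * f (0 + cos \<theta> * \<sigma>, (0 + cos \<theta> * \<sigma>) * tan \<theta>))) \<partial>lborel)"
        by (rule nn_integral_cmult[symmetric]) measurable
      also have "\<dots> = (\<integral>\<^sup>+\<sigma>. ennreal (indicator half_circle \<theta> * \<bar>\<sigma>\<bar>) * f (\<sigma> *\<^sub>R xi \<theta>) \<partial>lborel)"
      proof (rule nn_integral_cong)
        fix \<sigma>
        have "ennreal \<bar>cos \<theta>\<bar> * (ennreal \<bar>cos \<theta> * \<sigma>\<bar> * ennreal (1 / (cos \<theta>)\<^sup>2)) = ennreal \<bar>\<sigma>\<bar>"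
          using c by (simp add: abs_mult power2_eq_square flip: ennreal_mult)
        moreover have "(cos \<theta> * \<sigma>, cos \<theta> * \<sigma> * tan \<theta>) = \<sigma> *\<^sub>R xi \<theta>"
          using c by (simp add: xi_def tan_def)
        ultimately show "ennreal \<bar>cos \<theta>\<bar> * (ennreal \<bar>0 + cos \<theta> * \<sigma>\<bar> * (ennreal (?w \<theta>) * f (0 + cos \<theta> * \<sigma>, (0 + cos \<theta> * \<sigma>) * tan \<theta>)))
          = ennreal (indicator half_circle \<theta> * \<bar>\<sigma>\<bar>) * f (\<sigma> *\<^sub>R xi \<theta>)"
          using True by (simp flip: mult.assoc)
      qed
      finally show ?thesis .
    qed simp
  qed
  finally show ?thesis .
qed

text \<open>
  The point at parameter \<open>l\<close> on the line from the source, where \<open>l = 0\<close>, to the point \<open>s \<xi>\<^sub>\<beta>\<close>, where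
  \<open>l = 1\<close>.
\<close>

definition fan_point :: "real \<Rightarrow> real \<Rightarrow> real \<times> real \<Rightarrow> real \<times> real" where
  "fan_point D \<beta> = (\<lambda>(s, l). (l * s) *\<^sub>R xi \<beta> + (D * (1 - l)) *\<^sub>R xi_perp \<beta>)"

text \<open>
  The area element in the coordinates \<open>(s, l)\<close> is \<open>D \<bar>l\<bar> ds dl\<close>: the coordinate along \<open>\<xi>\<^sub>\<beta>\<^sup>\<bottom>\<close> is
  affine in \<open>l\<close>, and for fixed \<open>l\<close> the coordinate along \<open>\<xi>\<^sub>\<beta>\<close> is \<open>l s\<close>.
\<close>

lemma nn_integral_fan:
  fixes f :: "real \<times> real \<Rightarrow> ennreal"
  assumes f [measurable]: "f \<in> borel_measurable borel" and D: "D > 0"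
  shows "(\<integral>\<^sup>+x. f x \<partial>lborel) = (\<integral>\<^sup>+l. \<integral>\<^sup>+s. ennreal (D * \<bar>l\<bar>) * f (fan_point D \<beta> (s, l)) \<partial>lborel \<partial>lborel)"
proof -
  have fm [measurable]: "(\<lambda>x. f (u x *\<^sub>R xi \<beta> + v x *\<^sub>R xi_perp \<beta>)) \<in> borel_measurable M"
    if "u \<in> borel_measurable M" "v \<in> borel_measurable M" for u v and M :: "'x measure"
    by (rule measurable_compose[OF _ f]) (use that in measurable)
  have "(\<integral>\<^sup>+x. f x \<partial>lborel) = (\<integral>\<^sup>+b. \<integral>\<^sup>+a. f (a *\<^sub>R xi \<beta> + b *\<^sub>R xi_perp \<beta>) \<partial>lborel \<partial>lborel)"
    by (rule nn_integral_rotation[OF f])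
  also have "\<dots> = ennreal \<bar>- D\<bar> * (\<integral>\<^sup>+l. \<integral>\<^sup>+a. f (a *\<^sub>R xi \<beta> + (D + (- D) * l) *\<^sub>R xi_perp \<beta>) \<partial>lborel \<partial>lborel)"
    using D by (intro nn_integral_real_affine) auto
  also have "\<dots> = (\<integral>\<^sup>+l. ennreal D * (\<integral>\<^sup>+a. f (a *\<^sub>R xi \<beta> + (D + (- D) * l) *\<^sub>R xi_perp \<beta>) \<partial>lborel) \<partial>lborel)"
    using D by (subst nn_integral_cmult) auto
  also have "\<dots> = (\<integral>\<^sup>+l. \<integral>\<^sup>+s. ennreal (D * \<bar>l\<bar>) * f (fan_point D \<beta> (s, l)) \<partial>lborel \<partial>lborel)"
  proof (intro nn_integral_cong_AE)
    have "AE l in lborel. l \<noteq> (0 :: real)" by (rule AE_lborel_singleton)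
    then show "AE l in lborel. ennreal D * (\<integral>\<^sup>+a. f (a *\<^sub>R xi \<beta> + (D + (- D) * l) *\<^sub>R xi_perp \<beta>) \<partial>lborel)
      = (\<integral>\<^sup>+s. ennreal (D * \<bar>l\<bar>) * f (fan_point D \<beta> (s, l)) \<partial>lborel)"
    proof eventually_elim
      fix l :: real assume l: "l \<noteq> 0"
      have "(\<integral>\<^sup>+a. f (a *\<^sub>R xi \<beta> + (D + (- D) * l) *\<^sub>R xi_perp \<beta>) \<partial>lborel)
        = ennreal \<bar>l\<bar> * (\<integral>\<^sup>+s. f ((0 + l * s) *\<^sub>R xi \<beta> + (D + (- D) * l) *\<^sub>R xi_perp \<beta>) \<partial>lborel)"
        using l by (intro nn_integral_real_affine) auto
      then show "ennreal D * (\<integral>\<^sup>+a. f (a *\<^sub>R xi \<beta> + (D + (- D) * l) *\<^sub>R xi_perp \<beta>) \<partial>lborel)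
        = (\<integral>\<^sup>+s. ennreal (D * \<bar>l\<bar>) * f (fan_point D \<beta> (s, l)) \<partial>lborel)"
        using D unfolding fan_point_def
        by (simp add: nn_integral_cmult ennreal_mult mult.assoc right_diff_distrib)
    qed
  qed
  finally show ?thesis .
qed

section \<open>The Fourier transform of a Schwartz function\<close>

lemma integrable_inverse_one_plus_square: "integrable lborel (\<lambda>x::real. 1 / (1 + x\<^sup>2))"
  using integrable_inverse_1_plus_square by (simp add: set_integrable_def inverse_eq_divide)

lemma integrable_dominated_by_product:
  fixes f :: "'a::euclidean_space \<times> 'b::euclidean_space \<Rightarrow> 'c :: {banach, second_countable_topology}"
  assumes f [measurable]: "f \<in> borel_measurable borel"
    and u: "integrable lborel (u :: 'a \<Rightarrow> real)" and v: "integrable lborel (v :: 'b \<Rightarrow> real)"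
    and bound: "\<And>x y. norm (f (x, y)) \<le> u x * v y"
  shows "integrable lborel f"
proof (rule Bochner_Integration.integrable_bound)
  note [measurable] = u[THEN borel_measurable_integrable] v[THEN borel_measurable_integrable]
  have "integrable (lborel \<Otimes>\<^sub>M lborel) (\<lambda>p :: 'a \<times> 'b. u (fst p) * v (snd p))"
  proof (rule lborel_pair.Fubini_integrable)
    show "integrable lborel (\<lambda>x. LINT y|lborel. norm (u (fst (x, y)) * v (snd (x, y))))"
      using u by (simp add: abs_mult)
    show "AE x in lborel. integrable lborel (\<lambda>y. u (fst (x, y)) * v (snd (x, y)))"
      using v by simp
  qed measurable
  then show "integrable lborel (\<lambda>p :: 'a \<times> 'b. u (fst p) * v (snd p))"
    by (simp add: lborel_prod)
  show "AE p in lborel. norm (f p) \<le> norm (u (fst p) * v (snd p))"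
  proof (rule AE_I2)
    fix p :: "'a \<times> 'b"
    have "norm (f p) \<le> u (fst p) * v (snd p)"
      using bound[of "fst p" "snd p"] by simp
    also have "\<dots> \<le> norm (u (fst p) * v (snd p))"
      by simp
    finally show "norm (f p) \<le> norm (u (fst p) * v (snd p))" .
  qed
qed simp

lemma decay_in_coordinates:
  assumes "(1 + norm x) ^ 4 * y \<le> C" and x: "(norm x)\<^sup>2 = a\<^sup>2 + b\<^sup>2" and y: "0 \<le> y"
  shows "y \<le> C / ((1 + a\<^sup>2) * (1 + b\<^sup>2))"
proof -
  have le: "1 + c\<^sup>2 \<le> (1 + norm x)\<^sup>2" if "c\<^sup>2 \<le> (norm x)\<^sup>2" for c :: real
    using that norm_ge_zero[of x] unfolding power2_sum power_one mult_1_right by linarith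
  have "(1 + a\<^sup>2) * (1 + b\<^sup>2) \<le> (1 + norm x)\<^sup>2 * (1 + norm x)\<^sup>2"
    using x by (intro mult_mono le) auto
  also have "\<dots> = (1 + norm x) ^ 4" by (simp add: power_add[symmetric])
  finally have "(1 + a\<^sup>2) * (1 + b\<^sup>2) * y \<le> C"
    by (intro order_trans[OF mult_right_mono assms(1)] y)
  moreover have "0 < (1 + a\<^sup>2) * (1 + b\<^sup>2)"
    by (intro mult_pos_pos add_pos_nonneg) auto
  ultimately show ?thesis by (simp add: pos_le_divide_eq mult.commute)
qed

text \<open>
  The partial derivatives of a Schwartz function are continuous and dominated by a product of
  integrable functions of the two coordinates.  This is what integration by parts, one coordinate
  at a time, requires.
\<close>

lemma schwartz_derivatives:
  assumes "schwartz f"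
  shows "\<exists>G. G 0 0 = f
    \<and> (\<forall>i j x. (G i j has_derivative
          (\<lambda>h. fst h *\<^sub>R G (Suc i) j x + snd h *\<^sub>R G i (Suc j) x)) (at x))
    \<and> (\<forall>i j. continuous_on UNIV (G i j))
    \<and> (\<forall>i j. \<exists>C\<ge>0. \<forall>x. norm (G i j x) \<le> C / ((1 + (fst x)\<^sup>2) * (1 + (snd x)\<^sup>2)))"
proof -
  obtain G where G: "G 0 0 = f"
    "\<And>i j x. (G i j has_derivative
                  (\<lambda>h. fst h *\<^sub>R G (Suc i) j x + snd h *\<^sub>R G i (Suc j) x)) (at x)"
    and N: "\<And>i j N. \<exists>C. \<forall>x. (1 + norm x) ^ N * norm (G i j x) \<le> C"
    using assms unfolding schwartz_def by blast
  have "continuous_on UNIV (G i j)" for i j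
    by (intro continuous_at_imp_continuous_on ballI has_derivative_continuous[OF G(2)])
  moreover have "\<exists>C\<ge>0. \<forall>x. norm (G i j x) \<le> C / ((1 + (fst x)\<^sup>2) * (1 + (snd x)\<^sup>2))" for i j
  proof -
    obtain C where C: "\<And>x. (1 + norm x) ^ 4 * norm (G i j x) \<le> C"
      using N[of 4 i j] by blast
    have "norm (G i j x) \<le> C / ((1 + (fst x)\<^sup>2) * (1 + (snd x)\<^sup>2))" for x
      using C by (rule decay_in_coordinates) (auto simp: norm_prod_def)
    moreover have "0 \<le> C"
      using order_trans[OF norm_ge_zero[of "G i j 0"], of C] C[of 0] by simp
    ultimately show ?thesis by blast
  qed
  ultimately show ?thesis using G by blast
qed

lemma product_decay_integrable:
  fixes f :: "real \<times> real \<Rightarrow> complex"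
  assumes "f \<in> borel_measurable borel"
    and "\<And>x. norm (f x) \<le> C / ((1 + (fst x)\<^sup>2) * (1 + (snd x)\<^sup>2))"
  shows "integrable lborel f"
proof (rule integrable_dominated_by_product[OF assms(1)])
  show "integrable lborel (\<lambda>x::real. C * (1 / (1 + x\<^sup>2)))"
    by (intro integrable_mult_right integrable_inverse_one_plus_square)
  show "norm (f (x, y)) \<le> C * (1 / (1 + x\<^sup>2)) * (1 / (1 + y\<^sup>2))" for x y
    using assms(2)[of "(x, y)"] by simp
qed (rule integrable_inverse_one_plus_square)

lemma tendsto_zero_of_decay:
  fixes p :: "real \<Rightarrow> complex"
  assumes "\<And>x. norm (p x) \<le> C / (1 + x\<^sup>2)"
  shows "(p \<longlongrightarrow> 0) at_top" "(p \<longlongrightarrow> 0) at_bot"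
proof -
  have "((\<lambda>x::real. C / (1 + x\<^sup>2)) \<longlongrightarrow> 0) at_top" "((\<lambda>x::real. C / (1 + x\<^sup>2)) \<longlongrightarrow> 0) at_bot"
    by real_asymp+
  then show "(p \<longlongrightarrow> 0) at_top" "(p \<longlongrightarrow> 0) at_bot"
    using assms by (auto intro: Lim_null_comparison[rotated] always_eventually)
qed

lemma integral_derivative_times_cis:
  fixes p p' :: "real \<Rightarrow> complex"
  assumes p: "\<And>x. (p has_vector_derivative p' x) (at x)" and p': "continuous_on UNIV p'"
    and bound: "\<And>x. norm (p x) \<le> C / (1 + x\<^sup>2)" "\<And>x. norm (p' x) \<le> C' / (1 + x\<^sup>2)"
  shows "(LINT x|lborel. p' x * cis (- (k * x + c))) = \<i> * k * (LINT x|lborel. p x * cis (- (k * x + c)))"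
proof -
  define e where "e x = cis (- (k * x + c))" for x
  have pc: "continuous_on UNIV p"
    using p by (intro continuous_at_imp_continuous_on) (auto intro: has_vector_derivative_continuous)
  have [measurable]: "p \<in> borel_measurable borel" "p' \<in> borel_measurable borel" "e \<in> borel_measurable borel"
    using pc p' unfolding e_def
    by (auto intro!: borel_measurable_continuous_onI continuous_intros)
  have i: "integrable lborel (\<lambda>x. q x * e x)"
    if [measurable]: "q \<in> borel_measurable borel" and "\<And>x. norm (q x) \<le> B / (1 + x\<^sup>2)" for q B
  proof (rule Bochner_Integration.integrable_bound)
    show "integrable lborel (\<lambda>x::real. B * (1 / (1 + x\<^sup>2)))"
      by (intro integrable_mult_right integrable_inverse_one_plus_square)
    show "AE x in lborel. norm (q x * e x) \<le> norm (B * (1 / (1 + x\<^sup>2)))"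
    proof (rule AE_I2)
      fix x
      have "norm (q x * e x) \<le> B * (1 / (1 + x\<^sup>2))"
        using that(2)[of x] by (simp add: norm_mult e_def)
      also have "\<dots> \<le> norm (B * (1 / (1 + x\<^sup>2)))"
        unfolding real_norm_def by (rule abs_ge_self)
      finally show "norm (q x * e x) \<le> norm (B * (1 / (1 + x\<^sup>2)))" .
    qed
  qed measurable
  note ip = i[OF _ bound(1)] and ip' = i[OF _ bound(2)]
  let ?u' = "\<lambda>x. p' x * e x - \<i> * k * (p x * e x)"
  have e': "(e has_vector_derivative (- \<i> * k * e x)) (at x)" for x
    unfolding e_def cis_conv_exp
    by (rule has_vector_derivative_real_field derivative_eq_intros | simp)+
  have d: "((\<lambda>x. p x * e x) has_vector_derivative ?u' x) (at x)" for x
    by (rule has_vector_derivative_eq_rhs[OF has_vector_derivative_mult[OF p e']]) (simp add: algebra_simps)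
  have lim: "((\<lambda>x. p x * e x) \<longlongrightarrow> 0) at_top" "((\<lambda>x. p x * e x) \<longlongrightarrow> 0) at_bot"
    by (rule tendsto_zero_of_decay[where C = C]; use bound(1) in \<open>simp add: norm_mult e_def\<close>)+
  have ec: "continuous_on UNIV e" unfolding e_def by (intro continuous_intros)
  have "(LBINT x=-\<infinity>..\<infinity>. ?u' x) = 0 - 0"
  proof (rule interval_integral_FTC_integrable[where F = "\<lambda>x. p x * e x"])
    show "isCont ?u' x" for x
    proof -
      have "continuous_on UNIV ?u'"
        using pc p' ec by (intro continuous_intros)
      then show ?thesis by (simp add: continuous_on_eq_continuous_at)
    qed
    show "set_integrable lborel (einterval (- \<infinity>) \<infinity>) ?u'"
      using ip ip' by (simp add: set_integrable_def)
    show "(((\<lambda>x. p x * e x) \<circ> real_of_ereal) \<longlongrightarrow> 0) (at_right (- \<infinity>))"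
      using lim(2) by (simp add: ereal_tendsto_simps)
    show "(((\<lambda>x. p x * e x) \<circ> real_of_ereal) \<longlongrightarrow> 0) (at_left \<infinity>)"
      using lim(1) by (simp add: ereal_tendsto_simps)
  qed (use d in auto)
  then have "(LINT x|lborel. ?u' x) = 0"
    by (simp add: interval_lebesgue_integral_def set_lebesgue_integral_def)
  then show ?thesis
    using ip ip' by (simp add: e_def)
qed

lemma fourier_derivative:
  fixes f f1 f2 :: "real \<times> real \<Rightarrow> complex"
  assumes der: "\<And>x. (f has_derivative (\<lambda>h. fst h *\<^sub>R f1 x + snd h *\<^sub>R f2 x)) (at x)"
    and cont: "continuous_on UNIV f1" "continuous_on UNIV f2"
    and bound: "\<And>x. norm (f x) \<le> C / ((1 + (fst x)\<^sup>2) * (1 + (snd x)\<^sup>2))"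
      "\<And>x. norm (f1 x) \<le> C1 / ((1 + (fst x)\<^sup>2) * (1 + (snd x)\<^sup>2))"
      "\<And>x. norm (f2 x) \<le> C2 / ((1 + (fst x)\<^sup>2) * (1 + (snd x)\<^sup>2))"
  shows "fourier f1 k = \<i> * fst k * fourier f k" and "fourier f2 k = \<i> * snd k * fourier f k"
proof -
  obtain k1 k2 where k: "k = (k1, k2)" by (cases k)
  have c0: "continuous_on UNIV f"
    by (intro continuous_at_imp_continuous_on ballI has_derivative_continuous[OF der])
  have int: "integrable (lborel \<Otimes>\<^sub>M lborel) (\<lambda>(a, b). q (a, b) * cis (- (k \<bullet> (a, b))))"
    if "continuous_on UNIV q" "\<And>x. norm (q x) \<le> B / ((1 + (fst x)\<^sup>2) * (1 + (snd x)\<^sup>2))" for q B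
  proof -
    have "integrable lborel (\<lambda>x. q x * cis (- (k \<bullet> x)))"
    proof (rule product_decay_integrable[where C = B])
      show "(\<lambda>x. q x * cis (- (k \<bullet> x))) \<in> borel_measurable borel"
        using that(1) by (intro borel_measurable_continuous_onI continuous_intros)
      show "norm (q x * cis (- (k \<bullet> x))) \<le> B / ((1 + (fst x)\<^sup>2) * (1 + (snd x)\<^sup>2))" for x
        using that(2)[of x] by (simp only: norm_mult norm_cis mult_1_right)
    qed
    then show ?thesis by (simp add: lborel_prod case_prod_unfold)
  qed
  have fst_eq: "fourier q k = 1 / (2 * pi) * (LINT b|lborel. LINT a|lborel. q (a, b) * cis (- (k1 * a + k2 * b)))"
    and snd_eq: "fourier q k = 1 / (2 * pi) * (LINT a|lborel. LINT b|lborel. q (a, b) * cis (- (k2 * b + k1 * a)))"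
    if "continuous_on UNIV q" "\<And>x. norm (q x) \<le> B / ((1 + (fst x)\<^sup>2) * (1 + (snd x)\<^sup>2))" for q B
    using lborel_pair.integral_fst[OF int[OF that]] lborel_pair.integral_snd[OF int[OF that]]
    by (simp_all add: fourier_def lborel_prod case_prod_unfold k add.commute inner_prod_def)
  have one: "r / ((1 + a\<^sup>2) * (1 + b\<^sup>2)) \<le> \<bar>r\<bar> / (1 + a\<^sup>2)" "r / ((1 + a\<^sup>2) * (1 + b\<^sup>2)) \<le> \<bar>r\<bar> / (1 + b\<^sup>2)" for r a b :: real
  proof -
    have *: "r / (s * t) \<le> \<bar>r\<bar> / s" if "s \<ge> 1" "t \<ge> 1" for s t :: real
    proof -
      have "r / (s * t) \<le> \<bar>r\<bar> / (s * t)" using that by (intro divide_right_mono) auto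
      also have "\<dots> \<le> \<bar>r\<bar> / s" using that by (intro divide_left_mono) auto
      finally show ?thesis .
    qed
    show "r / ((1 + a\<^sup>2) * (1 + b\<^sup>2)) \<le> \<bar>r\<bar> / (1 + a\<^sup>2)" by (rule *) auto
    show "r / ((1 + a\<^sup>2) * (1 + b\<^sup>2)) \<le> \<bar>r\<bar> / (1 + b\<^sup>2)"
      using *[of "1 + b\<^sup>2" "1 + a\<^sup>2"] by (simp add: mult.commute)
  qed
  have b1: "norm (q (a, b)) \<le> \<bar>B\<bar> / (1 + a\<^sup>2)" and b2: "norm (q (a, b)) \<le> \<bar>B\<bar> / (1 + b\<^sup>2)"
    if "\<And>x. norm (q x) \<le> B / ((1 + (fst x)\<^sup>2) * (1 + (snd x)\<^sup>2))" for q :: "real \<times> real \<Rightarrow> complex" and B a b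
    using that[of "(a, b)"] one[of B a b] by auto
  have h1: "(LINT a|lborel. f1 (a, b) * cis (- (k1 * a + k2 * b))) = \<i> * k1 * (LINT a|lborel. f (a, b) * cis (- (k1 * a + k2 * b)))" for b
  proof (rule integral_derivative_times_cis)
    show "((\<lambda>a. f (a, b)) has_vector_derivative f1 (a, b)) (at a)" for a
      unfolding has_vector_derivative_def
      by (rule has_derivative_eq_rhs[OF has_derivative_compose[OF _ der]]) (auto intro!: derivative_eq_intros)
    show "continuous_on UNIV (\<lambda>a. f1 (a, b))"
      by (rule continuous_on_compose2[OF cont(1)]) (auto intro!: continuous_intros)
  qed (use b1[OF bound(1)] b1[OF bound(2)] in auto)
  show "fourier f1 k = \<i> * fst k * fourier f k"
    unfolding fst_eq[OF cont(1) bound(2)] fst_eq[OF c0 bound(1)] h1 by (simp add: k)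
  have h2: "(LINT b|lborel. f2 (a, b) * cis (- (k2 * b + k1 * a))) = \<i> * k2 * (LINT b|lborel. f (a, b) * cis (- (k2 * b + k1 * a)))" for a
  proof (rule integral_derivative_times_cis)
    show "((\<lambda>b. f (a, b)) has_vector_derivative f2 (a, b)) (at b)" for b
      unfolding has_vector_derivative_def
      by (rule has_derivative_eq_rhs[OF has_derivative_compose[OF _ der]]) (auto intro!: derivative_eq_intros)
    show "continuous_on UNIV (\<lambda>b. f2 (a, b))"
      by (rule continuous_on_compose2[OF cont(2)]) (auto intro!: continuous_intros)
  qed (use b2[OF bound(1)] b2[OF bound(3)] in auto)
  show "fourier f2 k = \<i> * snd k * fourier f k"
    unfolding snd_eq[OF cont(2) bound(3)] snd_eq[OF c0 bound(1)] h2 by (simp add: k)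
qed

lemma norm_fourier_le: "norm (fourier f k) \<le> 1 / (2 * pi) * (LINT x|lborel. norm (f x))"
proof -
  have "norm (LINT x|lborel. f x * cis (- (k \<bullet> x))) \<le> (LINT x|lborel. norm (f x * cis (- (k \<bullet> x))))"
    by (rule integral_norm_bound)
  also have "\<dots> = (LINT x|lborel. norm (f x))"
    by (simp add: norm_mult)
  finally have "1 / (2 * pi) * norm (LINT x|lborel. f x * cis (- (k \<bullet> x))) \<le> 1 / (2 * pi) * (LINT x|lborel. norm (f x))"
    by (rule mult_left_mono) simp
  then show ?thesis
    unfolding fourier_def norm_mult norm_of_real by simp
qed

lemma fourier_schwartz_decay:
  assumes "schwartz f"
  obtains C where "\<And>k. norm (fourier f k) \<le> C / (1 + (norm k)\<^sup>2)"
proof -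
  obtain G where G: "G 0 0 = f"
    "\<And>i j x. (G i j has_derivative (\<lambda>h. fst h *\<^sub>R G (Suc i) j x + snd h *\<^sub>R G i (Suc j) x)) (at x)"
    "\<And>i j. continuous_on UNIV (G i j)"
    "\<And>i j. \<exists>C\<ge>0. \<forall>x. norm (G i j x) \<le> C / ((1 + (fst x)\<^sup>2) * (1 + (snd x)\<^sup>2))"
    using schwartz_derivatives[OF assms] by blast
  from G(4) obtain B where B: "\<And>i j x. norm (G i j x) \<le> B i j / ((1 + (fst x)\<^sup>2) * (1 + (snd x)\<^sup>2))"
    by metis
  have d1: "fourier (G (Suc i) j) k = \<i> * fst k * fourier (G i j) k"
    and d2: "fourier (G i (Suc j)) k = \<i> * snd k * fourier (G i j) k" for i j k
    by (rule fourier_derivative[OF G(2) G(3) G(3) B B B])+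
  define I where "I i j = 1 / (2 * pi) * (LINT x|lborel. norm (G i j x))" for i j
  have I: "norm (fourier (G i j) k) \<le> I i j" for i j k
    unfolding I_def by (rule norm_fourier_le)
  have "norm (fourier f k) \<le> (I 0 0 + I 2 0 + I 0 2) / (1 + (norm k)\<^sup>2)" for k
  proof -
    have "(norm k)\<^sup>2 = (fst k)\<^sup>2 + (snd k)\<^sup>2"
      by (simp add: norm_prod_def)
    moreover have "(fst k)\<^sup>2 * norm (fourier f k) \<le> I 2 0"
      using I[of 2 0 k] d1[of 0 0 k] d1[of 1 0 k] G(1)
      by (simp add: norm_mult power2_eq_square numeral_2_eq_2 mult.assoc)
    moreover have "(snd k)\<^sup>2 * norm (fourier f k) \<le> I 0 2"
      using I[of 0 2 k] d2[of 0 0 k] d2[of 0 1 k] G(1)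
      by (simp add: norm_mult power2_eq_square numeral_2_eq_2 mult.assoc)
    moreover have "norm (fourier f k) \<le> I 0 0" using I[of 0 0 k] G(1) by simp
    ultimately have "(1 + (norm k)\<^sup>2) * norm (fourier f k) \<le> I 0 0 + I 2 0 + I 0 2"
      by (simp add: ring_distribs)
    moreover have "0 < 1 + (norm k)\<^sup>2" by (intro add_pos_nonneg) auto
    ultimately show ?thesis by (simp add: pos_le_divide_eq mult.commute)
  qed
  then show ?thesis using that by blast
qed

lemma borel_measurable_fst_snd [measurable]:
  "(fst :: 'a::euclidean_space \<times> 'b::euclidean_space \<Rightarrow> 'a) \<in> borel_measurable borel"
  "(snd :: 'a::euclidean_space \<times> 'b::euclidean_space \<Rightarrow> 'b) \<in> borel_measurable borel"
  by (intro borel_measurable_continuous_onI continuous_intros)+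

lemma borel_measurable_parameter_integral:
  fixes f :: "'a::euclidean_space \<times> 'b::euclidean_space \<Rightarrow> 'c :: {banach, second_countable_topology}"
  assumes f: "f \<in> borel_measurable borel"
  shows "(\<lambda>x. LINT y|lborel. f (x, y)) \<in> borel_measurable borel"
proof (rule lborel.borel_measurable_lebesgue_integral)
  have "sets (borel \<Otimes>\<^sub>M lborel) = sets (borel :: ('a \<times> 'b) measure)"
    by (simp add: borel_prod[symmetric] cong: sets_pair_measure_cong)
  then show "(\<lambda>(x, y). f (x, y)) \<in> borel_measurable (borel \<Otimes>\<^sub>M lborel)"
    using f by (simp cong: measurable_cong_sets)
qed

lemma borel_measurable_fourier:
  assumes [measurable]: "f \<in> borel_measurable borel"
  shows "fourier f \<in> borel_measurable borel"
  unfolding fourier_def[abs_def]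
  by (intro borel_measurable_times borel_measurable_const
        borel_measurable_parameter_integral[of "\<lambda>p. f (snd p) * cis (- (fst p \<bullet> snd p))", simplified])
    measurable

lemma inner_polar_frame:
  "(t *\<^sub>R xi \<theta> + u *\<^sub>R xi_perp \<theta>) \<bullet> (a *\<^sub>R xi \<theta> + b *\<^sub>R xi_perp \<theta>) = t * a + u * b"
proof -
  have "(t *\<^sub>R xi \<theta> + u *\<^sub>R xi_perp \<theta>) \<bullet> (a *\<^sub>R xi \<theta> + b *\<^sub>R xi_perp \<theta>)
      = (t * a + u * b) * ((cos \<theta>)\<^sup>2 + (sin \<theta>)\<^sup>2)"
    by (simp add: xi_def xi_perp_def inner_prod_def power2_eq_square algebra_simps
          del: sin_cos_squared_add sin_cos_squared_add2 sin_cos_squared_add3)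
  then show ?thesis by simp
qed

lemma norm_polar_frame: "(norm (a *\<^sub>R xi \<theta> + b *\<^sub>R xi_perp \<theta>))\<^sup>2 = a\<^sup>2 + b\<^sup>2"
  unfolding power2_norm_eq_inner inner_polar_frame by (simp add: power2_eq_square)

lemma integral_rotation:
  fixes f :: "real \<times> real \<Rightarrow> 'c :: {banach, second_countable_topology}"
  assumes [measurable]: "f \<in> borel_measurable borel"
  shows "integrable lborel f \<longleftrightarrow> integrable lborel (\<lambda>(a, b). f (a *\<^sub>R xi \<theta> + b *\<^sub>R xi_perp \<theta>))"
    and "integral\<^sup>L lborel f = (LINT (a, b)|lborel. f (a *\<^sub>R xi \<theta> + b *\<^sub>R xi_perp \<theta>))"
proof -
  let ?T = "\<lambda>p :: real \<times> real. fst p *\<^sub>R xi \<theta> + snd p *\<^sub>R xi_perp \<theta>"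
  have T [measurable]: "?T \<in> borel_measurable borel"
    by (intro borel_measurable_continuous_onI continuous_intros)
  have "?T \<in> lborel \<rightarrow>\<^sub>M lborel" by simp
  moreover have "emeasure lborel A = (\<integral>\<^sup>+x. ennreal 1 * indicator A (?T x) \<partial>lborel)" if "A \<in> sets lborel" for A
  proof -
    have [measurable]: "A \<in> sets borel" using that by simp
    have "emeasure lborel A = (\<integral>\<^sup>+x. indicator A x \<partial>lborel)" by simp
    also have "\<dots> = (\<integral>\<^sup>+x. indicator A (?T x) \<partial>lborel)"
      by (subst nn_integral_rotation[where \<beta> = \<theta>], measurable) (subst nn_integral_lborel_pair(2), auto)
    finally show ?thesis by simp
  qed
  ultimately show "integrable lborel f \<longleftrightarrow> integrable lborel (\<lambda>(a, b). f (a *\<^sub>R xi \<theta> + b *\<^sub>R xi_perp \<theta>))"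
    and "integral\<^sup>L lborel f = (LINT (a, b)|lborel. f (a *\<^sub>R xi \<theta> + b *\<^sub>R xi_perp \<theta>))"
    using change_of_variables[of ?T lborel lborel "\<lambda>_. 1" f] by (simp_all add: case_prod_unfold)
qed

text \<open>
  The Fourier transform of a Gaussian of width \<open>n\<close>.  As \<open>n\<close> grows it becomes a point mass, of total
  mass \<open>2 \<pi>\<close>, at the origin.
\<close>

lemma integral_gaussian_cis:
  assumes n: "n > 0"
  shows "(LINT u|lborel. complex_of_real (sqrt (2 * pi) * std_normal_density (u / n)) * cis (- (u * b)))
    = complex_of_real (2 * pi * (n * std_normal_density (n * b)))"
proof -
  let ?K = "sqrt (2 * pi)"
  have "(LINT u|lborel. complex_of_real (?K * std_normal_density (u / n)) * cis (- (u * b)))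
    = \<bar>n\<bar> *\<^sub>R (LINT v|lborel. complex_of_real (?K * std_normal_density ((0 + n * v) / n)) * cis (- ((0 + n * v) * b)))"
    using n by (intro lborel_integral_real_affine) auto
  also have "\<dots> = n * ?K * (LINT v|lborel. std_normal_density v *\<^sub>R cis (- (n * b) * v))"
    using n by (simp add: scaleR_conv_of_real mult.assoc mult.commute[of b] mult.left_commute[of b])
  also have "(LINT v|lborel. std_normal_density v *\<^sub>R cis (- (n * b) * v)) = char std_normal_distribution (- (n * b))"
    unfolding char_def by (subst integral_density) (auto simp: cis_conv_exp)
  also have "\<dots> = exp (- (n * b)\<^sup>2 / 2)"
    by (simp add: char_std_normal_distribution)
  also have "n * ?K * complex_of_real (exp (- (n * b)\<^sup>2 / 2)) = complex_of_real (2 * pi * (n * std_normal_density (n * b)))"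
  proof -
    have "?K * ?K = 2 * pi" by simp
    then have "n * ?K * exp (- (n * b)\<^sup>2 / 2) = 2 * pi * (n * std_normal_density (n * b))"
      unfolding std_normal_density_def by (simp add: field_simps)
    then show ?thesis by (simp flip: of_real_mult)
  qed
  finally show ?thesis .
qed

text \<open>
  The Fourier slice theorem, read from the transform to the function.  In the coordinates
  \<open>(a, b)\<close> with axes \<open>\<xi>\<^sub>\<theta>\<close> and \<open>\<xi>\<^sub>\<theta>\<^sup>\<bottom>\<close>, integrating the transform along a line is Fourier inversion in
  the variable \<open>b\<close> at the point \<open>b = 0\<close>.  The inversion is justified by inserting a wide Gaussian
  factor into the integral over the line, exchanging the integrals, and letting the width tend to
  infinity.
\<close>

lemma fourier_slice:
  assumes f: "schwartz f"
  shows "radon (fourier f) t \<theta> = (LINT \<sigma>|lborel. f (\<sigma> *\<^sub>R xi \<theta>) * cis (- (\<sigma> * t)))"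
proof -
  have fc: "continuous_on UNIV f"
    using schwartz_derivatives[OF f] by blast
  obtain C where C: "\<And>x. (1 + norm x) ^ 4 * norm (f x) \<le> C"
    using f unfolding schwartz_def by metis
  define \<psi> where "\<psi> p = f (fst p *\<^sub>R xi \<theta> + snd p *\<^sub>R xi_perp \<theta>)" for p
  have \<psi>c: "continuous_on UNIV \<psi>"
    unfolding \<psi>_def by (intro continuous_intros continuous_on_compose2[OF fc]) auto
  have \<psi>b: "norm (\<psi> p) \<le> C / ((1 + (fst p)\<^sup>2) * (1 + (snd p)\<^sup>2))" for p
    unfolding \<psi>_def by (rule decay_in_coordinates[OF C norm_polar_frame]) simp
  have [measurable]: "\<psi> \<in> borel_measurable borel" "f \<in> borel_measurable borel"
    using \<psi>c fc by (auto intro: borel_measurable_continuous_onI)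
  have C0: "0 \<le> C" using order_trans[OF norm_ge_zero[of "f 0"], of C] C[of 0] by simp
  have \<psi>b1: "norm (\<psi> p) \<le> C / (1 + (fst p)\<^sup>2)" for p
  proof -
    have "C / ((1 + (fst p)\<^sup>2) * (1 + (snd p)\<^sup>2)) \<le> C / ((1 + (fst p)\<^sup>2) * 1)"
      using C0 by (intro divide_left_mono mult_left_mono) (auto intro!: mult_pos_pos add_pos_nonneg)
    with \<psi>b[of p] show ?thesis by simp
  qed
  have \<psi>i: "integrable lborel \<psi>"
    by (rule product_decay_integrable[OF _ \<psi>b]) simp
  define F where "F u = fourier f (t *\<^sub>R xi \<theta> + u *\<^sub>R xi_perp \<theta>)" for u
  have F: "F u = 1 / (2 * pi) * (LINT p|lborel. \<psi> p * cis (- (t * fst p + u * snd p)))" for u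
    unfolding F_def fourier_def
    by (subst integral_rotation(2)[where \<theta> = \<theta>])
       (simp_all add: inner_polar_frame case_prod_unfold \<psi>_def)
  obtain B where B: "\<And>k. norm (fourier f k) \<le> B / (1 + (norm k)\<^sup>2)"
    using fourier_schwartz_decay[OF f] by blast
  have B0: "0 \<le> B" using order_trans[OF norm_ge_zero[of "fourier f 0"], of B] B[of 0] by simp
  have Fb: "norm (F u) \<le> B * (1 / (1 + u\<^sup>2))" for u
  proof -
    have "B / (1 + (t\<^sup>2 + u\<^sup>2)) \<le> B / (1 + u\<^sup>2)"
      using B0 by (intro divide_left_mono mult_pos_pos add_pos_nonneg) auto
    then show ?thesis
      using B[of "t *\<^sub>R xi \<theta> + u *\<^sub>R xi_perp \<theta>"] by (simp add: F_def norm_polar_frame)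
  qed
  have [measurable]: "F \<in> borel_measurable borel"
    unfolding F_def by (rule measurable_compose[OF _ borel_measurable_fourier]) measurable
  \<comment> \<open>\<open>K * N (u / n)\<close> is the Gaussian factor of width \<open>n\<close>, with value \<open>1\<close> at the origin\<close>
  define K where "K = sqrt (2 * pi)"
  define N where "N = (std_normal_density :: real \<Rightarrow> real)"
  have [measurable]: "N \<in> borel_measurable borel" by (simp add: N_def)
  have Ni: "integrable lborel N" "integral\<^sup>L lborel N = 1" and N0: "0 \<le> N x" for x
    using integral_normal_density[of 1 0] integrable_normal_density[of 1 0]
    by (simp_all add: N_def)
  have over_n: "(\<lambda>n. x / real (Suc n)) \<longlonglongrightarrow> 0" for x
    by (rule LIMSEQ_Suc[OF lim_const_over_n])
  have KN: "K * N x = exp (- x\<^sup>2 / 2)" for x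
    by (simp add: K_def N_def std_normal_density_def)
  have "(\<lambda>n. LINT u|lborel. complex_of_real (K * N (u / real (Suc n))) * F u) \<longlonglongrightarrow> (LINT u|lborel. F u)"
  proof (rule integral_dominated_convergence)
    show "integrable lborel (\<lambda>u::real. B * (1 / (1 + u\<^sup>2)))"
      by (intro integrable_mult_right integrable_inverse_one_plus_square)
    show "AE u in lborel. (\<lambda>n. complex_of_real (K * N (u / real (Suc n))) * F u) \<longlonglongrightarrow> F u"
    proof (rule AE_I2)
      fix u :: real
      have "(\<lambda>n. exp (- (u / real (Suc n))\<^sup>2 / 2)) \<longlonglongrightarrow> exp (- 0\<^sup>2 / 2)"
        by (intro tendsto_intros over_n) simp
      then have "(\<lambda>n. complex_of_real (exp (- (u / real (Suc n))\<^sup>2 / 2)) * F u) \<longlonglongrightarrow> of_real (exp (- 0\<^sup>2 / 2)) * F u"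
        by (intro tendsto_mult tendsto_of_real tendsto_const)
      then show "(\<lambda>n. complex_of_real (K * N (u / real (Suc n))) * F u) \<longlonglongrightarrow> F u"
        by (simp add: KN)
    qed
    show "AE u in lborel. norm (complex_of_real (K * N (u / real (Suc n))) * F u) \<le> B * (1 / (1 + u\<^sup>2))" for n
    proof (rule AE_I2)
      fix u :: real
      have "norm (complex_of_real (K * N (u / real (Suc n))) * F u) \<le> 1 * norm (F u)"
        unfolding KN norm_mult norm_of_real by (intro mult_right_mono) auto
      with Fb[of u] show "norm (complex_of_real (K * N (u / real (Suc n))) * F u) \<le> B * (1 / (1 + u\<^sup>2))"
        by simp
    qed
  qed measurable
  moreover have "(LINT u|lborel. complex_of_real (K * N (u / real (Suc n))) * F u)
    = (LINT p|lborel. \<psi> (fst p, snd p / real (Suc n)) * cis (- (t * fst p)) * N (snd p))" for n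
  proof -
    define m where "m = real (Suc n)"
    have m: "m > 0" by (simp add: m_def)
    let ?g = "\<lambda>u p. complex_of_real (K * N (u / m)) * (\<psi> p * cis (- (t * fst p + u * snd p)))"
    have cis_split: "cis (- (x + y)) = cis (- x) * cis (- y)" for x y
      by (simp add: cis_mult)
    have gi: "integrable lborel (case_prod ?g)"
    proof (rule integrable_dominated_by_product)
      show "integrable lborel (\<lambda>u. K * N (u / m))"
        using m lborel_integrable_real_affine[OF Ni(1), of "1 / m" 0] by simp
      show "integrable lborel (\<lambda>p. norm (\<psi> p))"
        using \<psi>i by (rule integrable_norm)
      show "case_prod ?g \<in> borel_measurable borel"
        unfolding case_prod_unfold by measurable
      show "norm (case (u, p) of (u, p) \<Rightarrow> ?g u p) \<le> K * N (u / m) * norm (\<psi> p)" for u p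
        by (simp add: norm_mult K_def abs_mult N0)
    qed
    have "(LINT u|lborel. complex_of_real (K * N (u / m)) * F u)
      = 1 / (2 * pi) * (LINT u|lborel. LINT p|lborel. ?g u p)"
      unfolding F by (simp add: mult.left_commute[of _ "1 / (2 * complex_of_real pi)"])
    also have "(LINT u|lborel. LINT p|lborel. ?g u p) = (LINT p|lborel. LINT u|lborel. ?g u p)"
      using gi by (intro lborel_pair.Fubini_integral[symmetric]) (simp add: lborel_prod)
    also have "(\<lambda>p. LINT u|lborel. ?g u p)
      = (\<lambda>p. \<psi> p * cis (- (t * fst p)) * complex_of_real (2 * pi * (m * N (m * snd p))))"
    proof
      fix p :: "real \<times> real"
      have "(LINT u|lborel. ?g u p) = (LINT u|lborel. \<psi> p * cis (- (t * fst p)) *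
          (complex_of_real (K * N (u / m)) * cis (- (u * snd p))))"
        by (simp only: cis_split mult_ac)
      then show "(LINT u|lborel. ?g u p) = \<psi> p * cis (- (t * fst p)) * complex_of_real (2 * pi * (m * N (m * snd p)))"
        using integral_gaussian_cis[OF m, of "snd p"] by (simp add: K_def N_def)
    qed
    also have "1 / (2 * pi) * (LINT p|lborel. \<psi> p * cis (- (t * fst p)) * complex_of_real (2 * pi * (m * N (m * snd p))))
      = (LINT p|lborel. \<psi> p * cis (- (t * fst p)) * complex_of_real (m * N (m * snd p)))"
      unfolding of_real_mult[of "2 * pi"] mult.left_commute[of _ "complex_of_real (2 * pi)"] by simp
    also have "\<dots> = (LINT a|lborel. LINT b|lborel. \<psi> (a, b) * cis (- (t * a)) * complex_of_real (m * N (m * b)))"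
    proof -
      have Nb: "N x \<le> 1" for x
      proof -
        have "1 * N x \<le> K * N x"
          using pi_ge_two by (intro mult_right_mono N0) (simp add: K_def)
        also have "\<dots> \<le> 1" by (simp add: KN)
        finally show ?thesis by simp
      qed
      have "integrable lborel (\<lambda>p. \<psi> p * cis (- (t * fst p)) * complex_of_real (m * N (m * snd p)))"
      proof (rule Bochner_Integration.integrable_bound)
        show "integrable lborel (\<lambda>p. m * norm (\<psi> p))" using \<psi>i by auto
        show "(\<lambda>p. \<psi> p * cis (- (t * fst p)) * complex_of_real (m * N (m * snd p))) \<in> borel_measurable lborel"
          by measurable
        show "AE p in lborel. norm (\<psi> p * cis (- (t * fst p)) * complex_of_real (m * N (m * snd p))) \<le> norm (m * norm (\<psi> p))"
          using m Nb N0 by (intro AE_I2) (simp add: norm_mult abs_mult mult_ac mult_left_le mult_left_mono)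
      qed
      then have "integrable (lborel \<Otimes>\<^sub>M lborel) (\<lambda>(a, b). \<psi> (a, b) * cis (- (t * a)) * complex_of_real (m * N (m * b)))"
        by (simp add: lborel_prod case_prod_unfold)
      from lborel_pair.integral_fst[OF this] show ?thesis
        by (simp add: lborel_prod case_prod_unfold)
    qed
    also have "\<dots> = (LINT a|lborel. LINT v|lborel. \<psi> (a, v / m) * cis (- (t * a)) * complex_of_real (N v))"
    proof (rule Bochner_Integration.integral_cong)
      fix a
      show "(LINT b|lborel. \<psi> (a, b) * cis (- (t * a)) * complex_of_real (m * N (m * b)))
        = (LINT v|lborel. \<psi> (a, v / m) * cis (- (t * a)) * complex_of_real (N v))"
        using m by (subst lborel_integral_real_affine[where c = "1 / m" and t = 0])
          (auto simp: scaleR_conv_of_real mult.assoc simp flip: integral_mult_right_zero)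
    qed simp
    also have "\<dots> = (LINT p|lborel. \<psi> (fst p, snd p / m) * cis (- (t * fst p)) * N (snd p))"
    proof -
      have "integrable lborel (\<lambda>p. \<psi> (fst p, snd p / m) * cis (- (t * fst p)) * complex_of_real (N (snd p)))"
      proof (rule integrable_dominated_by_product)
        show "integrable lborel (\<lambda>x::real. C * (1 / (1 + x\<^sup>2)))"
          by (intro integrable_mult_right integrable_inverse_one_plus_square)
        show "norm (\<psi> (fst (a, v), snd (a, v) / m) * cis (- (t * fst (a, v))) * complex_of_real (N (snd (a, v))))
          \<le> C * (1 / (1 + a\<^sup>2)) * N v" for a v
          using mult_right_mono[OF \<psi>b1[of "(a, v / m)"] N0[of v]] N0[of v] by (simp add: norm_mult)
      qed (use Ni in simp_all)
      then have "integrable (lborel \<Otimes>\<^sub>M lborel) (\<lambda>(a, v). \<psi> (a, v / m) * cis (- (t * a)) * complex_of_real (N v))"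
        by (simp add: lborel_prod case_prod_unfold)
      from lborel_pair.integral_fst[OF this] show ?thesis
        by (simp add: lborel_prod case_prod_unfold)
    qed
    finally show ?thesis by (simp add: m_def)
  qed
  moreover have "(\<lambda>n. LINT p|lborel. \<psi> (fst p, snd p / real (Suc n)) * cis (- (t * fst p)) * N (snd p))
    \<longlonglongrightarrow> (LINT p|lborel. \<psi> (fst p, 0) * cis (- (t * fst p)) * N (snd p))"
  proof (rule integral_dominated_convergence)
    show "integrable lborel (\<lambda>p. C * (1 / (1 + (fst p)\<^sup>2)) * N (snd p))"
    proof (rule integrable_dominated_by_product)
      show "integrable lborel (\<lambda>x::real. C * (1 / (1 + x\<^sup>2)))"
        by (intro integrable_mult_right integrable_inverse_one_plus_square)
      show "norm (C * (1 / (1 + (fst (x, y))\<^sup>2)) * N (snd (x, y))) \<le> C * (1 / (1 + x\<^sup>2)) * N y" for x y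
        unfolding real_norm_def fst_conv snd_conv
        using C0 N0[of y] by (subst abs_of_nonneg) (auto intro!: mult_nonneg_nonneg divide_nonneg_nonneg)
    qed (use Ni in simp_all)
    show "AE p in lborel. norm (\<psi> (fst p, snd p / real (Suc n)) * cis (- (t * fst p)) * N (snd p))
      \<le> C * (1 / (1 + (fst p)\<^sup>2)) * N (snd p)" for n
    proof (rule AE_I2)
      fix p :: "real \<times> real"
      show "norm (\<psi> (fst p, snd p / real (Suc n)) * cis (- (t * fst p)) * N (snd p)) \<le> C * (1 / (1 + (fst p)\<^sup>2)) * N (snd p)"
        using mult_right_mono[OF \<psi>b1[of "(fst p, snd p / real (Suc n))"] N0[of "snd p"]] N0[of "snd p"] by (simp add: norm_mult)
    qed
    show "AE p in lborel. (\<lambda>n. \<psi> (fst p, snd p / real (Suc n)) * cis (- (t * fst p)) * complex_of_real (N (snd p)))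
      \<longlonglongrightarrow> \<psi> (fst p, 0) * cis (- (t * fst p)) * complex_of_real (N (snd p))"
    proof (rule AE_I2)
      fix p :: "real \<times> real"
      have "(\<lambda>n. (fst p, snd p / real (Suc n))) \<longlonglongrightarrow> (fst p, 0)"
        by (intro tendsto_intros over_n)
      then have "(\<lambda>n. \<psi> (fst p, snd p / real (Suc n))) \<longlonglongrightarrow> \<psi> (fst p, 0)"
        by (rule continuous_on_tendsto_compose[OF \<psi>c]) auto
      then show "(\<lambda>n. \<psi> (fst p, snd p / real (Suc n)) * cis (- (t * fst p)) * complex_of_real (N (snd p)))
        \<longlonglongrightarrow> \<psi> (fst p, 0) * cis (- (t * fst p)) * complex_of_real (N (snd p))"
        by (intro tendsto_intros)
    qed
  qed simp_all
  moreover have "(LINT p|lborel. \<psi> (fst p, 0) * cis (- (t * fst p)) * N (snd p)) = (LINT a|lborel. \<psi> (a, 0) * cis (- (t * a)))"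
  proof -
    have "integrable lborel (\<lambda>p. \<psi> (fst p, 0) * cis (- (t * fst p)) * complex_of_real (N (snd p)))"
    proof (rule integrable_dominated_by_product)
      show "integrable lborel (\<lambda>x::real. C * (1 / (1 + x\<^sup>2)))"
        by (intro integrable_mult_right integrable_inverse_one_plus_square)
      show "norm (\<psi> (fst (a, v), 0) * cis (- (t * fst (a, v))) * complex_of_real (N (snd (a, v))))
        \<le> C * (1 / (1 + a\<^sup>2)) * N v" for a v
        using mult_right_mono[OF \<psi>b1[of "(a, 0)"] N0[of v]] N0[of v] by (simp add: norm_mult)
    qed (use Ni in simp_all)
    then have "integrable (lborel \<Otimes>\<^sub>M lborel) (\<lambda>(a, v). \<psi> (a, 0) * cis (- (t * a)) * complex_of_real (N v))"
      by (simp add: lborel_prod case_prod_unfold)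
    from lborel_pair.integral_fst[OF this] show ?thesis
      using Ni by (simp add: lborel_prod case_prod_unfold)
  qed
  ultimately have "(LINT u|lborel. F u) = (LINT a|lborel. \<psi> (a, 0) * cis (- (t * a)))"
    using LIMSEQ_unique by auto
  then show ?thesis
    by (simp add: radon_def F_def \<psi>_def mult.commute)
qed

section \<open>The adjoint of the fan-beam transform\<close>

lemma fan_data_periodic:
  assumes "fan_data g"
  shows "g s (\<beta> + 2 * pi) = g s \<beta>" and "g s (\<beta> + of_int k * (2 * pi)) = g s \<beta>"
proof -
  show per: "g s (\<beta> + 2 * pi) = g s \<beta>" for \<beta>
    using assms by (simp add: fan_data_def)
  have pern: "g s (\<beta> + real n * (2 * pi)) = g s \<beta>" for \<beta> n
  proof (induction n)
    case (Suc n)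
    have "g s (\<beta> + real (Suc n) * (2 * pi)) = g s ((\<beta> + real n * (2 * pi)) + 2 * pi)"
      by (rule arg_cong[where f = "g s"]) (simp add: algebra_simps)
    with Suc per show ?case by simp
  qed simp
  show "g s (\<beta> + of_int k * (2 * pi)) = g s \<beta>"
    using pern[of "\<beta> + of_int k * (2 * pi)" "nat (- k)"] pern[of \<beta> "nat k"]
    by (cases "0 \<le> k") (auto simp: algebra_simps)
qed

text \<open>Integrability gives measurability over one period of \<open>\<beta>\<close>; periodicity extends it to all \<open>\<beta>\<close>.\<close>

lemma fan_data_measurable:
  assumes "fan_data g"
  shows "(\<lambda>p. g (fst p) (snd p)) \<in> borel_measurable borel"
proof -
  define \<tau> where "\<tau> \<beta> = \<beta> - 2 * pi * of_int \<lfloor>\<beta> / (2 * pi)\<rfloor>" for \<beta>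
  have g\<tau>: "g s (\<tau> \<beta>) = g s \<beta>" for s \<beta>
    using fan_data_periodic(2)[OF assms, of s \<beta> "- \<lfloor>\<beta> / (2 * pi)\<rfloor>"]
    by (simp add: \<tau>_def algebra_simps)
  have \<tau>: "0 \<le> \<tau> \<beta>" "\<tau> \<beta> \<le> 2 * pi" for \<beta>
  proof -
    have "of_int \<lfloor>\<beta> / (2 * pi)\<rfloor> * (2 * pi) \<le> \<beta>" "\<beta> \<le> (of_int \<lfloor>\<beta> / (2 * pi)\<rfloor> + 1) * (2 * pi)"
      using of_int_floor_le[of "\<beta> / (2 * pi)"] real_of_int_floor_add_one_ge[of "\<beta> / (2 * pi)"] pi_gt_zero
      by (simp_all only: pos_le_divide_eq pos_divide_le_eq mult_pos_pos zero_less_numeral)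
    then show "0 \<le> \<tau> \<beta>" "\<tau> \<beta> \<le> 2 * pi"
      by (simp_all only: \<tau>_def ring_distribs mult.commute[of "2 * pi"] mult_1)
  qed
  have [measurable]: "\<tau> \<in> borel_measurable borel"
    unfolding \<tau>_def by measurable
  have i: "(\<lambda>p. indicator (UNIV \<times> {0..2 * pi}) p *\<^sub>R (case p of (s, \<beta>) \<Rightarrow> g s \<beta>)) \<in> borel_measurable borel"
    using assms by (auto simp: fan_data_def set_integrable_def dest: borel_measurable_integrable)
  have "(\<lambda>p :: real \<times> real. (fst p, \<tau> (snd p))) \<in> borel_measurable borel"
    by measurable
  from measurable_compose[OF this i] show ?thesis
    using \<tau> by (simp add: g\<tau> indicator_def)
qed

lemma fan_data_apply_measurable:
  assumes "fan_data g" "u \<in> borel_measurable M" "v \<in> borel_measurable M"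
  shows "(\<lambda>x. g (u x) (v x)) \<in> borel_measurable M"
proof -
  have "(\<lambda>x. (u x, v x)) \<in> borel_measurable M"
    using assms by measurable
  from measurable_compose[OF this fan_data_measurable[OF assms(1)]] show ?thesis by simp
qed

text \<open>The integrand of the adjoint: the weight of the point \<open>x\<close> for the source position \<open>\<beta>\<close>, times the datum.\<close>

definition fan_weight :: "real \<Rightarrow> (real \<Rightarrow> real \<Rightarrow> real) \<Rightarrow> real \<Rightarrow> real \<times> real \<Rightarrow> real" where
  "fan_weight D g \<beta> x =
     1 / D * (1 / \<bar>fan_U D \<beta> x\<bar> * sqrt ((fan_s D \<beta> x)\<^sup>2 + D\<^sup>2) * g (fan_s D \<beta> x) \<beta>)"

lemma fan_adjoint_eq: "fan_adjoint D g x = (LINT \<beta>:{0..2 * pi}|lborel. fan_weight D g \<beta> x)"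
  unfolding fan_adjoint_def fan_weight_def by (rule set_integral_mult_right[symmetric])

lemma fan_U_s_measurable [measurable]:
  assumes [measurable]: "u \<in> borel_measurable M" "v \<in> borel_measurable M"
  shows "(\<lambda>x. fan_U D (u x) (v x)) \<in> borel_measurable M" "(\<lambda>x. fan_s D (u x) (v x)) \<in> borel_measurable M"
  unfolding fan_s_def fan_U_def source_def xi_def xi_perp_def inner_prod_def by measurable

lemma fan_weight_measurable:
  assumes g: "fan_data g" and [measurable]: "u \<in> borel_measurable M" "v \<in> borel_measurable M"
  shows "(\<lambda>x. fan_weight D g (u x) (v x)) \<in> borel_measurable M"
proof -
  have [measurable]: "(\<lambda>x. g (fan_s D (u x) (v x)) (u x)) \<in> borel_measurable M"
    by (intro fan_data_apply_measurable[OF g]) measurable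
  show ?thesis unfolding fan_weight_def by measurable
qed

text \<open>
  In the coordinates \<open>(s, l)\<close>, \<open>fan_U\<close> is \<open>l\<close> and \<open>fan_s\<close> is \<open>s\<close>; the Jacobian \<open>D \<bar>l\<bar>\<close> cancels the
  singular factor of the weight and leaves the arc length of the line per unit of \<open>l\<close>.
\<close>

lemma fan_weight_point:
  assumes D: "D > 0" and l: "l \<noteq> 0"
  shows "D * \<bar>l\<bar> * fan_weight D g \<beta> (fan_point D \<beta> (s, l)) = sqrt (s\<^sup>2 + D\<^sup>2) * g s \<beta>"
proof -
  have "xi_perp \<beta> \<bullet> fan_point D \<beta> (s, l) = D * (1 - l)" "fan_point D \<beta> (s, l) \<bullet> xi \<beta> = l * s"
    using inner_polar_frame[of 0 \<beta> 1 "l * s" "D * (1 - l)"] inner_polar_frame[of 1 \<beta> 0 "l * s" "D * (1 - l)"]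
    by (simp_all add: fan_point_def inner_commute)
  note frame = this
  have U: "fan_U D \<beta> (fan_point D \<beta> (s, l)) = l"
    unfolding fan_U_def source_def inner_scaleR_left frame
    using D by (simp add: power2_eq_square algebra_simps)
  have "fan_s D \<beta> (fan_point D \<beta> (s, l)) = s"
    using l by (simp add: fan_s_def U frame)
  then show ?thesis
    using D l by (simp add: fan_weight_def U)
qed

text \<open>
  For fixed \<open>s\<close>, the points \<open>fan_point D \<beta> (s, l)\<close> run through the line with parameters \<open>t = s D / R\<close>
  and \<open>\<theta> = \<beta> + arctan (s / D)\<close>, where \<open>l\<close> decreases with the arc length \<open>u\<close>.
\<close>

lemma fan_point_on_line:
  fixes s D :: real
  assumes D: "D > 0"
  defines "R \<equiv> sqrt (s\<^sup>2 + D\<^sup>2)"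
  shows "fan_point D \<beta> (s, (D / R)\<^sup>2 + (- 1 / R) * u)
    = (s * D / R) *\<^sub>R xi (\<beta> + arctan (s / D)) + u *\<^sub>R xi_perp (\<beta> + arctan (s / D))"
proof -
  have R: "R > 0" "R * R = s * s + D * D"
    using D by (simp_all add: R_def add_nonneg_pos power2_eq_square)
  have "sqrt (1 + (s / D)\<^sup>2) = R / D"
  proof -
    have "1 + (s / D)\<^sup>2 = (s\<^sup>2 + D\<^sup>2) / D\<^sup>2"
      using D by (simp add: field_simps)
    then show ?thesis using D by (simp add: real_sqrt_divide R_def)
  qed
  then have c: "cos (arctan (s / D)) = D / R" and i: "sin (arctan (s / D)) = s / R"
    using D R by (simp_all add: cos_arctan sin_arctan)
  have a: "((D / R)\<^sup>2 + (- 1 / R) * u) * s = s * D / R * (D / R) - u * (s / R)"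
    by (simp add: power2_eq_square algebra_simps)
  have "(s * s + D * D) / (R * R) = 1"
    using R by (simp flip: R(2))
  then have e: "(D / R)\<^sup>2 = 1 - s / R * (s / R)"
    by (simp add: power2_eq_square add_divide_distrib)
  have b: "D * (1 - ((D / R)\<^sup>2 + (- 1 / R) * u)) = s * D / R * (s / R) + u * (D / R)"
    unfolding e by (simp add: algebra_simps)
  have x: "xi (\<beta> + \<gamma>) = cos \<gamma> *\<^sub>R xi \<beta> + sin \<gamma> *\<^sub>R xi_perp \<beta>"
    "xi_perp (\<beta> + \<gamma>) = - sin \<gamma> *\<^sub>R xi \<beta> + cos \<gamma> *\<^sub>R xi_perp \<beta>" for \<gamma>
    by (simp_all add: xi_def xi_perp_def cos_add sin_add)
  show ?thesis
    unfolding fan_point_def prod.case a b x c i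
    by (simp add: algebra_simps)
qed

lemma nn_integral_fan_weight:
  fixes h :: "real \<times> real \<Rightarrow> ennreal"
  assumes D: "D > 0" and g: "fan_data g" and h [measurable]: "h \<in> borel_measurable borel"
  shows "(\<integral>\<^sup>+x. h x * ennreal \<bar>fan_weight D g \<beta> x\<bar> \<partial>lborel)
    = (\<integral>\<^sup>+s. ennreal \<bar>g s \<beta>\<bar> * (\<integral>\<^sup>+u. h ((s * D / sqrt (s\<^sup>2 + D\<^sup>2)) *\<^sub>R xi (\<beta> + arctan (s / D))
        + u *\<^sub>R xi_perp (\<beta> + arctan (s / D))) \<partial>lborel) \<partial>lborel)"
proof -
  note [measurable] = fan_weight_measurable[OF g] fan_data_apply_measurable[OF g]
  define R where "R s = sqrt (s\<^sup>2 + D\<^sup>2)" for s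
  have R: "R s > 0" for s using D by (simp add: R_def add_nonneg_pos)
  have [measurable]: "R \<in> borel_measurable borel" unfolding R_def by measurable
  have hm [measurable]: "(\<lambda>x. h (fan_point D \<beta> (u x, v x))) \<in> borel_measurable M"
    if [measurable]: "u \<in> borel_measurable M" "v \<in> borel_measurable M" for u v and M :: "'x measure"
    by (rule measurable_compose[OF _ h]) (unfold fan_point_def prod.case, measurable)
  have "(\<integral>\<^sup>+x. h x * ennreal \<bar>fan_weight D g \<beta> x\<bar> \<partial>lborel)
    = (\<integral>\<^sup>+l. \<integral>\<^sup>+s. ennreal (D * \<bar>l\<bar>) * (h (fan_point D \<beta> (s, l)) * ennreal \<bar>fan_weight D g \<beta> (fan_point D \<beta> (s, l))\<bar>) \<partial>lborel \<partial>lborel)"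
    by (rule nn_integral_fan[OF _ D]) measurable
  also have "\<dots> = (\<integral>\<^sup>+l. \<integral>\<^sup>+s. ennreal \<bar>g s \<beta>\<bar> * (ennreal (R s) * h (fan_point D \<beta> (s, l))) \<partial>lborel \<partial>lborel)"
  proof (rule nn_integral_cong_AE)
    have "AE l in lborel. l \<noteq> (0 :: real)" by (rule AE_lborel_singleton)
    then show "AE l in lborel.
      (\<integral>\<^sup>+s. ennreal (D * \<bar>l\<bar>) * (h (fan_point D \<beta> (s, l)) * ennreal \<bar>fan_weight D g \<beta> (fan_point D \<beta> (s, l))\<bar>) \<partial>lborel)
      = (\<integral>\<^sup>+s. ennreal \<bar>g s \<beta>\<bar> * (ennreal (R s) * h (fan_point D \<beta> (s, l))) \<partial>lborel)"
    proof eventually_elim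
      fix l :: real assume l: "l \<noteq> 0"
      have "ennreal (D * \<bar>l\<bar>) * ennreal \<bar>fan_weight D g \<beta> (fan_point D \<beta> (s, l))\<bar> = ennreal \<bar>g s \<beta>\<bar> * ennreal (R s)" for s
      proof -
        have "D * \<bar>l\<bar> * \<bar>fan_weight D g \<beta> (fan_point D \<beta> (s, l))\<bar> = \<bar>D * \<bar>l\<bar> * fan_weight D g \<beta> (fan_point D \<beta> (s, l))\<bar>"
          using D by (simp add: abs_mult)
        also have "\<dots> = \<bar>g s \<beta>\<bar> * R s"
          unfolding fan_weight_point[OF D l] using R[of s] by (simp add: abs_mult R_def)
        finally show ?thesis
          using D R[of s] by (simp flip: ennreal_mult)
      qed
      then show "(\<integral>\<^sup>+s. ennreal (D * \<bar>l\<bar>) * (h (fan_point D \<beta> (s, l)) * ennreal \<bar>fan_weight D g \<beta> (fan_point D \<beta> (s, l))\<bar>) \<partial>lborel)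
        = (\<integral>\<^sup>+s. ennreal \<bar>g s \<beta>\<bar> * (ennreal (R s) * h (fan_point D \<beta> (s, l))) \<partial>lborel)"
        by (intro nn_integral_cong) (metis mult.assoc mult.commute)
    qed
  qed
  also have "\<dots> = (\<integral>\<^sup>+s. \<integral>\<^sup>+l. ennreal \<bar>g s \<beta>\<bar> * (ennreal (R s) * h (fan_point D \<beta> (s, l))) \<partial>lborel \<partial>lborel)"
    by (rule lborel_pair.Fubini') measurable
  also have "\<dots> = (\<integral>\<^sup>+s. ennreal \<bar>g s \<beta>\<bar> * (\<integral>\<^sup>+u. h ((s * D / R s) *\<^sub>R xi (\<beta> + arctan (s / D))
        + u *\<^sub>R xi_perp (\<beta> + arctan (s / D))) \<partial>lborel) \<partial>lborel)"
  proof (rule nn_integral_cong)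
    fix s
    have "(\<integral>\<^sup>+l. h (fan_point D \<beta> (s, l)) \<partial>lborel)
      = ennreal \<bar>- 1 / R s\<bar> * (\<integral>\<^sup>+u. h (fan_point D \<beta> (s, (D / R s)\<^sup>2 + (- 1 / R s) * u)) \<partial>lborel)"
      using R[of s] by (intro nn_integral_real_affine) auto
    also have "(\<integral>\<^sup>+u. h (fan_point D \<beta> (s, (D / R s)\<^sup>2 + (- 1 / R s) * u)) \<partial>lborel)
      = (\<integral>\<^sup>+u. h ((s * D / R s) *\<^sub>R xi (\<beta> + arctan (s / D)) + u *\<^sub>R xi_perp (\<beta> + arctan (s / D))) \<partial>lborel)"
      unfolding R_def fan_point_on_line[OF D] ..
    finally have l: "(\<integral>\<^sup>+l. h (fan_point D \<beta> (s, l)) \<partial>lborel) = ennreal \<bar>- 1 / R s\<bar> *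
      (\<integral>\<^sup>+u. h ((s * D / R s) *\<^sub>R xi (\<beta> + arctan (s / D)) + u *\<^sub>R xi_perp (\<beta> + arctan (s / D))) \<partial>lborel)" .
    have "ennreal (R s) * ennreal \<bar>- 1 / R s\<bar> = 1"
      using R[of s] by (simp flip: ennreal_mult)
    then have "ennreal (R s) * (\<integral>\<^sup>+l. h (fan_point D \<beta> (s, l)) \<partial>lborel) =
      (\<integral>\<^sup>+u. h ((s * D / R s) *\<^sub>R xi (\<beta> + arctan (s / D)) + u *\<^sub>R xi_perp (\<beta> + arctan (s / D))) \<partial>lborel)"
      unfolding l by (simp only: mult.assoc[symmetric] mult_1_left)
    then show "(\<integral>\<^sup>+l. ennreal \<bar>g s \<beta>\<bar> * (ennreal (R s) * h (fan_point D \<beta> (s, l))) \<partial>lborel)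
      = ennreal \<bar>g s \<beta>\<bar> * (\<integral>\<^sup>+u. h ((s * D / R s) *\<^sub>R xi (\<beta> + arctan (s / D)) + u *\<^sub>R xi_perp (\<beta> + arctan (s / D))) \<partial>lborel)"
      using R[of s] by (simp add: nn_integral_cmult)
  qed
  finally show ?thesis by (simp only: R_def)
qed

lemma integral_fan_weight:
  fixes f :: "real \<times> real \<Rightarrow> complex"
  assumes D: "D > 0" and g: "fan_data g" and f [measurable]: "f \<in> borel_measurable borel"
    and int: "integrable lborel (\<lambda>x. f x * complex_of_real (fan_weight D g \<beta> x))"
  shows "(LINT x|lborel. f x * complex_of_real (fan_weight D g \<beta> x))
    = (LINT s|lborel. fan_radon D f s \<beta> * complex_of_real (g s \<beta>))"
proof -
  note [measurable] = fan_weight_measurable[OF g] fan_data_apply_measurable[OF g]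
  define R where "R s = sqrt (s\<^sup>2 + D\<^sup>2)" for s
  have R: "R s > 0" for s using D by (simp add: R_def add_nonneg_pos)
  have [measurable]: "R \<in> borel_measurable borel" unfolding R_def by measurable
  have T [measurable]: "fan_point D \<beta> \<in> borel_measurable borel"
    unfolding fan_point_def case_prod_unfold by measurable
  have eq: "emeasure lborel A = (\<integral>\<^sup>+p. ennreal (D * \<bar>snd p\<bar>) * indicator A (fan_point D \<beta> p) \<partial>lborel)"
    if "A \<in> sets lborel" for A
  proof -
    have [measurable]: "A \<in> sets borel" using that by simp
    have "emeasure lborel A = (\<integral>\<^sup>+x. indicator A x \<partial>lborel)" by simp
    also have "\<dots> = (\<integral>\<^sup>+p. ennreal (D * \<bar>snd p\<bar>) * indicator A (fan_point D \<beta> p) \<partial>lborel)"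
      by (subst nn_integral_fan[OF _ D, where \<beta> = \<beta>], measurable) (subst nn_integral_lborel_pair(2), auto)
    finally show ?thesis .
  qed
  let ?F = "\<lambda>x. f x * complex_of_real (fan_weight D g \<beta> x)"
  let ?H = "\<lambda>p. complex_of_real (g (fst p) \<beta>) * (complex_of_real (R (fst p)) * f (fan_point D \<beta> p))"
  have Tl: "fan_point D \<beta> \<in> lborel \<rightarrow>\<^sub>M lborel" "(\<lambda>p. D * \<bar>snd p\<bar>) \<in> borel_measurable (lborel :: (real \<times> real) measure)"
    and Fm: "?F \<in> borel_measurable lborel" and nonneg: "0 \<le> D * \<bar>snd p\<bar>" for p :: "real \<times> real"
    using D by (simp_all, measurable)
  note cov = change_of_variables[OF Tl nonneg eq Fm]
  have AE: "AE p in lborel. (D * \<bar>snd p\<bar>) *\<^sub>R ?F (fan_point D \<beta> p) = ?H p"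
  proof -
    have "AE p :: real \<times> real in lborel \<Otimes>\<^sub>M lborel. snd p \<noteq> 0"
      by (rule lborel_pair.AE_pair_measure, measurable) (simp add: AE_lborel_singleton)
    then have "AE p :: real \<times> real in lborel. snd p \<noteq> 0"
      unfolding lborel_prod .
    then show ?thesis
    proof eventually_elim
      fix p :: "real \<times> real" assume p: "snd p \<noteq> 0"
      have "D * \<bar>snd p\<bar> * fan_weight D g \<beta> (fan_point D \<beta> p) = R (fst p) * g (fst p) \<beta>"
        using fan_weight_point[OF D p, of g \<beta> "fst p"] by (simp add: R_def)
      then have "complex_of_real (D * \<bar>snd p\<bar>) * complex_of_real (fan_weight D g \<beta> (fan_point D \<beta> p))
        = complex_of_real (R (fst p)) * complex_of_real (g (fst p) \<beta>)"
        by (simp flip: of_real_mult)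
      then show "(D * \<bar>snd p\<bar>) *\<^sub>R ?F (fan_point D \<beta> p) = ?H p"
        unfolding scaleR_conv_of_real by (metis mult.commute mult.left_commute)
    qed
  qed
  have [measurable]: "?H \<in> borel_measurable lborel"
    by measurable
  have "integrable lborel ?H"
    using cov(1) int by (subst integrable_cong_AE[OF _ _ AE, symmetric]) auto
  then have i: "integrable (lborel \<Otimes>\<^sub>M lborel) (\<lambda>(s, l). ?H (s, l))"
    by (simp add: lborel_prod case_prod_unfold)
  have "integral\<^sup>L lborel ?F = (LINT p|lborel. (D * \<bar>snd p\<bar>) *\<^sub>R ?F (fan_point D \<beta> p))"
    by (rule cov(2))
  also have "\<dots> = integral\<^sup>L lborel ?H"
  proof (rule integral_cong_AE[OF _ _ AE])
    show "(\<lambda>p. (D * \<bar>snd p\<bar>) *\<^sub>R ?F (fan_point D \<beta> p)) \<in> borel_measurable lborel"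
      by measurable
  qed measurable
  also have "\<dots> = (LINT s|lborel. LINT l|lborel. ?H (s, l))"
    using lborel_pair.integral_fst[OF i] by (simp add: lborel_prod case_prod_unfold)
  also have "\<dots> = (LINT s|lborel. fan_radon D f s \<beta> * complex_of_real (g s \<beta>))"
  proof (rule Bochner_Integration.integral_cong)
    fix s
    have "(LINT l|lborel. f (fan_point D \<beta> (s, l)))
      = \<bar>- 1 / R s\<bar> *\<^sub>R (LINT u|lborel. f (fan_point D \<beta> (s, (D / R s)\<^sup>2 + (- 1 / R s) * u)))"
      using R[of s] by (intro lborel_integral_real_affine) auto
    also have "(LINT u|lborel. f (fan_point D \<beta> (s, (D / R s)\<^sup>2 + (- 1 / R s) * u))) = fan_radon D f s \<beta>"
      unfolding R_def fan_point_on_line[OF D] fan_radon_def radon_def ..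
    finally have "complex_of_real (R s) * (LINT l|lborel. f (fan_point D \<beta> (s, l))) = fan_radon D f s \<beta>"
      using R[of s] by (simp add: scaleR_conv_of_real)
    then show "(LINT l|lborel. ?H (s, l)) = fan_radon D f s \<beta> * complex_of_real (g s \<beta>)"
      by simp
  qed simp
  finally show ?thesis .
qed

lemma line_integral_bound:
  fixes f :: "real \<times> real \<Rightarrow> complex"
  assumes [measurable]: "f \<in> borel_measurable borel" and b: "\<And>x. norm (f x) \<le> C / (1 + (norm x)\<^sup>2)"
  shows "(\<integral>\<^sup>+u. ennreal (norm (f (t *\<^sub>R xi \<theta> + u *\<^sub>R xi_perp \<theta>))) \<partial>lborel) \<le> ennreal (C * (LINT u|lborel. 1 / (1 + u\<^sup>2)))"
    and "norm (radon f t \<theta>) \<le> C * (LINT u|lborel. 1 / (1 + u\<^sup>2))"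
proof -
  have C: "0 \<le> C" using order_trans[OF norm_ge_zero[of "f 0"], of C] b[of 0] by simp
  have I0: "0 \<le> C * (LINT u::real|lborel. 1 / (1 + u\<^sup>2))"
    using C by (intro mult_nonneg_nonneg integral_nonneg_AE) auto
  have fb: "norm (f (t *\<^sub>R xi \<theta> + u *\<^sub>R xi_perp \<theta>)) \<le> C * (1 / (1 + u\<^sup>2))" for u
  proof -
    have "C / (1 + (t\<^sup>2 + u\<^sup>2)) \<le> C / (1 + u\<^sup>2)"
      using C by (intro divide_left_mono mult_pos_pos add_pos_nonneg) auto
    then show ?thesis
      using b[of "t *\<^sub>R xi \<theta> + u *\<^sub>R xi_perp \<theta>"] by (simp add: norm_polar_frame)
  qed
  have "(\<integral>\<^sup>+u. ennreal (norm (f (t *\<^sub>R xi \<theta> + u *\<^sub>R xi_perp \<theta>))) \<partial>lborel) \<le> (\<integral>\<^sup>+u. ennreal (C * (1 / (1 + u\<^sup>2))) \<partial>lborel)"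
    by (intro nn_integral_mono ennreal_leI fb)
  also have "\<dots> = ennreal (LINT u|lborel. C * (1 / (1 + u\<^sup>2)))"
    using C by (intro nn_integral_eq_integral integrable_mult_right integrable_inverse_one_plus_square) auto
  finally show *: "(\<integral>\<^sup>+u. ennreal (norm (f (t *\<^sub>R xi \<theta> + u *\<^sub>R xi_perp \<theta>))) \<partial>lborel) \<le> ennreal (C * (LINT u|lborel. 1 / (1 + u\<^sup>2)))"
    by (simp only: integral_mult_right_zero)
  show "norm (radon f t \<theta>) \<le> C * (LINT u|lborel. 1 / (1 + u\<^sup>2))"
  proof (cases "integrable lborel (\<lambda>u. f (t *\<^sub>R xi \<theta> + u *\<^sub>R xi_perp \<theta>))")
    case True
    from order_trans[OF integral_norm_bound_ennreal[OF True] *] show ?thesis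
      unfolding radon_def using I0 by simp
  next
    case False
    then show ?thesis using I0 by (simp add: radon_def not_integrable_integral_eq)
  qed
qed

lemma fan_radon_measurable:
  assumes [measurable]: "f \<in> borel_measurable borel"
  shows "(\<lambda>p. fan_radon D f (fst p) (snd p)) \<in> borel_measurable borel"
proof -
  have "(\<lambda>p :: (real \<times> real) \<times> real. f ((fst (fst p) * D / sqrt ((fst (fst p))\<^sup>2 + D\<^sup>2)) *\<^sub>R xi (snd (fst p) + arctan (fst (fst p) / D))
      + snd p *\<^sub>R xi_perp (snd (fst p) + arctan (fst (fst p) / D)))) \<in> borel_measurable borel"
    by measurable
  from borel_measurable_parameter_integral[OF this] show ?thesis
    by (simp add: fan_radon_def radon_def)
qed

text \<open>
  The defining property of the adjoint, for all functions of quadratic decay.  The larger class is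
  needed because the identity is applied to Fourier transforms of Schwartz functions.
\<close>

lemma fan_adjoint_pairing:
  fixes f :: "real \<times> real \<Rightarrow> complex"
  assumes D: "D > 0" and g: "fan_data g" and f [measurable]: "f \<in> borel_measurable borel"
    and b: "\<And>x. norm (f x) \<le> C / (1 + (norm x)\<^sup>2)"
  shows "set_integrable lborel (UNIV \<times> {0..2 * pi}) (\<lambda>(s, \<beta>). fan_radon D f s \<beta> * complex_of_real (g s \<beta>))"
    and "integrable lborel (\<lambda>x. f x * complex_of_real (fan_adjoint D g x))"
    and "(LINT y:UNIV \<times> {0..2 * pi}|lborel. (case y of (s, \<beta>) \<Rightarrow> fan_radon D f s \<beta> * complex_of_real (g s \<beta>)))
      = (LINT x|lborel. f x * complex_of_real (fan_adjoint D g x))"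
proof -
  note [measurable] = fan_weight_measurable[OF g] fan_data_apply_measurable[OF g] fan_radon_measurable[OF f]
  have [measurable]: "UNIV \<times> {0..2 * pi} \<in> sets (borel :: (real \<times> real) measure)"
    by (intro borel_closed closed_Times) auto
  define I where "I = C * (LINT u::real|lborel. 1 / (1 + u\<^sup>2))"
  have gi: "set_integrable lborel (UNIV \<times> {0..2 * pi}) (\<lambda>(s, \<beta>). g s \<beta>)"
    using g by (simp add: fan_data_def)
  then have gic: "set_integrable lborel (UNIV \<times> {0..2 * pi}) (\<lambda>p. complex_of_real (g (fst p) (snd p)))"
    unfolding set_integrable_def
    by (auto simp: case_prod_unfold scaleR_conv_of_real dest: integrable_of_real[where 'a = complex])
  have rb: "norm (fan_radon D f s \<beta>) \<le> I" for s \<beta>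
    unfolding fan_radon_def I_def by (rule line_integral_bound(2)[OF f b])
  have "set_integrable lborel (UNIV \<times> {0..2 * pi}) (\<lambda>p. complex_of_real (g (fst p) (snd p)) * fan_radon D f (fst p) (snd p))"
    by (rule set_integrable_mult_bounded[OF gic _ rb]) simp
  then show ri: "set_integrable lborel (UNIV \<times> {0..2 * pi}) (\<lambda>(s, \<beta>). fan_radon D f s \<beta> * complex_of_real (g s \<beta>))"
    by (simp add: case_prod_unfold mult.commute)
  let ?i = "indicat_real {0..2 * pi}"
  let ?H = "\<lambda>\<beta> x. ?i \<beta> *\<^sub>R (f x * complex_of_real (fan_weight D g \<beta> x))"
  have "integrable lborel (\<lambda>p. ?H (fst p) (snd p))"
  proof (rule integrableI_bounded)
    show "(\<lambda>p. ?H (fst p) (snd p)) \<in> borel_measurable lborel"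
      by measurable
    have "(\<integral>\<^sup>+p. ennreal (norm (?H (fst p) (snd p))) \<partial>lborel)
      = (\<integral>\<^sup>+\<beta>. \<integral>\<^sup>+x. ennreal (norm (?H \<beta> x)) \<partial>lborel \<partial>lborel)"
      by (subst nn_integral_lborel_pair(1)) simp_all
    also have "\<dots> \<le> (\<integral>\<^sup>+\<beta>. \<integral>\<^sup>+s. ennreal I * ennreal \<bar>indicat_real (UNIV \<times> {0..2 * pi}) (s, \<beta>) * g s \<beta>\<bar> \<partial>lborel \<partial>lborel)"
    proof (rule nn_integral_mono)
      fix \<beta>
      have "(\<integral>\<^sup>+x. ennreal (norm (?H \<beta> x)) \<partial>lborel)
        = ennreal (?i \<beta>) * (\<integral>\<^sup>+x. ennreal (norm (f x)) * ennreal \<bar>fan_weight D g \<beta> x\<bar> \<partial>lborel)"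
        by (subst nn_integral_cmult[symmetric]) (auto simp: norm_mult ennreal_mult)
      also have "\<dots> \<le> ennreal (?i \<beta>) * (\<integral>\<^sup>+s. ennreal \<bar>g s \<beta>\<bar> * ennreal I \<partial>lborel)"
        unfolding nn_integral_fan_weight[OF D g, of "\<lambda>x. ennreal (norm (f x))", simplified] I_def
        by (intro mult_left_mono nn_integral_mono line_integral_bound(1)[OF f b]) auto
      also have "\<dots> = (\<integral>\<^sup>+s. ennreal I * ennreal \<bar>indicat_real (UNIV \<times> {0..2 * pi}) (s, \<beta>) * g s \<beta>\<bar> \<partial>lborel)"
        by (subst nn_integral_cmult[symmetric]) (auto intro!: nn_integral_cong simp: abs_mult mult_ac split: split_indicator)
      finally show "(\<integral>\<^sup>+x. ennreal (norm (?H \<beta> x)) \<partial>lborel)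
        \<le> (\<integral>\<^sup>+s. ennreal I * ennreal \<bar>indicat_real (UNIV \<times> {0..2 * pi}) (s, \<beta>) * g s \<beta>\<bar> \<partial>lborel)" .
    qed
    also have "\<dots> = (\<integral>\<^sup>+p. ennreal I * ennreal \<bar>indicat_real (UNIV \<times> {0..2 * pi}) p * g (fst p) (snd p)\<bar> \<partial>lborel)"
      by (subst nn_integral_lborel_pair(2)) auto
    also have "\<dots> = ennreal I * (\<integral>\<^sup>+p. ennreal \<bar>indicat_real (UNIV \<times> {0..2 * pi}) p * g (fst p) (snd p)\<bar> \<partial>lborel)"
      by (rule nn_integral_cmult) measurable
    also have "\<dots> < \<infinity>"
      using gi by (simp add: set_integrable_def case_prod_unfold integrable_iff_bounded ennreal_mult_less_top)
    finally show "(\<integral>\<^sup>+p. ennreal (norm (?H (fst p) (snd p))) \<partial>lborel) < \<infinity>" .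
  qed
  then have Hi: "integrable (lborel \<Otimes>\<^sub>M lborel) (case_prod ?H)"
    by (simp add: lborel_prod case_prod_unfold)
  have inner: "(LINT \<beta>|lborel. ?H \<beta> x) = f x * complex_of_real (fan_adjoint D g x)" for x
  proof -
    have "(LINT \<beta>|lborel. ?H \<beta> x) = (LINT \<beta>|lborel. f x * complex_of_real (?i \<beta> * fan_weight D g \<beta> x))"
      by (rule Bochner_Integration.integral_cong) (auto simp: scaleR_conv_of_real)
    then show ?thesis
      by (simp add: fan_adjoint_eq set_lebesgue_integral_def del: of_real_mult)
  qed
  show "integrable lborel (\<lambda>x. f x * complex_of_real (fan_adjoint D g x))"
    using lborel_pair.integrable_snd[OF Hi] by (simp only: inner)
  have "(LINT x|lborel. f x * complex_of_real (fan_adjoint D g x)) = (LINT \<beta>|lborel. LINT x|lborel. ?H \<beta> x)"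
    using lborel_pair.Fubini_integral[OF Hi] by (simp only: inner)
  also have "\<dots> = (LINT \<beta>|lborel. LINT s|lborel. indicat_real (UNIV \<times> {0..2 * pi}) (s, \<beta>) *\<^sub>R (fan_radon D f s \<beta> * complex_of_real (g s \<beta>)))"
  proof (rule integral_cong_AE)
    show "(\<lambda>\<beta>. LINT x|lborel. ?H \<beta> x) \<in> borel_measurable lborel"
      using lborel_pair.integrable_fst[OF Hi] by (rule borel_measurable_integrable)
    have "integrable (lborel \<Otimes>\<^sub>M lborel) (\<lambda>(s, \<beta>). indicat_real (UNIV \<times> {0..2 * pi}) (s, \<beta>) *\<^sub>R (fan_radon D f s \<beta> * complex_of_real (g s \<beta>)))"
      using ri by (simp add: set_integrable_def lborel_prod case_prod_unfold)
    from lborel_pair.integrable_snd[OF this]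
    show "(\<lambda>\<beta>. LINT s|lborel. indicat_real (UNIV \<times> {0..2 * pi}) (s, \<beta>) *\<^sub>R (fan_radon D f s \<beta> * complex_of_real (g s \<beta>))) \<in> borel_measurable lborel"
      by (rule borel_measurable_integrable)
    show "AE \<beta> in lborel. (LINT x|lborel. ?H \<beta> x)
      = (LINT s|lborel. indicat_real (UNIV \<times> {0..2 * pi}) (s, \<beta>) *\<^sub>R (fan_radon D f s \<beta> * complex_of_real (g s \<beta>)))"
      using lborel_pair.AE_integrable_fst[OF Hi]
    proof eventually_elim
      fix \<beta> assume i: "integrable lborel (?H \<beta>)"
      show "(LINT x|lborel. ?H \<beta> x)
        = (LINT s|lborel. indicat_real (UNIV \<times> {0..2 * pi}) (s, \<beta>) *\<^sub>R (fan_radon D f s \<beta> * complex_of_real (g s \<beta>)))"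
      proof (cases "\<beta> \<in> {0..2 * pi}")
        case True
        then show ?thesis
          using integral_fan_weight[OF D g f, of \<beta>] i by simp
      qed simp
    qed
  qed
  also have "\<dots> = (LINT y:UNIV \<times> {0..2 * pi}|lborel. (case y of (s, \<beta>) \<Rightarrow> fan_radon D f s \<beta> * complex_of_real (g s \<beta>)))"
  proof -
    have "integrable (lborel \<Otimes>\<^sub>M lborel) (\<lambda>(s, \<beta>). indicat_real (UNIV \<times> {0..2 * pi}) (s, \<beta>) *\<^sub>R (fan_radon D f s \<beta> * complex_of_real (g s \<beta>)))"
      using ri by (simp add: set_integrable_def lborel_prod case_prod_unfold)
    from lborel_pair.integral_snd[OF this] show ?thesis
      by (simp add: set_lebesgue_integral_def lborel_prod case_prod_unfold)
  qed
  finally show "(LINT y:UNIV \<times> {0..2 * pi}|lborel. (case y of (s, \<beta>) \<Rightarrow> fan_radon D f s \<beta> * complex_of_real (g s \<beta>)))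
      = (LINT x|lborel. f x * complex_of_real (fan_adjoint D g x))" ..
qed

section \<open>The rearranged sinogram\<close>

lemma set_integral_Icc_Ico:
  fixes f :: "real \<Rightarrow> 'b :: {banach, second_countable_topology}"
  shows "set_integrable lborel {a..b} f \<longleftrightarrow> set_integrable lborel {a..<b} f"
    and "(LINT x:{a..b}|lborel. f x) = (LINT x:{a..<b}|lborel. f x)"
    and "set_integrable lborel {a<..b} f \<longleftrightarrow> set_integrable lborel {a..<b} f"
    and "(LINT x:{a<..b}|lborel. f x) = (LINT x:{a..<b}|lborel. f x)"
    and "(LINT x:{a<..<b}|lborel. f x) = (LINT x:{a..<b}|lborel. f x)"
  unfolding set_integrable_def set_lebesgue_integral_def
  by ((rule integrable_discrete_difference[of "{a, b}"] integral_discrete_difference[of "{a, b}"];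
        auto simp: indicator_def)+)

lemma set_integral_periodic_shift:
  fixes f :: "real \<Rightarrow> 'b :: {banach, second_countable_topology}"
  assumes [measurable]: "f \<in> borel_measurable borel" and p: "p > 0" and per: "\<And>x. f (x + p) = f x"
  shows "(LINT x:{0..<p}|lborel. f (x + c)) = (LINT x:{0..<p}|lborel. f x)"
    and "(LINT x:{0..<p}|lborel. f (c - x)) = (LINT x:{0..<p}|lborel. f x)"
proof -
  have "(LINT x:{c..<c + p}|lborel. f x) = (LINT x:{0..<p}|lborel. f (x + c))"
    unfolding set_lebesgue_integral_def
    by (subst lborel_integral_real_affine[where c = 1 and t = c])
       (auto simp: add.commute[of c] indicator_def intro!: Bochner_Integration.integral_cong)
  then show "(LINT x:{0..<p}|lborel. f (x + c)) = (LINT x:{0..<p}|lborel. f x)"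
    using set_integral_periodic(2)[OF assms, of c 0] by simp
  have "(LINT x:{c - p<..c}|lborel. f x) = (LINT x:{0..<p}|lborel. f (c - x))"
    unfolding set_lebesgue_integral_def
    by (subst lborel_integral_real_affine[where c = "-1" and t = c])
       (auto simp: indicator_def intro!: Bochner_Integration.integral_cong)
  then show "(LINT x:{0..<p}|lborel. f (c - x)) = (LINT x:{0..<p}|lborel. f x)"
    using set_integral_periodic(2)[OF assms, of "c - p" 0] by (simp add: set_integral_Icc_Ico(4))
qed

lemma set_integral_half_period:
  fixes f :: "real \<Rightarrow> complex"
  assumes [measurable]: "f \<in> borel_measurable borel" and per: "\<And>x. f (x + pi) = f x"
    and int: "set_integrable lborel {0..<2 * pi} f"
  shows "(LINT x:{0..<2 * pi}|lborel. f x) = 2 * (LINT x:half_circle|lborel. f x)"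
proof -
  have U: "{0..<2 * pi} = {0..<pi} \<union> {pi..<pi + pi}" by auto
  have "(LINT x:{0..<2 * pi}|lborel. f x) = (LINT x:{0..<pi}|lborel. f x) + (LINT x:{pi..<pi + pi}|lborel. f x)"
    unfolding U by (rule set_integral_Un) (auto intro: set_integrable_subset[OF int])
  moreover have "(LINT x:{c..<c + pi}|lborel. f x) = (LINT x:{- (pi / 2)..<- (pi / 2) + pi}|lborel. f x)" for c
    by (rule set_integral_periodic(2)) (use per in auto)
  from this[of 0] this[of pi]
  have "(LINT x:{0..<pi}|lborel. f x) = (LINT x:{- (pi / 2)..<pi / 2}|lborel. f x)"
    "(LINT x:{pi..<pi + pi}|lborel. f x) = (LINT x:{- (pi / 2)..<pi / 2}|lborel. f x)"
    by simp_all
  ultimately show ?thesis by (simp add: set_integral_Icc_Ico(5))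
qed

lemma zdot_eq: "zdot D g \<theta> \<gamma> = D * (1 / cos \<gamma>)\<^sup>2 * g (D * tan \<gamma>) (\<theta> - \<gamma>)"
proof (cases "\<exists>k::int. \<gamma> = pi / 2 + of_int k * pi")
  case True
  then obtain k :: int where "\<gamma> = pi / 2 + of_int k * pi" by blast
  then have "cos \<gamma> = 0" by (simp add: cos_add mult.commute[of _ pi])
  with True show ?thesis by (simp add: zdot_def wdot_def tau_def)
qed (simp add: zdot_def wdot_def tau_def lin_to_std_def)

lemma zdot_periodic:
  assumes g: "fan_data g"
  shows "zdot D g (\<theta> + of_int k * (2 * pi)) \<gamma> = zdot D g \<theta> \<gamma>"
    and "zdot D g (\<theta> + pi) \<gamma> = zdot D g \<theta> (\<gamma> + pi)"
    and "zdot D g \<theta> (\<gamma> + 2 * pi) = zdot D g \<theta> \<gamma>"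
proof -
  show "zdot D g (\<theta> + of_int k * (2 * pi)) \<gamma> = zdot D g \<theta> \<gamma>"
    using fan_data_periodic(2)[OF g, of "D * tan \<gamma>" "\<theta> - \<gamma>" k] by (simp add: zdot_eq algebra_simps)
  have "g (D * tan \<gamma>) (\<theta> + pi - \<gamma>) = g (D * tan \<gamma>) (\<theta> - (\<gamma> + pi))"
    using fan_data_periodic(1)[OF g, of "D * tan \<gamma>" "\<theta> - (\<gamma> + pi)"] by (simp add: algebra_simps)
  then show "zdot D g (\<theta> + pi) \<gamma> = zdot D g \<theta> (\<gamma> + pi)"
    by (simp add: zdot_eq)
  have "tan (\<gamma> + 2 * pi) = tan \<gamma>" by (simp add: tan_def sin_add cos_add)
  then show "zdot D g \<theta> (\<gamma> + 2 * pi) = zdot D g \<theta> \<gamma>"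
    using fan_data_periodic(1)[OF g, of "D * tan \<gamma>" "\<theta> - (\<gamma> + 2 * pi)"] by (simp add: zdot_eq)
qed

lemma zdot_measurable:
  assumes g: "fan_data g" and [measurable]: "u \<in> borel_measurable M" "v \<in> borel_measurable M"
  shows "(\<lambda>x. zdot D g (u x) (v x)) \<in> borel_measurable M"
proof -
  have [measurable]: "(\<lambda>x. g (D * tan (v x)) (u x - v x)) \<in> borel_measurable M"
    unfolding tan_def by (intro fan_data_apply_measurable[OF g]) measurable
  show ?thesis unfolding zdot_eq by measurable
qed

text \<open>
  The integral of \<open>\<bar>zdot D g \<theta> \<gamma>\<bar>\<close> over \<open>\<theta>\<close> is \<open>\<pi>\<close>-periodic in \<open>\<gamma>\<close>, and over the fan it integrates
  to the integral of \<open>\<bar>g\<bar>\<close>, by \<open>s = D tan \<gamma>\<close>.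
\<close>

lemma zdot_integrable:
  assumes D: "D > 0" and g: "fan_data g"
  shows "set_integrable lborel ({0..<2 * pi} \<times> {0..<2 * pi}) (\<lambda>p. zdot D g (fst p) (snd p))"
proof -
  note [measurable] = zdot_measurable[OF g] fan_data_apply_measurable[OF g]
  define N where "N \<gamma> = (\<integral>\<^sup>+\<theta>. indicator {0..<2 * pi} \<theta> * ennreal \<bar>zdot D g \<theta> \<gamma>\<bar> \<partial>lborel)" for \<gamma>
  define q where "q s = (\<integral>\<^sup>+\<beta>. indicator {0..<2 * pi} \<beta> * ennreal \<bar>g s \<beta>\<bar> \<partial>lborel)" for s
  have qm [measurable]: "q \<in> borel_measurable borel"
  proof -
    have "(\<lambda>p :: real \<times> real. indicator {0..<2 * pi} (snd p) * ennreal \<bar>g (fst p) (snd p)\<bar>) \<in> borel_measurable (borel \<Otimes>\<^sub>M lborel)"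
      by measurable
    from lborel.borel_measurable_nn_integral_fst[OF this] show ?thesis
      by (simp add: q_def[abs_def])
  qed
  have Nq: "N \<gamma> = ennreal (D * (1 / cos \<gamma>)\<^sup>2) * q (D * tan \<gamma>)" for \<gamma>
  proof -
    have "N \<gamma> = (\<integral>\<^sup>+\<beta>. indicator {- \<gamma>..<- \<gamma> + 2 * pi} \<beta> * ennreal \<bar>zdot D g (\<beta> + \<gamma>) \<gamma>\<bar> \<partial>lborel)"
      unfolding N_def
      by (subst nn_integral_real_affine[where c = 1 and t = \<gamma>])
         (auto simp: add.commute[of \<gamma>] indicator_def intro!: nn_integral_cong)
    also have "\<dots> = (\<integral>\<^sup>+\<beta>. indicator {0..<2 * pi} \<beta> * ennreal \<bar>zdot D g (\<beta> + \<gamma>) \<gamma>\<bar> \<partial>lborel)"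
    proof (rule nn_integral_periodic)
      show "ennreal \<bar>zdot D g (x + 2 * pi + \<gamma>) \<gamma>\<bar> = ennreal \<bar>zdot D g (x + \<gamma>) \<gamma>\<bar>" for x
        using zdot_periodic(1)[OF g, of D "x + \<gamma>" 1 \<gamma>] by (simp add: algebra_simps)
    qed auto
    also have "\<dots> = (\<integral>\<^sup>+\<beta>. ennreal (D * (1 / cos \<gamma>)\<^sup>2) * (indicator {0..<2 * pi} \<beta> * ennreal \<bar>g (D * tan \<gamma>) \<beta>\<bar>) \<partial>lborel)"
      using D by (intro nn_integral_cong) (simp add: zdot_eq abs_mult ennreal_mult mult_ac)
    also have "\<dots> = ennreal (D * (1 / cos \<gamma>)\<^sup>2) * q (D * tan \<gamma>)"
      unfolding q_def by (rule nn_integral_cmult) measurable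
    finally show ?thesis .
  qed
  have [measurable]: "N \<in> borel_measurable borel"
    unfolding Nq tan_def by measurable
  have Nper: "N (\<gamma> + pi) = N \<gamma>" for \<gamma>
    unfolding Nq by simp
  have q: "(\<integral>\<^sup>+s. q s \<partial>lborel) < \<infinity>"
  proof -
    have "(\<integral>\<^sup>+s. q s \<partial>lborel) = (\<integral>\<^sup>+p. indicator {0..<2 * pi} (snd p) * ennreal \<bar>g (fst p) (snd p)\<bar> \<partial>lborel)"
      unfolding q_def by (subst nn_integral_lborel_pair(1)) auto
    also have "\<dots> \<le> (\<integral>\<^sup>+p. ennreal (norm (indicat_real (UNIV \<times> {0..2 * pi}) p *\<^sub>R g (fst p) (snd p))) \<partial>lborel)"
      by (intro nn_integral_mono) (auto split: split_indicator)
    also have "\<dots> < \<infinity>"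
      using g by (simp add: fan_data_def set_integrable_def integrable_iff_bounded case_prod_unfold)
    finally show ?thesis .
  qed
  have half: "(\<integral>\<^sup>+\<gamma>. indicator {- (pi / 2)..<- (pi / 2) + pi} \<gamma> * N \<gamma> \<partial>lborel) = (\<integral>\<^sup>+s. q s \<partial>lborel)"
  proof -
    have "(\<integral>\<^sup>+s. q s \<partial>lborel) = ennreal \<bar>D\<bar> * (\<integral>\<^sup>+s. q (0 + D * s) \<partial>lborel)"
      using D by (intro nn_integral_real_affine) auto
    also have "\<dots> = ennreal D * (\<integral>\<^sup>+\<gamma>. ennreal (indicator half_circle \<gamma> / (cos \<gamma>)\<^sup>2) * q (D * tan \<gamma>) \<partial>lborel)"
      using D by (subst nn_integral_tan) auto
    also have "\<dots> = (\<integral>\<^sup>+\<gamma>. ennreal D * (ennreal (indicator half_circle \<gamma> / (cos \<gamma>)\<^sup>2) * q (D * tan \<gamma>)) \<partial>lborel)"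
      by (rule nn_integral_cmult[symmetric]) (unfold tan_def, measurable)
    also have "\<dots> = (\<integral>\<^sup>+\<gamma>. indicator {- (pi / 2)..<- (pi / 2) + pi} \<gamma> * N \<gamma> \<partial>lborel)"
    proof (rule nn_integral_cong)
      fix \<gamma> :: real
      show "ennreal D * (ennreal (indicator half_circle \<gamma> / (cos \<gamma>)\<^sup>2) * q (D * tan \<gamma>)) = indicator {- (pi / 2)..<- (pi / 2) + pi} \<gamma> * N \<gamma>"
      proof (cases "\<gamma> = - (pi / 2)")
        case True
        then show ?thesis unfolding Nq by simp
      next
        case False
        then have "indicator {- (pi / 2)..<- (pi / 2) + pi} \<gamma> = (indicator half_circle \<gamma> :: ennreal)"
          by (auto simp: indicator_def)
        moreover have "ennreal D * ennreal (1 / (cos \<gamma>)\<^sup>2) = ennreal (D * (1 / cos \<gamma>)\<^sup>2)"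
          using D by (simp add: power_divide flip: ennreal_mult)
        ultimately show ?thesis unfolding Nq
          by (cases "\<gamma> \<in> half_circle") (simp_all flip: mult.assoc)
      qed
    qed
    finally show ?thesis ..
  qed
  have "(\<integral>\<^sup>+\<gamma>. indicator {0..<2 * pi} \<gamma> * N \<gamma> \<partial>lborel)
    = (\<integral>\<^sup>+\<gamma>. indicator {0..<0 + pi} \<gamma> * N \<gamma> + indicator {pi..<pi + pi} \<gamma> * N \<gamma> \<partial>lborel)"
    by (intro nn_integral_cong) (auto simp: indicator_def)
  also have "\<dots> = (\<integral>\<^sup>+\<gamma>. indicator {0..<0 + pi} \<gamma> * N \<gamma> \<partial>lborel) + (\<integral>\<^sup>+\<gamma>. indicator {pi..<pi + pi} \<gamma> * N \<gamma> \<partial>lborel)"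
    by (rule nn_integral_add) measurable
  also have "\<dots> < \<infinity>"
    using q half nn_integral_periodic[of N pi, OF _ pi_gt_zero Nper, of pi] nn_integral_periodic[of N pi, OF _ pi_gt_zero Nper, of "- (pi / 2)"]
    by simp
  finally have fin: "(\<integral>\<^sup>+\<gamma>. indicator {0..<2 * pi} \<gamma> * N \<gamma> \<partial>lborel) < \<infinity>" .
  show ?thesis
    unfolding set_integrable_def
  proof (rule integrableI_bounded)
    have [measurable]: "{0..<2 * pi} \<times> {0..<2 * pi} \<in> sets (borel :: (real \<times> real) measure)"
      unfolding borel_prod[symmetric] by measurable
    show "(\<lambda>p. indicat_real ({0..<2 * pi} \<times> {0..<2 * pi}) p *\<^sub>R zdot D g (fst p) (snd p)) \<in> borel_measurable lborel"
      by measurable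
    have "(\<integral>\<^sup>+p. ennreal (norm (indicat_real ({0..<2 * pi} \<times> {0..<2 * pi}) p *\<^sub>R zdot D g (fst p) (snd p))) \<partial>lborel)
      = (\<integral>\<^sup>+\<gamma>. \<integral>\<^sup>+\<theta>. indicator {0..<2 * pi} \<gamma> * (indicator {0..<2 * pi} \<theta> * ennreal \<bar>zdot D g \<theta> \<gamma>\<bar>) \<partial>lborel \<partial>lborel)"
      by (subst nn_integral_lborel_pair(2), measurable) (intro nn_integral_cong, simp add: indicator_def)
    also have "\<dots> = (\<integral>\<^sup>+\<gamma>. indicator {0..<2 * pi} \<gamma> * N \<gamma> \<partial>lborel)"
      unfolding N_def by (intro nn_integral_cong nn_integral_cmult) measurable
    finally show "(\<integral>\<^sup>+p. ennreal (norm (indicat_real ({0..<2 * pi} \<times> {0..<2 * pi}) p *\<^sub>R zdot D g (fst p) (snd p))) \<partial>lborel) < \<infinity>"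
      using fin by simp
  qed
qed

lemma AE_zdot_integrable:
  assumes D: "D > 0" and g: "fan_data g"
  shows "AE \<theta> in lborel. set_integrable lborel {0..2 * pi} (zdot D g \<theta>)"
proof -
  note [measurable] = zdot_measurable[OF g]
  define M where "M \<theta> = (\<integral>\<^sup>+\<gamma>. indicator {0..<2 * pi} \<gamma> * ennreal \<bar>zdot D g \<theta> \<gamma>\<bar> \<partial>lborel)" for \<theta>
  have Mm [measurable]: "M \<in> borel_measurable borel"
  proof -
    have "(\<lambda>p :: real \<times> real. indicator {0..<2 * pi} (snd p) * ennreal \<bar>zdot D g (fst p) (snd p)\<bar>) \<in> borel_measurable (borel \<Otimes>\<^sub>M lborel)"
      by measurable
    from lborel.borel_measurable_nn_integral_fst[OF this] show ?thesis
      by (simp add: M_def[abs_def])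
  qed
  have Mper: "M (\<theta> + 2 * pi) = M \<theta>" for \<theta>
    using zdot_periodic(1)[OF g, of D \<theta> 1] by (simp add: M_def)
  have "(\<integral>\<^sup>+\<theta>. indicator {0..<2 * pi} \<theta> * M \<theta> \<partial>lborel)
    = (\<integral>\<^sup>+p. ennreal (norm (indicat_real ({0..<2 * pi} \<times> {0..<2 * pi}) p *\<^sub>R zdot D g (fst p) (snd p))) \<partial>lborel)"
  proof -
    have [measurable]: "{0..<2 * pi} \<times> {0..<2 * pi} \<in> sets (borel :: (real \<times> real) measure)"
      unfolding borel_prod[symmetric] by measurable
    have z: "(\<lambda>p. ennreal (norm (indicat_real ({0..<2 * pi} \<times> {0..<2 * pi}) p *\<^sub>R zdot D g (fst p) (snd p)))) \<in> borel_measurable borel"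
      by (intro measurable_compose[OF _ measurable_ennreal] borel_measurable_norm borel_measurable_scaleR zdot_measurable[OF g])
         simp_all
    have "(\<integral>\<^sup>+\<theta>. indicator {0..<2 * pi} \<theta> * M \<theta> \<partial>lborel)
      = (\<integral>\<^sup>+\<theta>. \<integral>\<^sup>+\<gamma>. indicator {0..<2 * pi} \<theta> * (indicator {0..<2 * pi} \<gamma> * ennreal \<bar>zdot D g \<theta> \<gamma>\<bar>) \<partial>lborel \<partial>lborel)"
      unfolding M_def by (intro nn_integral_cong nn_integral_cmult[symmetric]) measurable
    also have "\<dots> = (\<integral>\<^sup>+p. ennreal (norm (indicat_real ({0..<2 * pi} \<times> {0..<2 * pi}) p *\<^sub>R zdot D g (fst p) (snd p))) \<partial>lborel)"
      unfolding nn_integral_lborel_pair(1)[OF z]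
      by (intro nn_integral_cong) (auto simp: indicator_def)
    finally show ?thesis .
  qed
  also have "\<dots> < \<infinity>"
    using zdot_integrable[OF assms] by (simp add: set_integrable_def integrable_iff_bounded)
  finally have "(\<integral>\<^sup>+\<theta>. indicator {a..<a + 2 * pi} \<theta> * M \<theta> \<partial>lborel) \<noteq> \<infinity>" for a
    using nn_integral_periodic[of M "2 * pi", OF _ _ Mper, of a] by simp
  then have "AE \<theta> in lborel. indicator {a..<a + 2 * pi} \<theta> * M \<theta> \<noteq> \<infinity>" for a
    by (intro nn_integral_PInf_AE) measurable
  then have "AE \<theta> in lborel. \<forall>k::int. indicator {of_int k * (2 * pi)..<of_int k * (2 * pi) + 2 * pi} \<theta> * M \<theta> \<noteq> \<infinity>"
    by (simp add: AE_all_countable)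
  then show ?thesis
  proof eventually_elim
    fix \<theta> assume *: "\<forall>k::int. indicator {of_int k * (2 * pi)..<of_int k * (2 * pi) + 2 * pi} \<theta> * M \<theta> \<noteq> \<infinity>"
    have "of_int \<lfloor>\<theta> / (2 * pi)\<rfloor> * (2 * pi) \<le> \<theta>" "\<theta> < (of_int \<lfloor>\<theta> / (2 * pi)\<rfloor> + 1) * (2 * pi)"
      using floor_correct[of "\<theta> / (2 * pi)"] pi_gt_zero
      by (simp_all only: pos_le_divide_eq pos_divide_less_eq mult_pos_pos zero_less_numeral of_int_add of_int_1)
    then have "\<theta> \<in> {of_int \<lfloor>\<theta> / (2 * pi)\<rfloor> * (2 * pi)..<of_int \<lfloor>\<theta> / (2 * pi)\<rfloor> * (2 * pi) + 2 * pi}"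
      by (simp add: distrib_right)
    with *[rule_format, of "\<lfloor>\<theta> / (2 * pi)\<rfloor>"] have "M \<theta> \<noteq> \<infinity>" by simp
    moreover have "(\<integral>\<^sup>+\<gamma>. ennreal (norm (indicat_real {0..<2 * pi} \<gamma> *\<^sub>R zdot D g \<theta> \<gamma>)) \<partial>lborel) = M \<theta>"
      unfolding M_def by (intro nn_integral_cong) (auto split: split_indicator)
    ultimately have "set_integrable lborel {0..<2 * pi} (zdot D g \<theta>)"
      unfolding set_integrable_def by (intro integrableI_bounded) (auto simp: less_top)
    then show "set_integrable lborel {0..2 * pi} (zdot D g \<theta>)"
      by (simp add: set_integral_Icc_Ico(1))
  qed
qed

text \<open>The parameters \<open>(t, \<theta>)\<close> and \<open>(- t, \<theta> + \<pi>)\<close> describe the same line.\<close>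

lemma radon_antipodal: "radon f (- t) (\<theta> + pi) = radon f t \<theta>"
proof -
  have "radon f (- t) (\<theta> + pi) = (LINT u|lborel. f (t *\<^sub>R xi \<theta> + (0 + (- 1) * u) *\<^sub>R xi_perp \<theta>))"
    by (simp add: radon_def xi_def xi_perp_def)
  also have "\<dots> = radon f t \<theta>"
    unfolding radon_def by (subst (2) lborel_integral_real_affine[where c = "-1" and t = 0]) auto
  finally show ?thesis .
qed

lemma radon_periodic: "radon f t (\<theta> + 2 * pi) = radon f t \<theta>"
  by (simp add: radon_def xi_def xi_perp_def)

lemma radon_measurable:
  assumes [measurable]: "f \<in> borel_measurable borel"
  shows "(\<lambda>p. radon f (fst p) (snd p)) \<in> borel_measurable borel"
proof -
  have "(\<lambda>p :: (real \<times> real) \<times> real. f (fst (fst p) *\<^sub>R xi (snd (fst p)) + snd p *\<^sub>R xi_perp (snd (fst p)))) \<in> borel_measurable borel"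
    by measurable
  from borel_measurable_parameter_integral[OF this] show ?thesis
    by (simp add: radon_def)
qed

text \<open>
  The pairing in the parallel coordinates \<open>(D sin \<gamma>, \<theta>)\<close>.  Both partial integrals of the integrand over
  full periods are \<open>\<pi>\<close>-periodic, so each of them integrates over a half period to half of the
  integral over the square of full periods.
\<close>

lemma fan_pairing_parallel:
  fixes f :: "real \<times> real \<Rightarrow> complex"
  assumes D: "D > 0" and g: "fan_data g" and f [measurable]: "f \<in> borel_measurable borel"
    and b: "\<And>x. norm (f x) \<le> C / (1 + (norm x)\<^sup>2)"
  shows "(LINT y:UNIV \<times> {0..2 * pi}|lborel. (case y of (s, \<beta>) \<Rightarrow> fan_radon D f s \<beta> * complex_of_real (g s \<beta>)))
    = (LINT \<theta>:half_circle|lborel. LINT \<gamma>:{0..<2 * pi}|lborel. complex_of_real (zdot D g \<theta> \<gamma>) * radon f (D * sin \<gamma>) \<theta>)"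
proof -
  define I where "I = C * (LINT u::real|lborel. 1 / (1 + u\<^sup>2))"
  have rb: "norm (radon f t \<theta>) \<le> I" for t \<theta>
    unfolding I_def by (rule line_integral_bound(2)[OF f b])
  have rm [measurable]: "(\<lambda>x. radon f (u x) (v x)) \<in> borel_measurable M"
    if [measurable]: "u \<in> borel_measurable M" "v \<in> borel_measurable M" for u v and M :: "'x measure"
    using measurable_compose[OF _ radon_measurable[OF f], of "\<lambda>x. (u x, v x)" M] by simp
  note [measurable] = zdot_measurable[OF g] fan_data_apply_measurable[OF g]
  define E where "E \<theta> \<gamma> = complex_of_real (zdot D g \<theta> \<gamma>) * radon f (D * sin \<gamma>) \<theta>" for \<theta> \<gamma>
  have [measurable]: "(\<lambda>x. E (u x) (v x)) \<in> borel_measurable M"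
    if [measurable]: "u \<in> borel_measurable M" "v \<in> borel_measurable M" for u v and M :: "'x measure"
    unfolding E_def by measurable
  have E\<theta>: "E (\<theta> + 2 * pi) \<gamma> = E \<theta> \<gamma>" for \<theta> \<gamma>
    using zdot_periodic(1)[OF g, of D \<theta> 1] by (simp add: E_def radon_periodic)
  have E\<gamma>: "E \<theta> (\<gamma> + 2 * pi) = E \<theta> \<gamma>" for \<theta> \<gamma>
    by (simp add: E_def zdot_periodic(3)[OF g])
  have Epi: "E \<theta> (\<gamma> + pi) = E (\<theta> + pi) \<gamma>" for \<theta> \<gamma>
    using radon_antipodal[of f "- (D * sin \<gamma>)" \<theta>] by (simp add: E_def zdot_periodic(2)[OF g])
  define H where "H \<theta> = (LINT \<gamma>:{0..<2 * pi}|lborel. E \<theta> \<gamma>)" for \<theta>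
  define K where "K \<gamma> = (LINT \<theta>:{0..<2 * pi}|lborel. E \<theta> \<gamma>)" for \<gamma>
  have Hper: "H (\<theta> + pi) = H \<theta>" for \<theta>
    unfolding H_def Epi[symmetric] by (rule set_integral_periodic_shift(1)) (auto simp: E\<gamma>)
  have Kper: "K (\<gamma> + pi) = K \<gamma>" for \<gamma>
    unfolding K_def Epi by (rule set_integral_periodic_shift(1)) (auto simp: E\<theta>)
  let ?i = "indicat_real {0..<2 * pi}"
  have Ei: "integrable (lborel \<Otimes>\<^sub>M lborel) (\<lambda>(\<theta>, \<gamma>). ?i \<theta> *\<^sub>R ?i \<gamma> *\<^sub>R E \<theta> \<gamma>)"
  proof -
    have "set_integrable lborel ({0..<2 * pi} \<times> {0..<2 * pi}) (\<lambda>p. complex_of_real (zdot D g (fst p) (snd p)))"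
      using zdot_integrable[OF D g] unfolding set_integrable_def
      by (auto simp: scaleR_conv_of_real dest: integrable_of_real[where 'a = complex])
    from set_integrable_mult_bounded[OF this _ rb, of "\<lambda>p. D * sin (snd p)" fst]
    have "set_integrable lborel ({0..<2 * pi} \<times> {0..<2 * pi}) (\<lambda>p. E (fst p) (snd p))"
      by (simp add: E_def)
    then show ?thesis
      by (simp add: set_integrable_def lborel_prod case_prod_unfold indicator_times)
  qed
  have Hi: "integrable lborel (\<lambda>\<theta>. ?i \<theta> *\<^sub>R H \<theta>)"
    using lborel_pair.integrable_fst[OF Ei] by (simp add: H_def set_lebesgue_integral_def del: scaleR_scaleR)
  have "(\<lambda>\<gamma>. LINT \<theta>|lborel. ?i \<theta> *\<^sub>R ?i \<gamma> *\<^sub>R E \<theta> \<gamma>) = (\<lambda>\<gamma>. ?i \<gamma> *\<^sub>R K \<gamma>)"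
    by (simp add: K_def set_lebesgue_integral_def scaleR_left_commute[of "?i _" "?i _"] del: scaleR_scaleR)
  then have Ki: "integrable lborel (\<lambda>\<gamma>. ?i \<gamma> *\<^sub>R K \<gamma>)"
    and HK: "(LINT \<gamma>|lborel. ?i \<gamma> *\<^sub>R K \<gamma>) = (LINT \<theta>|lborel. ?i \<theta> *\<^sub>R H \<theta>)"
    using lborel_pair.integrable_snd[OF Ei] lborel_pair.Fubini_integral[OF Ei]
    by (simp_all add: H_def set_lebesgue_integral_def del: scaleR_scaleR)
  have [measurable]: "H \<in> borel_measurable borel"
  proof -
    have "(\<lambda>p. ?i (snd p) *\<^sub>R E (fst p) (snd p)) \<in> borel_measurable borel" by measurable
    from borel_measurable_parameter_integral[OF this] show ?thesis
      by (simp add: H_def[abs_def] set_lebesgue_integral_def)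
  qed
  have [measurable]: "K \<in> borel_measurable borel"
  proof -
    have "(\<lambda>p. ?i (snd p) *\<^sub>R E (snd p) (fst p)) \<in> borel_measurable borel" by measurable
    from borel_measurable_parameter_integral[OF this] show ?thesis
      by (simp add: K_def[abs_def] set_lebesgue_integral_def)
  qed
  have "2 * (LINT \<theta>:half_circle|lborel. H \<theta>) = 2 * (LINT \<gamma>:half_circle|lborel. K \<gamma>)"
    using set_integral_half_period[of H, OF _ Hper] set_integral_half_period[of K, OF _ Kper] Hi Ki HK
    by (simp add: set_integrable_def set_lebesgue_integral_def)
  then have HKh: "(LINT \<theta>:half_circle|lborel. H \<theta>) = (LINT \<gamma>:half_circle|lborel. K \<gamma>)"
    by simp
  define q where "q s = (LINT \<beta>:{0..2 * pi}|lborel. fan_radon D f s \<beta> * complex_of_real (g s \<beta>))" for s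
  have frm [measurable]: "(\<lambda>x. fan_radon D f (u x) (v x)) \<in> borel_measurable M"
    if [measurable]: "u \<in> borel_measurable M" "v \<in> borel_measurable M" for u v and M :: "'x measure"
    unfolding fan_radon_def by measurable
  have ri: "integrable (lborel \<Otimes>\<^sub>M lborel)
      (\<lambda>(s, \<beta>). indicat_real (UNIV \<times> {0..2 * pi}) (s, \<beta>) *\<^sub>R (fan_radon D f s \<beta> * complex_of_real (g s \<beta>)))"
    using fan_adjoint_pairing(1)[OF D g f b] by (simp add: set_integrable_def lborel_prod case_prod_unfold)
  have qe: "q s = (LINT \<beta>|lborel. indicat_real (UNIV \<times> {0..2 * pi}) (s, \<beta>) *\<^sub>R (fan_radon D f s \<beta> * complex_of_real (g s \<beta>)))" for s
    unfolding q_def set_lebesgue_integral_def by (simp add: indicator_times)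
  have qm [measurable]: "q \<in> borel_measurable lborel"
    using lborel_pair.integrable_fst[OF ri, THEN borel_measurable_integrable] unfolding qe .
  have "(LINT y:UNIV \<times> {0..2 * pi}|lborel. (case y of (s, \<beta>) \<Rightarrow> fan_radon D f s \<beta> * complex_of_real (g s \<beta>)))
    = (LINT s|lborel. q s)"
    using lborel_pair.integral_fst[OF ri]
    unfolding qe by (simp add: set_lebesgue_integral_def lborel_prod case_prod_unfold)
  also have "\<dots> = (LINT \<gamma>|lborel. (indicat_real half_circle \<gamma> * (D / (cos \<gamma>)\<^sup>2)) *\<^sub>R q (D * tan \<gamma>))"
  proof (rule change_of_variables(2))
    fix A :: "real set" assume "A \<in> sets lborel"
    then have [measurable]: "A \<in> sets borel" by simp
    have "emeasure lborel A = (\<integral>\<^sup>+s. indicator A s \<partial>lborel)" by simp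
    also have "\<dots> = ennreal \<bar>D\<bar> * (\<integral>\<^sup>+s. indicator A (0 + D * s) \<partial>lborel)"
      using D by (intro nn_integral_real_affine) auto
    also have "\<dots> = ennreal D * (\<integral>\<^sup>+\<gamma>. ennreal (indicator half_circle \<gamma> / (cos \<gamma>)\<^sup>2) * indicator A (D * tan \<gamma>) \<partial>lborel)"
      using D by (subst nn_integral_tan) auto
    also have "\<dots> = (\<integral>\<^sup>+\<gamma>. ennreal D * (ennreal (indicator half_circle \<gamma> / (cos \<gamma>)\<^sup>2) * indicator A (D * tan \<gamma>)) \<partial>lborel)"
      by (rule nn_integral_cmult[symmetric]) (unfold tan_def, measurable)
    also have "\<dots> = (\<integral>\<^sup>+\<gamma>. ennreal (indicat_real half_circle \<gamma> * (D / (cos \<gamma>)\<^sup>2)) * indicator A (D * tan \<gamma>) \<partial>lborel)"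
      using D by (intro nn_integral_cong) (auto simp: mult.assoc[symmetric] simp flip: ennreal_mult split: split_indicator)
    finally show "emeasure lborel A = (\<integral>\<^sup>+\<gamma>. ennreal (indicat_real half_circle \<gamma> * (D / (cos \<gamma>)\<^sup>2)) * indicator A (D * tan \<gamma>) \<partial>lborel)" .
  next
    show "(\<lambda>\<gamma>. D * tan \<gamma>) \<in> lborel \<rightarrow>\<^sub>M lborel" unfolding tan_def by simp
  qed (use D in auto)
  also have "\<dots> = (LINT \<gamma>:half_circle|lborel. K \<gamma>)"
    unfolding set_lebesgue_integral_def
  proof (rule Bochner_Integration.integral_cong)
    fix \<gamma> :: real
    show "(indicat_real half_circle \<gamma> * (D / (cos \<gamma>)\<^sup>2)) *\<^sub>R q (D * tan \<gamma>) = indicat_real half_circle \<gamma> *\<^sub>R K \<gamma>"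
    proof (cases "\<gamma> \<in> half_circle")
      case True
      then have c: "cos \<gamma> > 0" by (intro cos_gt_zero_pi) auto
      have at: "arctan (tan \<gamma>) = \<gamma>" using True by (intro arctan_tan) auto
      have "sqrt ((D * tan \<gamma>)\<^sup>2 + D\<^sup>2) = D / cos \<gamma>"
      proof -
        have "(D * tan \<gamma>)\<^sup>2 + D\<^sup>2 = D\<^sup>2 * ((sin \<gamma>)\<^sup>2 + (cos \<gamma>)\<^sup>2) / (cos \<gamma>)\<^sup>2"
          using c by (simp add: tan_def field_simps
              del: sin_cos_squared_add sin_cos_squared_add2 sin_cos_squared_add3)
        then have "(D * tan \<gamma>)\<^sup>2 + D\<^sup>2 = (D / cos \<gamma>)\<^sup>2" by (simp add: power_divide)
        then show ?thesis using D c by simp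
      qed
      then have t: "D * tan \<gamma> * D / sqrt ((D * tan \<gamma>)\<^sup>2 + D\<^sup>2) = D * sin \<gamma>"
        using D c by (simp add: tan_def field_simps)
      have fr: "fan_radon D f (D * tan \<gamma>) \<beta> = radon f (D * sin \<gamma>) (\<beta> + \<gamma>)" for \<beta>
        unfolding fan_radon_def t using D at by simp
      have "(D / (cos \<gamma>)\<^sup>2) *\<^sub>R q (D * tan \<gamma>) = (LINT \<beta>:{0..2 * pi}|lborel. E (\<beta> + \<gamma>) \<gamma>)"
        unfolding q_def set_lebesgue_integral_def integral_scaleR_right[symmetric] fr
        by (rule Bochner_Integration.integral_cong)
           (auto simp: E_def zdot_eq scaleR_conv_of_real power_divide)
      also have "\<dots> = K \<gamma>"
        unfolding set_integral_Icc_Ico(2) K_def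
        by (rule set_integral_periodic_shift(1)) (auto simp: E\<theta>)
      finally show ?thesis using True by simp
    qed simp
  qed simp
  also have "\<dots> = (LINT \<theta>:half_circle|lborel. H \<theta>)" by (rule HKh[symmetric])
  finally show ?thesis unfolding H_def E_def .
qed

section \<open>The Fourier transform of the adjoint image\<close>

text \<open>
  A polar angle of \<open>k\<close>, given by an explicit formula so that its measurability is evident.  It lies
  between \<open>- \<pi>/2\<close> and \<open>3 \<pi>/2\<close>; at the origin its value is irrelevant.
\<close>

definition plane_angle :: "real \<times> real \<Rightarrow> real" where
  "plane_angle k = (if fst k = 0 then (if snd k > 0 then pi / 2 else - (pi / 2))
     else arctan (snd k / fst k) + (if fst k < 0 then pi else 0))"

lemma xi_plane_angle:
  assumes "k \<noteq> 0"
  shows "norm k *\<^sub>R xi (plane_angle k) = k"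
proof -
  obtain x y where k: "k = (x, y)" by (cases k)
  show ?thesis
  proof (cases "x = 0")
    case True
    then show ?thesis by (auto simp: k plane_angle_def xi_def)
  next
    case False
    have n: "norm k = sqrt (x\<^sup>2 + y\<^sup>2)" "norm k > 0"
      using assms by (simp_all add: k norm_prod_def sum_power2_gt_zero_iff False)
    have "1 + (y / x)\<^sup>2 = (x\<^sup>2 + y\<^sup>2) / x\<^sup>2"
      using False by (simp add: field_simps)
    then have "sqrt (1 + (y / x)\<^sup>2) = norm k / \<bar>x\<bar>"
      by (simp add: n real_sqrt_divide)
    then have "cos (arctan (y / x)) = \<bar>x\<bar> / norm k" "sin (arctan (y / x)) = y / x * (\<bar>x\<bar> / norm k)"
      by (simp_all add: cos_arctan sin_arctan)
    then show ?thesis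
      using False n(2) by (cases "x > 0") (auto simp: k plane_angle_def xi_def)
  qed
qed

lemma xi_eq_imp_angle_shift:
  assumes "xi \<alpha> = xi \<theta>"
  obtains m :: int where "\<theta> = \<alpha> + of_int m * (2 * pi)"
proof -
  have "sin \<theta> = sin \<alpha> \<and> cos \<theta> = cos \<alpha>" using assms by (simp add: xi_def)
  then obtain m :: int where "\<theta> = \<alpha> + 2 * pi * m" unfolding sin_cos_eq_iff by blast
  then show ?thesis by (intro that[of m]) simp
qed

lemma plane_angle_measurable [measurable]: "plane_angle \<in> borel_measurable borel"
  unfolding plane_angle_def by measurable

text \<open>
  The sum \<open>Z \<theta> \<sigma>\<close> of the Bessel series, as an integral.  Where \<open>zdot D g \<theta>\<close> is not integrable its
  value is \<open>0\<close> by the convention for Bochner integrals; these \<open>\<theta>\<close> form a null set.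
\<close>

definition zdot_spectrum :: "real \<Rightarrow> (real \<Rightarrow> real \<Rightarrow> real) \<Rightarrow> real \<Rightarrow> real \<Rightarrow> complex" where
  "zdot_spectrum D g \<theta> \<sigma> =
     (LINT \<gamma>:{0..<2 * pi}|lborel. complex_of_real (zdot D g \<theta> \<gamma>) * cis (- (D * \<sigma> * sin \<gamma>)))"

text \<open>The Fourier transform of the adjoint image, as a function on the plane of frequencies.\<close>

definition adjoint_spectrum :: "real \<Rightarrow> (real \<Rightarrow> real \<Rightarrow> real) \<Rightarrow> real \<times> real \<Rightarrow> complex" where
  "adjoint_spectrum D g k =
     complex_of_real (1 / norm k) * zdot_spectrum D g (plane_angle k) (norm k)"

lemma zdot_spectrum_measurable:
  assumes g: "fan_data g" and [measurable]: "u \<in> borel_measurable borel" "v \<in> borel_measurable borel"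
  shows "(\<lambda>x :: 'a::euclidean_space. zdot_spectrum D g (u x) (v x)) \<in> borel_measurable borel"
proof -
  note [measurable] = zdot_measurable[OF g]
  have "(\<lambda>p :: 'a \<times> real. indicat_real {0..<2 * pi} (snd p) *\<^sub>R
      (complex_of_real (zdot D g (u (fst p)) (snd p)) * cis (- (D * v (fst p) * sin (snd p))))) \<in> borel_measurable borel"
    by measurable
  from borel_measurable_parameter_integral[OF this] show ?thesis
    by (simp add: zdot_spectrum_def set_lebesgue_integral_def)
qed

lemma zdot_spectrum_antipodal:
  assumes g: "fan_data g"
  shows "zdot_spectrum D g (\<theta> + pi) (- \<sigma>) = zdot_spectrum D g \<theta> \<sigma>"
proof -
  note [measurable] = zdot_measurable[OF g]
  let ?p = "\<lambda>\<gamma>. complex_of_real (zdot D g \<theta> \<gamma>) * cis (- (D * \<sigma> * sin \<gamma>))"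
  have "zdot_spectrum D g (\<theta> + pi) (- \<sigma>) = (LINT \<gamma>:{0..<2 * pi}|lborel. ?p (\<gamma> + pi))"
    by (simp add: zdot_spectrum_def zdot_periodic(2)[OF g])
  also have "\<dots> = (LINT \<gamma>:{0..<2 * pi}|lborel. ?p \<gamma>)"
    by (rule set_integral_periodic_shift(1)) (auto simp: zdot_periodic(3)[OF g])
  finally show ?thesis by (simp add: zdot_spectrum_def)
qed

text \<open>
  The value does not depend on the choice of the polar angle, and the formula also holds for
  negative \<open>\<sigma>\<close>, as required by the polar coordinates with signed radius.
\<close>

lemma adjoint_spectrum_polar:
  assumes g: "fan_data g" and \<sigma>: "\<sigma> \<noteq> 0"
  shows "adjoint_spectrum D g (\<sigma> *\<^sub>R xi \<theta>) = complex_of_real (1 / \<bar>\<sigma>\<bar>) * zdot_spectrum D g \<theta> \<sigma>"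
proof -
  have nxi: "norm (xi \<alpha>) = 1" for \<alpha> by (simp add: xi_def norm_prod_def)
  have pos: "adjoint_spectrum D g (r *\<^sub>R xi \<alpha>) = complex_of_real (1 / r) * zdot_spectrum D g \<alpha> r"
    if r: "r > 0" for r \<alpha>
  proof -
    have n: "norm (r *\<^sub>R xi \<alpha>) = r" using r by (simp add: nxi)
    then have "r *\<^sub>R xi \<alpha> \<noteq> 0" using r by (metis norm_zero less_irrefl)
    from xi_plane_angle[OF this] have "r *\<^sub>R xi (plane_angle (r *\<^sub>R xi \<alpha>)) = r *\<^sub>R xi \<alpha>"
      by (simp only: n)
    then have "xi (plane_angle (r *\<^sub>R xi \<alpha>)) = xi \<alpha>" using r by simp
    then obtain m :: int where "\<alpha> = plane_angle (r *\<^sub>R xi \<alpha>) + of_int m * (2 * pi)"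
      by (rule xi_eq_imp_angle_shift)
    then have zz: "zdot D g (plane_angle (r *\<^sub>R xi \<alpha>)) \<gamma> = zdot D g \<alpha> \<gamma>" for \<gamma>
      using zdot_periodic(1)[OF g, of D "plane_angle (r *\<^sub>R xi \<alpha>)" m \<gamma>] by metis
    show ?thesis unfolding adjoint_spectrum_def n zdot_spectrum_def zz ..
  qed
  show ?thesis
  proof (cases "\<sigma> > 0")
    case True
    then show ?thesis using pos[of \<sigma> \<theta>] by simp
  next
    case False
    have "\<sigma> *\<^sub>R xi \<theta> = (- \<sigma>) *\<^sub>R xi (\<theta> + pi)" by (simp add: xi_def)
    then show ?thesis
      using pos[of "- \<sigma>" "\<theta> + pi"] False \<sigma> zdot_spectrum_antipodal[OF g, of D \<theta> \<sigma>] by simp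
  qed
qed

lemma adjoint_spectrum_pairing:
  assumes D: "D > 0" and g: "fan_data g" and \<phi>: "schwartz \<phi>"
  shows "integrable lborel (\<lambda>k. adjoint_spectrum D g k * \<phi> k)"
    and "(LINT k|lborel. adjoint_spectrum D g k * \<phi> k)
      = (LINT \<theta>:half_circle|lborel. LINT \<gamma>:{0..<2 * pi}|lborel.
           complex_of_real (zdot D g \<theta> \<gamma>) * radon (fourier \<phi>) (D * sin \<gamma>) \<theta>)"
proof -
  have "continuous_on UNIV \<phi>"
    using schwartz_derivatives[OF \<phi>] by blast
  then have pm [measurable]: "\<phi> \<in> borel_measurable borel"
    by (rule borel_measurable_continuous_onI)
  obtain C where C: "\<And>x. (1 + norm x) ^ 4 * norm (\<phi> x) \<le> C"
    using \<phi> unfolding schwartz_def by metis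
  have C1: "norm (\<phi> (\<sigma> *\<^sub>R xi \<theta>)) \<le> C * (1 / (1 + \<sigma>\<^sup>2))" for \<sigma> \<theta>
    using decay_in_coordinates[OF C, of "\<sigma> *\<^sub>R xi \<theta>" \<sigma> 0] norm_polar_frame[of \<sigma> \<theta> 0] by simp
  have Ci: "integrable lborel (\<lambda>\<sigma>::real. C * (1 / (1 + \<sigma>\<^sup>2)))"
    by (intro integrable_mult_right integrable_inverse_one_plus_square)
  have xm [measurable]: "(\<lambda>x. \<phi> (u x *\<^sub>R xi (v x))) \<in> borel_measurable M"
    if [measurable]: "u \<in> borel_measurable M" "v \<in> borel_measurable M" for u v and M :: "'x measure"
    by measurable
  note [measurable] = zdot_measurable[OF g] zdot_spectrum_measurable[OF g]
  let ?i = "indicat_real {0..<2 * pi}" and ?h = "indicat_real half_circle"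
  define n where "n \<theta> = (LINT \<gamma>:{0..<2 * pi}|lborel. \<bar>zdot D g \<theta> \<gamma>\<bar>)" for \<theta>
  have nm [measurable]: "n \<in> borel_measurable borel"
  proof -
    have "(\<lambda>p. ?i (snd p) *\<^sub>R \<bar>zdot D g (fst p) (snd p)\<bar>) \<in> borel_measurable borel" by measurable
    from borel_measurable_parameter_integral[OF this] show ?thesis
      by (simp add: n_def[abs_def] set_lebesgue_integral_def)
  qed
  have n_int: "integrable lborel (\<lambda>\<theta>. ?h \<theta> * n \<theta>)"
  proof -
    have "integrable (lborel \<Otimes>\<^sub>M lborel) (\<lambda>(\<theta>, \<gamma>). ?i \<theta> * (?i \<gamma> * \<bar>zdot D g \<theta> \<gamma>\<bar>))"
      using integrable_abs[OF zdot_integrable[OF D g, unfolded set_integrable_def]]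
      by (simp add: lborel_prod case_prod_unfold indicator_times abs_mult mult.assoc)
    from lborel_pair.integrable_fst[OF this] have "set_integrable lborel {0..<0 + 2 * pi} n"
      by (simp add: set_integrable_def n_def set_lebesgue_integral_def)
    moreover have "n (\<theta> + 2 * pi) = n \<theta>" for \<theta>
      using zdot_periodic(1)[OF g, of D \<theta> 1] by (simp add: n_def)
    ultimately have "set_integrable lborel {- (pi / 2)..<- (pi / 2) + 2 * pi} n"
      using set_integral_periodic(1)[OF nm, of "2 * pi" "- (pi / 2)" 0] by simp
    then have "set_integrable lborel half_circle n"
      by (rule set_integrable_subset) (use pi_gt_zero in auto)
    then show ?thesis by (simp add: set_integrable_def)
  qed
  \<comment> \<open>the integrand in polar coordinates; the factor \<open>\<bar>\<sigma>\<bar>\<close> of the area element has cancelled\<close>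
  define W where "W p = ?h (fst p) *\<^sub>R (zdot_spectrum D g (fst p) (snd p) * \<phi> (snd p *\<^sub>R xi (fst p)))" for p
  have Wm [measurable]: "W \<in> borel_measurable borel"
    unfolding W_def by measurable
  have Zn: "norm (zdot_spectrum D g \<theta> \<sigma>) \<le> n \<theta>" for \<theta> \<sigma>
    unfolding zdot_spectrum_def n_def set_lebesgue_integral_def
    by (rule order_trans[OF integral_norm_bound]) (simp add: norm_mult)
  have Wi: "integrable lborel W"
  proof (rule integrable_dominated_by_product[OF Wm n_int Ci])
    fix \<theta> \<sigma> :: real
    have "norm (zdot_spectrum D g \<theta> \<sigma> * \<phi> (\<sigma> *\<^sub>R xi \<theta>)) \<le> n \<theta> * (C * (1 / (1 + \<sigma>\<^sup>2)))"
      unfolding norm_mult by (intro mult_mono Zn C1 order_trans[OF norm_ge_zero Zn]) simp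
    then have "?h \<theta> * norm (zdot_spectrum D g \<theta> \<sigma> * \<phi> (\<sigma> *\<^sub>R xi \<theta>)) \<le> ?h \<theta> * (n \<theta> * (C * (1 / (1 + \<sigma>\<^sup>2))))"
      by (rule mult_left_mono) simp
    then show "norm (W (\<theta>, \<sigma>)) \<le> ?h \<theta> * n \<theta> * (C * (1 / (1 + \<sigma>\<^sup>2)))"
      by (simp add: W_def mult.assoc)
  qed
  define T where "T p = snd p *\<^sub>R xi (fst p)" for p :: "real \<times> real"
  have Tm [measurable]: "T \<in> borel_measurable borel"
    unfolding T_def by measurable
  have Fm [measurable]: "adjoint_spectrum D g \<in> borel_measurable borel"
    unfolding adjoint_spectrum_def[abs_def] by measurable
  let ?F = "\<lambda>k. adjoint_spectrum D g k * \<phi> k"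
  have eq: "emeasure lborel A = (\<integral>\<^sup>+p. ennreal (?h (fst p) * \<bar>snd p\<bar>) * indicator A (T p) \<partial>lborel)"
    if "A \<in> sets lborel" for A
  proof -
    have [measurable]: "A \<in> sets borel" using that by simp
    have "emeasure lborel A = (\<integral>\<^sup>+x. indicator A x \<partial>lborel)" by simp
    also have "\<dots> = (\<integral>\<^sup>+p. ennreal (?h (fst p) * \<bar>snd p\<bar>) * indicator A (T p) \<partial>lborel)"
      by (subst nn_integral_polar, measurable) (subst nn_integral_lborel_pair(1), auto simp: T_def)
    finally show ?thesis .
  qed
  have Tl: "T \<in> lborel \<rightarrow>\<^sub>M lborel" "(\<lambda>p. ?h (fst p) * \<bar>snd p\<bar>) \<in> borel_measurable (lborel :: (real \<times> real) measure)"
    and Fl: "?F \<in> borel_measurable lborel" and nonneg: "0 \<le> ?h (fst p) * \<bar>snd p\<bar>" for p :: "real \<times> real"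
    by (simp_all, measurable)
  note cov = change_of_variables[OF Tl nonneg eq Fl]
  have Wl: "(\<lambda>p. (?h (fst p) * \<bar>snd p\<bar>) *\<^sub>R ?F (T p)) \<in> borel_measurable lborel" by measurable
  have AE: "AE p in lborel. (?h (fst p) * \<bar>snd p\<bar>) *\<^sub>R ?F (T p) = W p"
  proof -
    have "AE p :: real \<times> real in lborel \<Otimes>\<^sub>M lborel. snd p \<noteq> 0"
      by (rule lborel_pair.AE_pair_measure, measurable) (simp add: AE_lborel_singleton)
    then have "AE p :: real \<times> real in lborel. snd p \<noteq> 0"
      unfolding lborel_prod .
    then show ?thesis
    proof eventually_elim
      fix p :: "real \<times> real" assume "snd p \<noteq> 0"
      then show "(?h (fst p) * \<bar>snd p\<bar>) *\<^sub>R ?F (T p) = W p"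
        by (simp add: T_def W_def adjoint_spectrum_polar[OF g] scaleR_conv_of_real)
    qed
  qed
  have "integrable lborel (\<lambda>p. (?h (fst p) * \<bar>snd p\<bar>) *\<^sub>R ?F (T p))"
    using Wi by (subst integrable_cong_AE[OF Wl _ AE]) auto
  then show "integrable lborel ?F"
    by (simp only: cov(1))
  have "integral\<^sup>L lborel ?F = (LINT p|lborel. (?h (fst p) * \<bar>snd p\<bar>) *\<^sub>R ?F (T p))"
    by (rule cov(2))
  also have "\<dots> = integral\<^sup>L lborel W"
    by (rule integral_cong_AE[OF Wl _ AE]) simp
  also have Wip: "integrable (lborel \<Otimes>\<^sub>M lborel) (\<lambda>(\<theta>, \<sigma>). W (\<theta>, \<sigma>))"
    using Wi by (simp add: lborel_prod)
  then have "integral\<^sup>L lborel W = (LINT \<theta>|lborel. LINT \<sigma>|lborel. W (\<theta>, \<sigma>))"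
    using lborel_pair.integral_fst[OF Wip] by (simp add: lborel_prod)
  also have "\<dots> = (LINT \<theta>|lborel. ?h \<theta> *\<^sub>R (LINT \<gamma>:{0..<2 * pi}|lborel.
           complex_of_real (zdot D g \<theta> \<gamma>) * radon (fourier \<phi>) (D * sin \<gamma>) \<theta>))"
  proof (rule integral_cong_AE)
    show "(\<lambda>\<theta>. LINT \<sigma>|lborel. W (\<theta>, \<sigma>)) \<in> borel_measurable lborel"
      using lborel_pair.integrable_fst[OF Wip] by (rule borel_measurable_integrable)
    have [measurable]: "(\<lambda>x. radon (fourier \<phi>) (u x) (v x)) \<in> borel_measurable M"
      if [measurable]: "u \<in> borel_measurable M" "v \<in> borel_measurable M" for u v and M :: "'x measure"
      using measurable_compose[OF _ radon_measurable[OF borel_measurable_fourier[OF pm]], of "\<lambda>x. (u x, v x)" M] by simp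
    have "(\<lambda>p. ?i (snd p) *\<^sub>R (complex_of_real (zdot D g (fst p) (snd p)) * radon (fourier \<phi>) (D * sin (snd p)) (fst p))) \<in> borel_measurable borel"
      by measurable
    from borel_measurable_parameter_integral[OF this]
    show "(\<lambda>\<theta>. ?h \<theta> *\<^sub>R (LINT \<gamma>:{0..<2 * pi}|lborel.
           complex_of_real (zdot D g \<theta> \<gamma>) * radon (fourier \<phi>) (D * sin \<gamma>) \<theta>)) \<in> borel_measurable lborel"
      by (simp add: set_lebesgue_integral_def)
    show "AE \<theta> in lborel. (LINT \<sigma>|lborel. W (\<theta>, \<sigma>)) = ?h \<theta> *\<^sub>R (LINT \<gamma>:{0..<2 * pi}|lborel.
           complex_of_real (zdot D g \<theta> \<gamma>) * radon (fourier \<phi>) (D * sin \<gamma>) \<theta>)"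
      using AE_zdot_integrable[OF D g]
    proof eventually_elim
      fix \<theta> assume "set_integrable lborel {0..2 * pi} (zdot D g \<theta>)"
      then have zi: "integrable lborel (\<lambda>\<gamma>. \<bar>?i \<gamma> * zdot D g \<theta> \<gamma>\<bar>)"
        unfolding set_integral_Icc_Ico(1) by (auto simp: set_integrable_def)
      let ?G = "\<lambda>\<gamma> \<sigma>. ?i \<gamma> *\<^sub>R (complex_of_real (zdot D g \<theta> \<gamma>) * (\<phi> (\<sigma> *\<^sub>R xi \<theta>) * cis (- (\<sigma> * (D * sin \<gamma>)))))"
      have "integrable lborel (\<lambda>p. ?G (fst p) (snd p))"
      proof (rule integrable_dominated_by_product[OF _ zi Ci])
        show "(\<lambda>p. ?G (fst p) (snd p)) \<in> borel_measurable borel" by measurable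
        show "norm (?G (fst (\<gamma>, \<sigma>)) (snd (\<gamma>, \<sigma>))) \<le> \<bar>?i \<gamma> * zdot D g \<theta> \<gamma>\<bar> * (C * (1 / (1 + \<sigma>\<^sup>2)))" for \<gamma> \<sigma>
          using mult_left_mono[OF C1[of \<sigma> \<theta>], of "\<bar>?i \<gamma> * zdot D g \<theta> \<gamma>\<bar>"]
          by (simp add: norm_mult abs_mult mult.assoc)
      qed
      then have Gi: "integrable (lborel \<Otimes>\<^sub>M lborel) (case_prod ?G)"
        by (simp add: lborel_prod case_prod_unfold)
      have "(LINT \<sigma>|lborel. zdot_spectrum D g \<theta> \<sigma> * \<phi> (\<sigma> *\<^sub>R xi \<theta>)) = (LINT \<sigma>|lborel. LINT \<gamma>|lborel. ?G \<gamma> \<sigma>)"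
      proof (rule Bochner_Integration.integral_cong)
        fix \<sigma>
        have "zdot_spectrum D g \<theta> \<sigma> * \<phi> (\<sigma> *\<^sub>R xi \<theta>)
          = (LINT \<gamma>:{0..<2 * pi}|lborel. complex_of_real (zdot D g \<theta> \<gamma>) * cis (- (D * \<sigma> * sin \<gamma>)) * \<phi> (\<sigma> *\<^sub>R xi \<theta>))"
          unfolding zdot_spectrum_def by (rule set_integral_mult_left[symmetric])
        also have "\<dots> = (LINT \<gamma>|lborel. ?G \<gamma> \<sigma>)"
          unfolding set_lebesgue_integral_def
          by (rule Bochner_Integration.integral_cong) (simp_all add: mult_ac)
        finally show "zdot_spectrum D g \<theta> \<sigma> * \<phi> (\<sigma> *\<^sub>R xi \<theta>) = (LINT \<gamma>|lborel. ?G \<gamma> \<sigma>)" .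
      qed simp
      also have "\<dots> = (LINT \<gamma>|lborel. LINT \<sigma>|lborel. ?G \<gamma> \<sigma>)"
        by (rule lborel_pair.Fubini_integral[OF Gi])
      also have "\<dots> = (LINT \<gamma>:{0..<2 * pi}|lborel. complex_of_real (zdot D g \<theta> \<gamma>) * radon (fourier \<phi>) (D * sin \<gamma>) \<theta>)"
        by (simp add: set_lebesgue_integral_def fourier_slice[OF \<phi>])
      finally show "(LINT \<sigma>|lborel. W (\<theta>, \<sigma>)) = ?h \<theta> *\<^sub>R (LINT \<gamma>:{0..<2 * pi}|lborel.
           complex_of_real (zdot D g \<theta> \<gamma>) * radon (fourier \<phi>) (D * sin \<gamma>) \<theta>)"
        by (simp add: W_def)
    qed
  qed
  finally show "integral\<^sup>L lborel ?F = (LINT \<theta>:half_circle|lborel. LINT \<gamma>:{0..<2 * pi}|lborel.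
           complex_of_real (zdot D g \<theta> \<gamma>) * radon (fourier \<phi>) (D * sin \<gamma>) \<theta>)"
    by (simp add: set_lebesgue_integral_def[of lborel half_circle])
qed

lemma schwartz_decay:
  assumes "schwartz f"
  obtains C where "\<And>x. norm (f x) \<le> C / (1 + (norm x)\<^sup>2)"
proof -
  obtain C where C: "\<And>x. (1 + norm x) ^ 4 * norm (f x) \<le> C"
    using assms unfolding schwartz_def by metis
  have "norm (f x) \<le> C / (1 + (norm x)\<^sup>2)" for x
    using decay_in_coordinates[OF C, of x "norm x" 0] by simp
  then show ?thesis using that by blast
qed

lemma schwartz_measurable: "schwartz f \<Longrightarrow> f \<in> borel_measurable borel"
  using schwartz_derivatives[of f] by (blast intro: borel_measurable_continuous_onI)

lemma has_fourier_fan_adjoint: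
  assumes D: "D > 0" and g: "fan_data g"
  shows "has_fourier (\<lambda>x. complex_of_real (fan_adjoint D g x)) (adjoint_spectrum D g)"
  unfolding has_fourier_def
proof (intro allI impI)
  fix \<phi> assume \<phi>: "schwartz \<phi>"
  obtain C where C: "\<And>k. norm (fourier \<phi> k) \<le> C / (1 + (norm k)\<^sup>2)"
    using fourier_schwartz_decay[OF \<phi>] by blast
  have m: "fourier \<phi> \<in> borel_measurable borel"
    by (rule borel_measurable_fourier[OF schwartz_measurable[OF \<phi>]])
  show "integrable lborel (\<lambda>x. complex_of_real (fan_adjoint D g x) * fourier \<phi> x) \<and>
      integrable lborel (\<lambda>k. adjoint_spectrum D g k * \<phi> k) \<and>
      (LINT x|lborel. complex_of_real (fan_adjoint D g x) * fourier \<phi> x) = (LINT k|lborel. adjoint_spectrum D g k * \<phi> k)"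
    using fan_adjoint_pairing(2,3)[OF D g m C] fan_pairing_parallel[OF D g m C]
      adjoint_spectrum_pairing[OF D g \<phi>]
    by (simp add: mult.commute)
qed

text \<open>
  With \<open>s = D tan \<gamma>\<close>, consistency equates the datum at \<open>(s, \<theta> - \<gamma>)\<close> with the one at
  \<open>(- s, \<theta> + \<pi> + \<gamma>)\<close>, angles being taken modulo \<open>2 \<pi>\<close>, and the latter angle is \<open>\<theta> - (\<pi> - \<gamma>)\<close>.
\<close>

lemma line_consistent_zdot:
  assumes g: "fan_data g" and D: "D > 0" and l: "line_consistent D g"
  shows "zdot D g \<theta> (pi - \<gamma>) = zdot D g \<theta> \<gamma>"
proof (cases "cos \<gamma> = 0")
  case False
  define \<alpha> where "\<alpha> = arctan (tan \<gamma>)"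
  have "cos \<alpha> \<noteq> 0" unfolding \<alpha>_def by simp
  moreover have "tan \<alpha> = tan \<gamma>" unfolding \<alpha>_def by (rule tan_arctan)
  ultimately have "sin (\<gamma> - \<alpha>) = 0"
    using False by (simp add: sin_diff tan_def field_simps)
  then obtain k :: int where "\<gamma> - \<alpha> = of_int k * pi"
    unfolding sin_zero_iff_int2 by blast
  then have \<alpha>: "\<alpha> = \<gamma> - of_int k * pi" by simp
  have "g (- (D * tan \<gamma>)) (\<theta> - \<gamma> + pi + 2 * \<alpha>) = g (D * tan \<gamma>) (\<theta> - \<gamma>)"
    using l[unfolded line_consistent_def, rule_format, of "D * tan \<gamma>" "\<theta> - \<gamma>"] D by (simp add: \<alpha>_def)
  moreover have "g (- (D * tan \<gamma>)) (\<theta> - \<gamma> + pi + 2 * \<alpha>) = g (- (D * tan \<gamma>)) (\<theta> - (pi - \<gamma>))"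
    using fan_data_periodic(2)[OF g, of "- (D * tan \<gamma>)" "\<theta> - (pi - \<gamma>)" "1 - k"]
    by (simp add: \<alpha> algebra_simps)
  ultimately show ?thesis
    by (simp add: zdot_eq tan_def cos_diff sin_diff power_divide)
qed (simp add: zdot_eq cos_diff)

lemma zdot_spectrum_fan:
  assumes g: "fan_data g" and D: "D > 0" and l: "line_consistent D g"
    and z: "set_integrable lborel {0..2 * pi} (zdot D g \<theta>)"
  shows "set_integrable lborel {0..2 * pi} (zdot_fan D g \<theta>)"
    and "2 * (LINT \<gamma>:{0..2 * pi}|lborel. complex_of_real (zdot_fan D g \<theta> \<gamma>) * cis (- (D * \<sigma> * sin \<gamma>))) = zdot_spectrum D g \<theta> \<sigma>"
proof -
  note [measurable] = zdot_measurable[OF g]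
  have restr: "set_integrable lborel {0..2 * pi} (\<lambda>\<gamma>. zdot D g \<theta> \<gamma> * (if P \<gamma> then 1 else 0))"
    if [measurable]: "Measurable.pred borel P" for P
    by (rule set_integrable_mult_bounded[OF z, of _ 1]) auto
  have fan_eq: "zdot_fan D g \<theta> = (\<lambda>\<gamma>. zdot D g \<theta> \<gamma> * (if 0 < cos \<gamma> then 1 else 0))"
    by (auto simp: zdot_fan_def)
  have pos: "Measurable.pred borel (\<lambda>\<gamma>::real. 0 < cos \<gamma>)" and neg: "Measurable.pred borel (\<lambda>\<gamma>::real. cos \<gamma> < 0)"
    by (rule borel_measurable_pred_less; simp)+
  show fi: "set_integrable lborel {0..2 * pi} (zdot_fan D g \<theta>)"
    unfolding fan_eq by (rule restr[OF pos])
  define e where "e \<gamma> = cis (- (D * \<sigma> * sin \<gamma>))" for \<gamma>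
  have [measurable]: "e \<in> borel_measurable borel" unfolding e_def by measurable
  define rear where "rear \<gamma> = zdot D g \<theta> \<gamma> * (if cos \<gamma> < 0 then 1 else 0)" for \<gamma>
  have bi: "set_integrable lborel {0..2 * pi} rear"
    unfolding rear_def by (rule restr[OF neg])
  have cplx: "set_integrable lborel {0..<2 * pi} (\<lambda>\<gamma>. complex_of_real (z \<gamma>) * e \<gamma>)"
    if "set_integrable lborel {0..2 * pi} z" for z
  proof (rule set_integrable_mult_bounded[where C = 1])
    show "set_integrable lborel {0..<2 * pi} (\<lambda>\<gamma>. complex_of_real (z \<gamma>))"
      using that[unfolded set_integral_Icc_Ico(1)] unfolding set_integrable_def
      by (auto simp: scaleR_conv_of_real dest: integrable_of_real[where 'a = complex])
  qed (auto simp: e_def)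
  have [measurable]: "rear \<in> borel_measurable borel" unfolding rear_def by measurable
  have "(LINT \<gamma>:{0..<2 * pi}|lborel. complex_of_real (rear \<gamma>) * e \<gamma>)
    = (LINT \<gamma>:{0..<2 * pi}|lborel. complex_of_real (rear (pi - \<gamma>)) * e (pi - \<gamma>))"
    by (rule set_integral_periodic_shift(2)[symmetric])
       (auto simp: rear_def e_def zdot_periodic(3)[OF g])
  also have "\<dots> = (LINT \<gamma>:{0..<2 * pi}|lborel. complex_of_real (zdot_fan D g \<theta> \<gamma>) * e \<gamma>)"
    by (simp add: rear_def e_def fan_eq line_consistent_zdot[OF g D l] cos_diff sin_diff)
  finally have b: "(LINT \<gamma>:{0..<2 * pi}|lborel. complex_of_real (rear \<gamma>) * e \<gamma>)
    = (LINT \<gamma>:{0..<2 * pi}|lborel. complex_of_real (zdot_fan D g \<theta> \<gamma>) * e \<gamma>)" .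
  have "zdot D g \<theta> \<gamma> = zdot_fan D g \<theta> \<gamma> + rear \<gamma>" for \<gamma>
    by (cases "cos \<gamma> = 0") (auto simp: fan_eq rear_def zdot_eq)
  then have "zdot_spectrum D g \<theta> \<sigma> = (LINT \<gamma>:{0..<2 * pi}|lborel.
      complex_of_real (zdot_fan D g \<theta> \<gamma>) * e \<gamma> + complex_of_real (rear \<gamma>) * e \<gamma>)"
    by (simp add: zdot_spectrum_def e_def distrib_right)
  also have "\<dots> = (LINT \<gamma>:{0..<2 * pi}|lborel. complex_of_real (zdot_fan D g \<theta> \<gamma>) * e \<gamma>)
      + (LINT \<gamma>:{0..<2 * pi}|lborel. complex_of_real (rear \<gamma>) * e \<gamma>)"
    by (rule set_integral_add(2)[OF cplx[OF fi] cplx[OF bi]])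
  finally show "2 * (LINT \<gamma>:{0..2 * pi}|lborel. complex_of_real (zdot_fan D g \<theta> \<gamma>) * cis (- (D * \<sigma> * sin \<gamma>))) = zdot_spectrum D g \<theta> \<sigma>"
    unfolding b set_integral_Icc_Ico(2) by (simp add: e_def)
qed

theorem theorem4:
  fixes D :: real and g :: "real \<Rightarrow> real \<Rightarrow> real"
  assumes "D > 0" and "fan_data g"
  shows "is_fan_adjoint_image D g (fan_adjoint D g) \<and>
    (AE \<theta> in lborel. set_integrable lborel {0..2 * pi} (zdot D g \<theta>)) \<and>
    (\<exists>F. has_fourier (\<lambda>x. complex_of_real (fan_adjoint D g x)) F \<and>
      (\<forall>\<theta> \<sigma>. set_integrable lborel {0..2 * pi} (zdot D g \<theta>) \<longrightarrow> \<sigma> > 0 \<longrightarrow>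
        (line_consistent D g \<longrightarrow>
           summable (\<lambda>n. bessel_coeff (zdot_fan D g \<theta>) n * complex_of_real (bessel_J n (D * \<sigma>))) \<and>
           F (\<sigma> *\<^sub>R xi \<theta>) = complex_of_real (2 / \<sigma>) *
             (\<Sum>n. bessel_coeff (zdot_fan D g \<theta>) n * complex_of_real (bessel_J n (D * \<sigma>)))) \<and>
        summable (\<lambda>n. bessel_coeff (zdot D g \<theta>) n * complex_of_real (bessel_J n (D * \<sigma>))) \<and>
        F (\<sigma> *\<^sub>R xi \<theta>) = complex_of_real (1 / \<sigma>) *
          (\<Sum>n. bessel_coeff (zdot D g \<theta>) n * complex_of_real (bessel_J n (D * \<sigma>)))))"
proof (intro conjI exI[of _ "adjoint_spectrum D g"] allI impI)
  show "is_fan_adjoint_image D g (fan_adjoint D g)"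
    unfolding is_fan_adjoint_image_def
  proof (intro allI impI)
    fix f assume f: "schwartz f"
    obtain C where C: "\<And>x. norm (f x) \<le> C / (1 + (norm x)\<^sup>2)"
      using schwartz_decay[OF f] by blast
    note pairing = fan_adjoint_pairing[OF assms schwartz_measurable[OF f] C]
    show "set_integrable lborel (UNIV \<times> {0..2 * pi}) (\<lambda>(s, \<beta>). fan_radon D f s \<beta> * complex_of_real (g s \<beta>)) \<and>
        integrable lborel (\<lambda>x. f x * complex_of_real (fan_adjoint D g x)) \<and>
        (LINT y:UNIV \<times> {0..2 * pi}|lborel. (case y of (s, \<beta>) \<Rightarrow> fan_radon D f s \<beta> * complex_of_real (g s \<beta>))) =
        (LINT x|lborel. f x * complex_of_real (fan_adjoint D g x))"
      using pairing by blast
  qed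
  show "AE \<theta> in lborel. set_integrable lborel {0..2 * pi} (zdot D g \<theta>)"
    by (rule AE_zdot_integrable[OF assms])
  show "has_fourier (\<lambda>x. complex_of_real (fan_adjoint D g x)) (adjoint_spectrum D g)"
    by (rule has_fourier_fan_adjoint[OF assms])
  fix \<theta> \<sigma> :: real
  assume z: "set_integrable lborel {0..2 * pi} (zdot D g \<theta>)" and \<sigma>: "\<sigma> > 0"
  have F: "adjoint_spectrum D g (\<sigma> *\<^sub>R xi \<theta>) = complex_of_real (1 / \<sigma>) * zdot_spectrum D g \<theta> \<sigma>"
    using adjoint_spectrum_polar[OF assms(2), of \<sigma> D \<theta>] \<sigma> by simp
  note series = bessel_coeff_series[OF z, of "D * \<sigma>"]
  show "summable (\<lambda>n. bessel_coeff (zdot D g \<theta>) n * complex_of_real (bessel_J n (D * \<sigma>)))"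
    using series by (rule sums_summable)
  show "adjoint_spectrum D g (\<sigma> *\<^sub>R xi \<theta>) = complex_of_real (1 / \<sigma>) *
      (\<Sum>n. bessel_coeff (zdot D g \<theta>) n * complex_of_real (bessel_J n (D * \<sigma>)))"
    unfolding F sums_unique[OF series, symmetric] zdot_spectrum_def set_integral_Icc_Ico(2) ..
  assume l: "line_consistent D g"
  note fan = zdot_spectrum_fan[OF assms(2,1) l z]
  note fan_series = bessel_coeff_series[OF fan(1), of "D * \<sigma>"]
  show "summable (\<lambda>n. bessel_coeff (zdot_fan D g \<theta>) n * complex_of_real (bessel_J n (D * \<sigma>)))"
    using fan_series by (rule sums_summable)
  show "adjoint_spectrum D g (\<sigma> *\<^sub>R xi \<theta>) = complex_of_real (2 / \<sigma>) *
      (\<Sum>n. bessel_coeff (zdot_fan D g \<theta>) n * complex_of_real (bessel_J n (D * \<sigma>)))"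
    unfolding F sums_unique[OF fan_series, symmetric] fan(2)[of \<sigma>, symmetric] by simp
qed

end
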